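(* Every $\aleph_0$-categorical Banach space $M$ contains isometric copies of $c_0$ or $\ell_p$ (for some $1\leqslant p<\infty$). Moreover, $M$ contains an isometric copy of $\ell_2$.
   Context: Banach spaces are regarded as structures of continuous first-order logic in the usual language of Banach spaces. For $1\leqslant p<\infty$, $\ell_p$ is the Banach space of real sequences with $\|x\|_p=(\sum|x_n|^p)^{1/p}<\infty$, and $c_0$ is the Banach space of real null sequences with the supremum norm. A separable Banach space $M$ is $\aleph_0$-categorical if it is $\mathfrak{p}_{\mathrm{id}}$-$\aleph_0$-categorical, where $\mathfrak{p}_{\mathrm{id}}$ is the strictest perturbation system, i.e. the identity system, in which each complete type is perturbed only to itself: between any two separable models of the complete continuous first-order theory of $M$ there is a bijection preserving the complete types (over $\emptyset$) of all finite tuples. In other words, the theory of $M$ has an infinite model and any two separable models of it are isometric (isomorphic). An isometric copy of $Y$ in $M$ is a linear subspace of $M$ linearly isometric to $Y$.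
   Formalization: The "infinite model" in the definition of ℵ₀-categorical is taken to be an infinite-dimensional (non-compact) model; otherwise nonzero finite-dimensional spaces such as ℝ, the only model of its theory, would be ℵ₀-categorical yet contain no copy of c₀ or any ℓ_p. *)

theory Defs
  imports "HOL-Analysis.Analysis" "HOL-Library.More_List"
begin

section \<open>Banach spaces as structures with a carrier set\<close>

text \<open>
  Categoricity quantifies over all separable models of a theory, and this quantification takes
  place inside a formula.  Models can therefore not be instances of the type class
  \<^class>\<open>banach\<close>; they are records with an explicit carrier set.
\<close>

record 'a space =
  vcarrier :: "'a set"
  vzero :: 'a
  vadd :: "'a \<Rightarrow> 'a \<Rightarrow> 'a"
  vscale :: "real \<Rightarrow> 'a \<Rightarrow> 'a"
  vnorm :: "'a \<Rightarrow> real"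

locale vnormed =
  fixes V :: "'a space"
  assumes zero_closed: "vzero V \<in> vcarrier V"
    and add_closed: "\<lbrakk>x \<in> vcarrier V; y \<in> vcarrier V\<rbrakk> \<Longrightarrow> vadd V x y \<in> vcarrier V"
    and scale_closed: "x \<in> vcarrier V \<Longrightarrow> vscale V r x \<in> vcarrier V"
    and add_assoc: "\<lbrakk>x \<in> vcarrier V; y \<in> vcarrier V; z \<in> vcarrier V\<rbrakk>
          \<Longrightarrow> vadd V (vadd V x y) z = vadd V x (vadd V y z)"
    and add_commute: "\<lbrakk>x \<in> vcarrier V; y \<in> vcarrier V\<rbrakk> \<Longrightarrow> vadd V x y = vadd V y x"
    and add_zero: "x \<in> vcarrier V \<Longrightarrow> vadd V (vzero V) x = x"
    and add_inverse: "x \<in> vcarrier V \<Longrightarrow> \<exists>y\<in>vcarrier V. vadd V x y = vzero V"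
    and scale_add_right: "\<lbrakk>x \<in> vcarrier V; y \<in> vcarrier V\<rbrakk>
          \<Longrightarrow> vscale V r (vadd V x y) = vadd V (vscale V r x) (vscale V r y)"
    and scale_add_left: "x \<in> vcarrier V
          \<Longrightarrow> vscale V (r + s) x = vadd V (vscale V r x) (vscale V s x)"
    and scale_scale: "x \<in> vcarrier V \<Longrightarrow> vscale V r (vscale V s x) = vscale V (r * s) x"
    and scale_one: "x \<in> vcarrier V \<Longrightarrow> vscale V 1 x = x"
    and norm_eq_zero: "x \<in> vcarrier V \<Longrightarrow> vnorm V x = 0 \<longleftrightarrow> x = vzero V"
    and norm_scale: "x \<in> vcarrier V \<Longrightarrow> vnorm V (vscale V r x) = \<bar>r\<bar> * vnorm V x"
    and norm_triangle: "\<lbrakk>x \<in> vcarrier V; y \<in> vcarrier V\<rbrakk>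
          \<Longrightarrow> vnorm V (vadd V x y) \<le> vnorm V x + vnorm V y"

text \<open>
  The value \<open>0\<close> outside the carrier is only there because the locale \<^locale>\<open>Metric_space\<close>
  requires symmetry and nonnegativity of the distance on the whole type.
\<close>

definition vdist :: "'a space \<Rightarrow> 'a \<Rightarrow> 'a \<Rightarrow> real" where
  "vdist V x y =
     (if x \<in> vcarrier V \<and> y \<in> vcarrier V then vnorm V (vadd V x (vscale V (- 1) y)) else 0)"

definition vbanach :: "'a space \<Rightarrow> bool" where
  "vbanach V \<longleftrightarrow> vnormed V \<and> Metric_space.mcomplete (vcarrier V) (vdist V)"

definition vseparable :: "'a space \<Rightarrow> bool" where
  "vseparable V \<longleftrightarrow> separable_space (Metric_space.mtopology (vcarrier V) (vdist V))"

definition vball :: "'a space \<Rightarrow> real \<Rightarrow> 'a set" where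
  "vball V r = {x \<in> vcarrier V. vnorm V x \<le> r}"

definition lin_comb :: "'a space \<Rightarrow> real list \<Rightarrow> 'a list \<Rightarrow> 'a" where
  "lin_comb V cs bs = foldr (\<lambda>(c, b) x. vadd V (vscale V c b) x) (zip cs bs) (vzero V)"

definition infinite_dimensional :: "'a space \<Rightarrow> bool" where
  "infinite_dimensional V \<longleftrightarrow>
     \<not> (\<exists>bs. set bs \<subseteq> vcarrier V \<and>
          (\<forall>x\<in>vcarrier V. \<exists>cs. length cs = length bs \<and> x = lin_comb V cs bs))"

definition vsubspace :: "'a space \<Rightarrow> 'a set \<Rightarrow> bool" where
  "vsubspace V S \<longleftrightarrow> S \<subseteq> vcarrier V \<and> vzero V \<in> S \<and>
     (\<forall>x\<in>S. \<forall>y\<in>S. vadd V x y \<in> S) \<and> (\<forall>r. \<forall>x\<in>S. vscale V r x \<in> S)"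

definition isometric_copy :: "'b space \<Rightarrow> 'a space \<Rightarrow> 'a set \<Rightarrow> bool" where
  "isometric_copy Y V S \<longleftrightarrow> vsubspace V S \<and>
     (\<exists>T. bij_betw T (vcarrier Y) S \<and>
        (\<forall>x\<in>vcarrier Y. \<forall>y\<in>vcarrier Y. T (vadd Y x y) = vadd V (T x) (T y)) \<and>
        (\<forall>r. \<forall>x\<in>vcarrier Y. T (vscale Y r x) = vscale V r (T x)) \<and>
        (\<forall>x\<in>vcarrier Y. vnorm V (T x) = vnorm Y x))"

definition contains_isometric_copy :: "'a space \<Rightarrow> 'b space \<Rightarrow> bool" where
  "contains_isometric_copy V Y \<longleftrightarrow> (\<exists>S. isometric_copy Y V S)"

definition ell :: "real \<Rightarrow> (nat \<Rightarrow> real) space" where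
  "ell p = \<lparr> vcarrier = {x. summable (\<lambda>n. \<bar>x n\<bar> powr p)},
             vzero = (\<lambda>n. 0),
             vadd = (\<lambda>x y n. x n + y n),
             vscale = (\<lambda>r x n. r * x n),
             vnorm = (\<lambda>x. (\<Sum>n. \<bar>x n\<bar> powr p) powr (1 / p)) \<rparr>"

definition c_zero :: "(nat \<Rightarrow> real) space" where
  "c_zero = \<lparr> vcarrier = {x. x \<longlonglongrightarrow> 0},
              vzero = (\<lambda>n. 0),
              vadd = (\<lambda>x y n. x n + y n),
              vscale = (\<lambda>r x n. r * x n),
              vnorm = (\<lambda>x. SUP n. \<bar>x n\<bar>) \<rparr>"


section \<open>Continuous first-order logic of Banach spaces\<close>

text \<open>
  The language is the usual many-sorted one: for every integer \<open>n \<ge> 1\<close> there is a sort for the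
  closed ball of radius \<open>n\<close>, with function symbols for \<open>0\<close>, addition and multiplication by each real
  scalar between the appropriate sorts, inclusion maps between the balls, and a predicate symbol
  for the norm.  All sorts are subsets of one vector space, so neither the inclusion maps nor the
  sort of a term affects values: they are not written, and the only visible trace of the sorts is
  the radius that bounds each quantified variable.  The distance of two terms is the norm of their
  difference.
\<close>

datatype bterm = Var nat | Zero | Add bterm bterm | Scale real bterm

text \<open>
  A connective of arity \<open>n\<close> is a continuous function of \<open>n\<close> real arguments.  It is represented by
  a continuous function on \<open>nat \<Rightarrow> real\<close> (with the product topology), which is evaluated at the
  list of \<open>n\<close> arguments extended by \<open>0\<close>.
\<close>

datatype bform =
    Norm bterm
  | Conn "(nat \<Rightarrow> real) \<Rightarrow> real" "bform list"
  | FSup nat nat bform  \<comment> \<open>\<open>FSup x n \<phi>\<close>: supremum of \<open>\<phi>\<close> over \<open>x\<close> in the ball of radius \<open>n\<close>\<close>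
  | FInf nat nat bform

fun tvars :: "bterm \<Rightarrow> nat set" where
  "tvars (Var x) = {x}"
| "tvars Zero = {}"
| "tvars (Add s t) = tvars s \<union> tvars t"
| "tvars (Scale r t) = tvars t"

fun fvars :: "bform \<Rightarrow> nat set" where
  "fvars (Norm t) = tvars t"
| "fvars (Conn u \<phi>s) = (\<Union>\<phi>\<in>set \<phi>s. fvars \<phi>)"
| "fvars (FSup x n \<phi>) = fvars \<phi> - {x}"
| "fvars (FInf x n \<phi>) = fvars \<phi> - {x}"

fun wf_form :: "bform \<Rightarrow> bool" where
  "wf_form (Norm t) \<longleftrightarrow> True"
| "wf_form (Conn u \<phi>s) \<longleftrightarrow> continuous_on UNIV u \<and> (\<forall>\<phi>\<in>set \<phi>s. wf_form \<phi>)"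
| "wf_form (FSup x n \<phi>) \<longleftrightarrow> 1 \<le> n \<and> wf_form \<phi>"
| "wf_form (FInf x n \<phi>) \<longleftrightarrow> 1 \<le> n \<and> wf_form \<phi>"

fun tvalue :: "'a space \<Rightarrow> (nat \<Rightarrow> 'a) \<Rightarrow> bterm \<Rightarrow> 'a" where
  "tvalue V s (Var x) = s x"
| "tvalue V s Zero = vzero V"
| "tvalue V s (Add t t') = vadd V (tvalue V s t) (tvalue V s t')"
| "tvalue V s (Scale r t) = vscale V r (tvalue V s t)"

text \<open>
  Well-formed formulas are bounded on bounded sets, so the suprema and infima below are those of
  nonempty bounded sets of reals.
\<close>

fun fvalue :: "'a space \<Rightarrow> (nat \<Rightarrow> 'a) \<Rightarrow> bform \<Rightarrow> real" where
  "fvalue V s (Norm t) = vnorm V (tvalue V s t)"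
| "fvalue V s (Conn u \<phi>s) = u (nth_default 0 (map (fvalue V s) \<phi>s))"
| "fvalue V s (FSup x n \<phi>) = (SUP a\<in>vball V (real n). fvalue V (s(x := a)) \<phi>)"
| "fvalue V s (FInf x n \<phi>) = (INF a\<in>vball V (real n). fvalue V (s(x := a)) \<phi>)"

text \<open>
  The complete type over the empty set of a finite tuple, given as a list; the variable
  \<open>i\<close> stands for the \<open>i\<close>-th entry.  As in continuous logic generally, a condition is an equation
  \<open>\<phi> = 0\<close>; since \<open>\<phi> - r\<close> is again a formula, the type determines all values \<open>\<phi>(as)\<close>.
\<close>

definition complete_type :: "'a space \<Rightarrow> 'a list \<Rightarrow> bform set" where
  "complete_type V as =
     {\<phi>. wf_form \<phi> \<and> fvars \<phi> \<subseteq> {..<length as} \<and> fvalue V (nth_default (vzero V) as) \<phi> = 0}"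

definition theory_of :: "'a space \<Rightarrow> bform set" where
  "theory_of V = {\<phi>. wf_form \<phi> \<and> fvars \<phi> = {} \<and> fvalue V (\<lambda>_. vzero V) \<phi> = 0}"

definition model_of :: "'a space \<Rightarrow> bform set \<Rightarrow> bool" where
  "model_of V \<Gamma> \<longleftrightarrow> vbanach V \<and> (\<forall>\<phi>\<in>\<Gamma>. fvalue V (\<lambda>_. vzero V) \<phi> = 0)"

definition type_preserving_bijection :: "'a space \<Rightarrow> 'b space \<Rightarrow> ('a \<Rightarrow> 'b) \<Rightarrow> bool" where
  "type_preserving_bijection V W f \<longleftrightarrow> bij_betw f (vcarrier V) (vcarrier W) \<and>
     (\<forall>as. set as \<subseteq> vcarrier V \<longrightarrow> complete_type W (map f as) = complete_type V as)"

text \<open>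
  Models range over spaces whose carrier is a set of real sequences.  This is no restriction:
  a separable metric space has at most continuum many points, so every separable Banach space is
  isomorphic to one of this form, and by the downward Loewenheim-Skolem theorem a theory of Banach
  spaces with an infinite-dimensional model has a separable one.

  An infinite structure of continuous logic is a non-compact one, which for a Banach space
  means infinite-dimensional (the balls, which are the sorts, are not compact); a nonzero
  finite-dimensional space does not count as infinite although its carrier is an infinite set.
\<close>

definition aleph0_categorical :: "'a space \<Rightarrow> bool" where
  "aleph0_categorical V \<longleftrightarrow> vbanach V \<and> vseparable V \<and>
     (\<exists>N :: (nat \<Rightarrow> real) space. model_of N (theory_of V) \<and> infinite_dimensional N) \<and>
     (\<forall>(N1 :: (nat \<Rightarrow> real) space) (N2 :: (nat \<Rightarrow> real) space).
        model_of N1 (theory_of V) \<and> vseparable N1 \<and>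
        model_of N2 (theory_of V) \<and> vseparable N2 \<longrightarrow>
        (\<exists>f. type_preserving_bijection N1 N2 f))"


section \<open>Agreement with the library notions\<close>

context vnormed
begin

lemma zero_scale: "x \<in> vcarrier V \<Longrightarrow> vscale V 0 x = vzero V"
  by (metis abs_zero mult_zero_left norm_eq_zero norm_scale scale_closed)

lemma add_neg: "x \<in> vcarrier V \<Longrightarrow> vadd V x (vscale V (- 1) x) = vzero V"
  using scale_add_left[of x 1 "- 1"] by (simp add: scale_one zero_scale)

lemma norm_nonneg: assumes "x \<in> vcarrier V" shows "0 \<le> vnorm V x"
proof -
  have "vnorm V (vzero V) = 0"
    using norm_eq_zero[OF zero_closed] by blast
  then show ?thesis
    using norm_triangle[OF assms scale_closed[OF assms], of "- 1"] assms
    by (simp add: add_neg norm_scale)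
qed

lemma vdist_commute: "vdist V x y = vdist V y x"
proof (cases "x \<in> vcarrier V \<and> y \<in> vcarrier V")
  case True
  then have "vscale V (- 1) (vadd V x (vscale V (- 1) y)) = vadd V y (vscale V (- 1) x)"
    by (simp add: scale_add_right scale_scale scale_one scale_closed add_commute)
  with True show ?thesis
    using norm_scale[of "vadd V x (vscale V (- 1) y)" "- 1"]
    by (simp add: vdist_def add_closed scale_closed)
qed (auto simp: vdist_def)

lemma diff_eq_zero:
  assumes "x \<in> vcarrier V" "y \<in> vcarrier V" "vadd V x (vscale V (- 1) y) = vzero V"
  shows "x = y"
proof -
  have "vadd V (vadd V x (vscale V (- 1) y)) y = vadd V x (vadd V y (vscale V (- 1) y))"
    using assms(1,2) by (simp add: add_assoc scale_closed add_commute)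
  then show ?thesis
    using assms by (simp add: add_neg add_zero add_commute[of x "vzero V"] zero_closed)
qed

lemma vdist_triangle:
  assumes "x \<in> vcarrier V" "y \<in> vcarrier V" "z \<in> vcarrier V"
  shows "vdist V x z \<le> vdist V x y + vdist V y z"
proof -
  let ?n = "vscale V (- 1)"
  have c: "?n y \<in> vcarrier V" "?n z \<in> vcarrier V"
    using assms by (simp_all add: scale_closed)
  have "vadd V (?n y) (vadd V y (?n z)) = vadd V (vadd V y (?n y)) (?n z)"
    using assms c by (simp add: add_commute flip: add_assoc)
  also have "\<dots> = ?n z"
    using assms c by (simp add: add_neg add_zero)
  finally have "vadd V (vadd V x (?n y)) (vadd V y (?n z)) = vadd V x (?n z)"
    using assms c by (simp add: add_assoc add_closed)
  then show ?thesis
    using norm_triangle[of "vadd V x (?n y)" "vadd V y (?n z)"] assms c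
    by (simp add: vdist_def add_closed)
qed

lemma Metric_space_vdist: "Metric_space (vcarrier V) (vdist V)"
proof
  show "0 \<le> vdist V x y" for x y
    by (simp add: vdist_def norm_nonneg add_closed scale_closed)
  show "vdist V x y = 0 \<longleftrightarrow> x = y" if "x \<in> vcarrier V" "y \<in> vcarrier V" for x y
    using that diff_eq_zero[of x y]
    by (auto simp: vdist_def norm_eq_zero add_closed scale_closed add_neg)
qed (use vdist_commute vdist_triangle in auto)

end

definition space_of_class :: "'a::real_normed_vector space" where
  "space_of_class = \<lparr> vcarrier = UNIV, vzero = 0, vadd = (+), vscale = (*\<^sub>R), vnorm = norm \<rparr>"

lemma vbanach_space_of_class: "vbanach (space_of_class :: 'a::banach space)"
proof -
  have "vnormed (space_of_class :: 'a space)"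
    by unfold_locales
      (auto simp: space_of_class_def algebra_simps norm_triangle_ineq
            intro: exI[of _ "- x" for x])
  moreover have "vdist (space_of_class :: 'a space) = dist"
    by (auto simp: vdist_def space_of_class_def dist_norm fun_eq_iff)
  moreover have "Met_TC.mcomplete TYPE('a)"
    using complete_UNIV by (metis mcomplete_iff_complete)
  ultimately show ?thesis
    by (simp add: vbanach_def) (simp add: space_of_class_def)
qed

end

theory Submission
  imports Defs "HOL-Library.Function_Algebras"
begin

text \<open>
  Everything follows from the last conjunct, because \<open>ell 2\<close> is one of the spaces
  that the first conjunct allows. By categoricity it is enough to exhibit one separable model of
  the theory of \<open>M\<close> that contains \<open>\<ell>\<^sub>2\<close> isometrically:
  \<open>M\<close>, copied onto a set of real sequences, is another separable model, and a
  bijection between models that preserves types is a linear isometry, since the graphs of addition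
  and of the scalar multiplications and the values of the norm are part of the types.

  The model comes from an infinite-dimensional model \<open>N\<close>. By Dvoretzky's theorem
  \<open>N\<close> contains almost isometric copies of all finite-dimensional Euclidean spaces, so
  an ultrapower of \<open>N\<close> contains a sequence equivalent, isometrically, to the unit
  vectors of \<open>\<ell>\<^sub>2\<close>. Closing this sequence under rational linear
  combinations and countably many Skolem functions, and then taking the closure, gives a separable
  subspace \<open>W\<close> of the ultrapower that has the same theory as \<open>N\<close>
  (\<open>skolem_hull.W_theory\<close>); countably many Skolem functions suffice because every
  formula is, uniformly on bounded sets, a limit of formulas with rational coefficients
  (\<open>vnormed.wf_form_approx\<close>).

  Dvoretzky's theorem is proved here in its qualitative form, with averages over random signs. A
  separated bounded sequence \<open>e\<close> has a spreading limit, the iterated ultrafilter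
  limit of \<open>\<parallel>a\<^sub>1 e(n\<^sub>1) + \<dots> + a\<^sub>r
  e(n\<^sub>r)\<parallel>\<close>, in which setting to zero one coefficient of a combination of
  differences \<open>e(n\<^sub>1) - e(n\<^sub>2)\<close>, \<open>e(n\<^sub>3) -
  e(n\<^sub>4)\<close>, \<open>\<dots>\<close> does not increase the norm
  (\<open>separated_sequence.iter_lim_suppress\<close>). For such a norm \<open>f\<close> there
  are finite systems of vectors \<open>w\<^sub>b\<close> for which \<open>f (\<Sum>b. c\<^sub>b
  w\<^sub>b)\<close> is at most the Euclidean norm of \<open>c\<close>, while the average of
  \<open>f (\<Sum>b. \<plusminus>w\<^sub>b)\<close> over all signs is as large as desired
  (\<open>suppression_family.growth\<close>). Replace each sign by a normalized sum of many signs,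
  weighted by a unit vector \<open>a\<close>. By the central limit theorem the average then hardly
  depends on the direction \<open>a\<close> (\<open>seminorm.clt_seminorm\<close>), and by the
  Efron--Stein inequality its variance stays bounded (\<open>seminorm.radsum_variance\<close>).
  Since the average is large compared with the deviation, one choice of signs serves finitely many
  directions at once, and it spans an almost Euclidean section
  (\<open>suppression_family.almost_Euclidean\<close>).
\<close>

section \<open>Averages over independent random signs\<close>

text \<open>
  A pattern of signs on \<open>I\<close> is coded by the set \<open>S \<subseteq> I\<close> of the
  indices with a positive sign, so averages over independent random signs are finite sums over
  \<open>Pow I\<close>.
\<close>

definition sign_mean :: "'i set \<Rightarrow> ('i set \<Rightarrow> real) \<Rightarrow> real" where
  "sign_mean I F = (\<Sum>S\<in>Pow I. F S) / 2 ^ card I"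

definition sgnof :: "'i set \<Rightarrow> 'i \<Rightarrow> real" where
  "sgnof S i = (if i \<in> S then 1 else -1)"

lemma sgnof_sq [simp]: "sgnof S i * sgnof S i = 1" "(sgnof S i)\<^sup>2 = 1" "\<bar>sgnof S i\<bar> = 1"
  by (auto simp: sgnof_def)

lemma sign_mean_empty [simp]: "sign_mean {} F = F {}"
  by (simp add: sign_mean_def)

lemma sign_mean_insert:
  assumes "finite I" "j \<notin> I"
  shows "sign_mean (insert j I) F = (sign_mean I F + sign_mean I (\<lambda>S. F (insert j S))) / 2"
proof -
  have "(\<Sum>S\<in>Pow (insert j I). F S) = (\<Sum>S\<in>Pow I. F S) + (\<Sum>S\<in>insert j ` Pow I. F S)"
    unfolding Pow_insert using assms by (intro sum.union_disjoint) auto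
  also have "(\<Sum>S\<in>insert j ` Pow I. F S) = (\<Sum>S\<in>Pow I. F (insert j S))"
    using assms by (subst sum.reindex) (auto simp: inj_on_def)
  finally show ?thesis
    using assms by (simp add: sign_mean_def add_divide_distrib)
qed

lemma sign_mean_cong:
  "(\<And>S. S \<subseteq> I \<Longrightarrow> F S = G S) \<Longrightarrow> sign_mean I F = sign_mean I G"
  by (auto simp: sign_mean_def intro!: sum.cong)

lemma sign_mean_mono:
  "(\<And>S. S \<subseteq> I \<Longrightarrow> F S \<le> G S) \<Longrightarrow> sign_mean I F \<le> sign_mean I G"
  by (auto simp: sign_mean_def intro!: divide_right_mono sum_mono)

lemma sign_mean_const [simp]: "finite I \<Longrightarrow> sign_mean I (\<lambda>_. c) = c"
  by (simp add: sign_mean_def card_Pow)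

lemma sign_mean_add: "sign_mean I (\<lambda>S. F S + G S) = sign_mean I F + sign_mean I G"
  by (simp add: sign_mean_def sum.distrib add_divide_distrib)

lemma sign_mean_diff: "sign_mean I (\<lambda>S. F S - G S) = sign_mean I F - sign_mean I G"
  by (simp add: sign_mean_def sum_subtractf diff_divide_distrib)

lemma sign_mean_cmult: "sign_mean I (\<lambda>S. c * F S) = c * sign_mean I F"
  by (simp add: sign_mean_def sum_distrib_left)

lemma sign_mean_sum: "sign_mean I (\<lambda>S. \<Sum>a\<in>A. F a S) = (\<Sum>a\<in>A. sign_mean I (F a))"
  unfolding sign_mean_def by (subst sum.swap) (simp add: sum_divide_distrib)

lemma sign_mean_le_exists:
  assumes "finite I" "sign_mean I F \<le> c"
  shows "\<exists>S\<subseteq>I. F S \<le> c"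
proof (rule ccontr)
  assume "\<not> ?thesis"
  then have less: "\<And>S. S \<in> Pow I \<Longrightarrow> c < F S"
    by (meson PowD not_le)
  have "(\<Sum>S\<in>Pow I. c) < (\<Sum>S\<in>Pow I. F S)"
    using assms less by (intro sum_strict_mono) auto
  then have "c < sign_mean I F"
    using assms by (simp add: sign_mean_def card_Pow field_simps)
  with assms show False
    by simp
qed

lemma sign_mean_flip:
  assumes "D \<subseteq> I"
  shows "sign_mean I (\<lambda>S. F (sym_diff S D)) = sign_mean I F"
proof -
  have "(\<Sum>S\<in>Pow I. F (sym_diff S D)) = (\<Sum>S\<in>Pow I. F S)"
    using assms
    by (intro sum.reindex_bij_witness[of _ "\<lambda>S. sym_diff S D" "\<lambda>S. sym_diff S D"]) auto
  then show ?thesis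
    by (simp add: sign_mean_def)
qed

lemma sign_mean_Un:
  assumes "finite J" "finite I" "I \<inter> J = {}"
  shows "sign_mean (I \<union> J) F = sign_mean I (\<lambda>S. sign_mean J (\<lambda>R. F (S \<union> R)))"
  using assms
proof (induction J arbitrary: F rule: finite_induct)
  case (insert j J)
  then have "sign_mean (I \<union> insert j J) F =
      (sign_mean (I \<union> J) F + sign_mean (I \<union> J) (\<lambda>S. F (insert j S))) / 2"
    using sign_mean_insert[of "I \<union> J" j F] by simp
  also have "\<dots> = (sign_mean I (\<lambda>S. sign_mean J (\<lambda>R. F (S \<union> R))) +
      sign_mean I (\<lambda>S. sign_mean J (\<lambda>R. F (insert j (S \<union> R))))) / 2"
    using insert by simp
  also have "\<dots> = sign_mean I (\<lambda>S. (1 / 2) * (sign_mean J (\<lambda>R. F (S \<union> R)) +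
      sign_mean J (\<lambda>R. F (insert j (S \<union> R)))))"
    by (simp only: sign_mean_cmult sign_mean_add)
  also have "\<dots> = sign_mean I (\<lambda>S. sign_mean (insert j J) (\<lambda>R. F (S \<union> R)))"
    using insert by (simp add: sign_mean_insert)
  finally show ?case .
qed simp

lemma sign_mean_marginal:
  assumes "finite I" "J \<subseteq> I" "\<And>S. S \<subseteq> I \<Longrightarrow> F S = F (S \<inter> J)"
  shows "sign_mean I F = sign_mean J F"
proof -
  have fin: "finite J" "finite (I - J)"
    using assms finite_subset by auto
  have "sign_mean I F = sign_mean (J \<union> (I - J)) F"
    using assms by (simp add: Un_absorb1)
  also have "\<dots> = sign_mean J (\<lambda>S. sign_mean (I - J) (\<lambda>R. F (S \<union> R)))"
    using fin by (intro sign_mean_Un) auto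
  also have "\<dots> = sign_mean J (\<lambda>S. sign_mean (I - J) (\<lambda>R. F S))"
  proof (intro sign_mean_cong)
    fix S R assume S: "S \<subseteq> J" and R: "R \<subseteq> I - J"
    then have "(S \<union> R) \<inter> J = S" "S \<union> R \<subseteq> I" using assms by auto
    then show "F (S \<union> R) = F S" using assms(3)[of "S \<union> R"] by simp
  qed
  finally show ?thesis using fin by simp
qed

lemma sign_mean_reindex:
  assumes "inj_on h I"
  shows "sign_mean (h ` I) F = sign_mean I (\<lambda>S. F (h ` S))"
proof -
  have "(\<Sum>S\<in>Pow (h ` I). F S) = (\<Sum>S\<in>(`) h ` Pow I. F S)"
    by (simp add: image_Pow_surj)
  also have "\<dots> = (\<Sum>S\<in>Pow I. F (h ` S))"
    using assms by (subst sum.reindex) (auto simp: inj_on_image_Pow)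
  finally show ?thesis
    using assms by (simp add: sign_mean_def card_image)
qed

text \<open>
  The characteristic function of a weighted sum of signs; the phase \<open>\<phi>\<close> makes
  the induction work and later yields sines as well.
\<close>

lemma sign_mean_cos:
  assumes "finite I"
  shows "sign_mean I (\<lambda>S. cos (\<phi> + (\<Sum>i\<in>I. \<theta> i * sgnof S i))) = cos \<phi> * (\<Prod>i\<in>I. cos (\<theta> i))"
  using assms
proof (induction I arbitrary: \<phi> rule: finite_induct)
  case (insert j I)
  have 1: "sign_mean I (\<lambda>S. cos (\<phi> + (\<Sum>i\<in>insert j I. \<theta> i * sgnof S i))) =
      sign_mean I (\<lambda>S. cos ((\<phi> - \<theta> j) + (\<Sum>i\<in>I. \<theta> i * sgnof S i)))"
  proof (rule sign_mean_cong)
    fix S assume "S \<subseteq> I"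
    with insert have "j \<notin> S" by auto
    then show "cos (\<phi> + (\<Sum>i\<in>insert j I. \<theta> i * sgnof S i)) =
       cos ((\<phi> - \<theta> j) + (\<Sum>i\<in>I. \<theta> i * sgnof S i))"
      using insert by (simp add: sgnof_def algebra_simps)
  qed
  have 2: "sign_mean I (\<lambda>S. cos (\<phi> + (\<Sum>i\<in>insert j I. \<theta> i * sgnof (insert j S) i))) =
      sign_mean I (\<lambda>S. cos ((\<phi> + \<theta> j) + (\<Sum>i\<in>I. \<theta> i * sgnof S i)))"
  proof (rule sign_mean_cong)
    fix S assume "S \<subseteq> I"
    have "(\<Sum>i\<in>I. \<theta> i * sgnof (insert j S) i) = (\<Sum>i\<in>I. \<theta> i * sgnof S i)"
      using insert by (intro sum.cong) (auto simp: sgnof_def)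
    then show "cos (\<phi> + (\<Sum>i\<in>insert j I. \<theta> i * sgnof (insert j S) i)) =
       cos ((\<phi> + \<theta> j) + (\<Sum>i\<in>I. \<theta> i * sgnof S i))"
      using insert by (simp add: sgnof_def add.assoc)
  qed
  show ?case
    unfolding sign_mean_insert[OF insert(1,2)] 1 2 insert.IH
    using insert(1,2) by (simp add: cos_add cos_diff algebra_simps)
qed simp

lemma sign_mean_square_le:
  assumes "finite I"
  shows "(sign_mean I F)\<^sup>2 \<le> sign_mean I (\<lambda>S. (F S)\<^sup>2)"
proof -
  let ?m = "sign_mean I F"
  have "0 \<le> sign_mean I (\<lambda>S. (F S - ?m)\<^sup>2)"
    using sign_mean_mono[of I "\<lambda>_. 0"] assms by simp
  also have "(\<lambda>S. (F S - ?m)\<^sup>2) = (\<lambda>S. (F S)\<^sup>2 - (2 * ?m) * F S + ?m\<^sup>2)"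
    by (auto simp: power2_eq_square algebra_simps)
  also have "sign_mean I \<dots> = sign_mean I (\<lambda>S. (F S)\<^sup>2) - ?m\<^sup>2"
    using assms
    by (simp add: sign_mean_add sign_mean_diff sign_mean_cmult power2_eq_square)
  finally show ?thesis by simp
qed

text \<open>
  The Efron--Stein inequality: variance is subadditive over the coordinates. Splitting off one
  sign \<open>j\<close> leaves the mean of the two conditional variances, to which the induction
  hypothesis applies, and a quarter of the squared difference of the two conditional means, which
  by convexity is at most a quarter of the mean squared effect of the sign \<open>j\<close>.
\<close>

lemma Efron_Stein:
  assumes "finite I"
  shows "sign_mean I (\<lambda>S. (F S)\<^sup>2) - (sign_mean I F)\<^sup>2
    \<le> (\<Sum>i\<in>I. sign_mean I (\<lambda>S. (F (insert i S) - F (S - {i}))\<^sup>2)) / 4"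
  using assms
proof (induction I arbitrary: F rule: finite_induct)
  case (insert j I)
  define G where "G S = F (insert j S)" for S
  let ?E = "sign_mean I"
  have IH: "?E (\<lambda>S. (H S)\<^sup>2) - (?E H)\<^sup>2
     \<le> (\<Sum>i\<in>I. ?E (\<lambda>S. (H (insert i S) - H (S - {i}))\<^sup>2)) / 4" for H
    by (rule insert.IH)
  have j: "sign_mean (insert j I) (\<lambda>S. (F (insert j S) - F (S - {j}))\<^sup>2) = ?E (\<lambda>S. (G S - F S)\<^sup>2)"
  proof -
    have "S - {j} = S" if "S \<subseteq> I" for S using that insert by auto
    then have "?E (\<lambda>S. (F (insert j S) - F (S - {j}))\<^sup>2) = ?E (\<lambda>S. (G S - F S)\<^sup>2)"
      by (intro sign_mean_cong) (simp add: G_def)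
    then show ?thesis
      using insert \<open>\<And>S. S \<subseteq> I \<Longrightarrow> S - {j} = S\<close>
      by (simp add: sign_mean_insert G_def cong: sign_mean_cong)
  qed
  have i: "sign_mean (insert j I) (\<lambda>S. (F (insert i S) - F (S - {i}))\<^sup>2) =
     (?E (\<lambda>S. (F (insert i S) - F (S - {i}))\<^sup>2) + ?E (\<lambda>S. (G (insert i S) - G (S - {i}))\<^sup>2)) / 2"
    if "i \<in> I" for i
  proof -
    have "insert i (insert j S) = insert j (insert i S)" "insert j S - {i} = insert j (S - {i})" for S
      using that insert by auto
    then show ?thesis
      using insert by (simp add: sign_mean_insert G_def)
  qed
  have eq: "sign_mean (insert j I) (\<lambda>S. (F S)\<^sup>2) - (sign_mean (insert j I) F)\<^sup>2 =
      ((?E (\<lambda>S. (F S)\<^sup>2) - (?E F)\<^sup>2) + (?E (\<lambda>S. (G S)\<^sup>2) - (?E G)\<^sup>2)) / 2 + (?E G - ?E F)\<^sup>2 / 4"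
    using insert by (simp add: sign_mean_insert G_def[symmetric] power2_eq_square field_simps)
  have "sign_mean (insert j I) (\<lambda>S. (F S)\<^sup>2) - (sign_mean (insert j I) F)\<^sup>2 \<le>
     ((\<Sum>i\<in>I. ?E (\<lambda>S. (F (insert i S) - F (S - {i}))\<^sup>2)) / 4 +
      (\<Sum>i\<in>I. ?E (\<lambda>S. (G (insert i S) - G (S - {i}))\<^sup>2)) / 4) / 2 + ?E (\<lambda>S. (G S - F S)\<^sup>2) / 4"
  proof -
    have "x \<le> (p + q) / 2 + d / 4" if "x = (a + b) / 2 + c / 4" "a \<le> p" "b \<le> q" "c \<le> d"
      for x a b c d p q :: real
      using that by (simp add: field_simps)
    from this[OF eq IH[of F] IH[of G]] show ?thesis
      using sign_mean_square_le[OF insert(1), of "\<lambda>S. G S - F S"] by (simp add: sign_mean_diff)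
  qed
  also have "\<dots> = (\<Sum>i\<in>insert j I. sign_mean (insert j I) (\<lambda>S. (F (insert i S) - F (S - {i}))\<^sup>2)) / 4"
    using insert(1,2) by (simp add: j i sum.distrib add_divide_distrib flip: sum_divide_distrib)
  finally show ?case .
qed simp

locale seminorm =
  fixes f :: "'v::real_vector \<Rightarrow> real"
  assumes subadd: "f (x + y) \<le> f x + f y"
    and homog: "f (c *\<^sub>R x) = \<bar>c\<bar> * f x"
begin

lemma f_zero [simp]: "f 0 = 0"
  using homog[of 0 0] by simp

lemma f_minus: "f (- x) = f x"
  using homog[of "-1" x] by simp

lemma f_nonneg: "0 \<le> f x"
  using subadd[of x "- x"] by (simp add: f_minus)

lemma f_sum: "f (\<Sum>i\<in>I. w i) \<le> (\<Sum>i\<in>I. f (w i))"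
  by (induction I rule: infinite_finite_induct) (auto intro: order_trans[OF subadd])

lemma f_diff: "\<bar>f x - f y\<bar> \<le> f (x - y)"
  using subadd[of "x - y" y] subadd[of "y - x" x] f_minus[of "x - y"] by simp

lemma f_sum_scaled_le: "f (\<Sum>i\<in>I. c i *\<^sub>R w i) \<le> (\<Sum>i\<in>I. \<bar>c i\<bar> * f (w i))"
  using f_sum[of "\<lambda>i. c i *\<^sub>R w i" I] by (simp add: homog)

text \<open>
  For a convex function, a convex combination of the drops caused by single steps is at most the
  drop caused by the same combination of the steps; any missing weight is given to the zero step.
\<close>

lemma convex_step:
  assumes "finite I" "\<And>i. i \<in> I \<Longrightarrow> 0 \<le> c i" "(\<Sum>i\<in>I. c i) \<le> 1"
  shows "(\<Sum>i\<in>I. c i * (f x - f (x - u i))) \<le> f x - f (x - (\<Sum>i\<in>I. c i *\<^sub>R u i))"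
proof -
  have "x - (\<Sum>i\<in>I. c i *\<^sub>R u i) = (1 - (\<Sum>i\<in>I. c i)) *\<^sub>R x + (\<Sum>i\<in>I. c i *\<^sub>R (x - u i))"
    by (simp add: scaleR_right_diff_distrib sum_subtractf scaleR_left_diff_distrib scaleR_sum_left)
  then have "f (x - (\<Sum>i\<in>I. c i *\<^sub>R u i)) \<le> (1 - (\<Sum>i\<in>I. c i)) * f x + (\<Sum>i\<in>I. c i * f (x - u i))"
    using subadd[of "(1 - (\<Sum>i\<in>I. c i)) *\<^sub>R x" "\<Sum>i\<in>I. c i *\<^sub>R (x - u i)"]
      f_sum_scaled_le[of c "\<lambda>i. x - u i" I] assms
    by (simp add: homog)
  then show ?thesis
    by (simp add: right_diff_distrib left_diff_distrib sum_subtractf flip: sum_distrib_right)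
qed

text \<open>
  The weak 2-norm of the system \<open>w\<close> is at most 1: the map \<open>c \<mapsto> \<Sum>i.
  c i w i\<close> from the Euclidean space is a contraction.
\<close>

definition weak2 :: "'i set \<Rightarrow> ('i \<Rightarrow> 'v) \<Rightarrow> bool" where
  "weak2 I w \<longleftrightarrow> (\<forall>c. f (\<Sum>i\<in>I. c i *\<^sub>R w i) \<le> sqrt (\<Sum>i\<in>I. (c i)\<^sup>2))"

lemma weak2D: "weak2 I w \<Longrightarrow> f (\<Sum>i\<in>I. c i *\<^sub>R w i) \<le> sqrt (\<Sum>i\<in>I. (c i)\<^sup>2)"
  by (auto simp: weak2_def)

text \<open>
  This replaces the gradient of \<open>f\<close>, which need not exist: if \<open>f\<close> were
  differentiable at \<open>x\<close>, the drops would be at most \<open>T\<close> times the moduli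
  of the coordinates of the gradient along the \<open>w i\<close>, a vector of Euclidean norm at
  most 1. Instead, step from \<open>x\<close> by all \<open>t i w i\<close> at once, with weights
  proportional to the drops \<open>d i\<close>; by convexity the function drops at least by a
  multiple of \<open>\<Sum>i. (d i)\<^sup>2\<close>, and by the weak 2-norm at most by the same
  multiple of \<open>T\<close> times the square root of this sum.
\<close>

lemma sum_sq_drops_le:
  assumes fin: "finite I" and w: "weak2 I w" and t: "\<And>i. i \<in> I \<Longrightarrow> \<bar>t i\<bar> \<le> T"
  shows "(\<Sum>i\<in>I. (max 0 (f x - f (x - (t i) *\<^sub>R w i)))\<^sup>2) \<le> T\<^sup>2"
proof -
  define d where "d i = max 0 (f x - f (x - (t i) *\<^sub>R w i))" for i
  define D where "D = (\<Sum>i\<in>I. (d i)\<^sup>2)"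
  (* The factor only ensures that the weights \<open>s * d i\<close> add up to at most 1. *)
  define s where "s = 1 / (1 + (\<Sum>i\<in>I. d i))"
  have d0: "0 \<le> d i" for i by (simp add: d_def)
  then have sd: "0 \<le> (\<Sum>i\<in>I. d i)" by (simp add: sum_nonneg)
  then have s: "s > 0" by (simp add: s_def add_pos_nonneg)
  have D0: "D \<ge> 0" by (simp add: D_def sum_nonneg)
  have T: "T \<ge> 0" if "I \<noteq> {}" using t that by fastforce
  have "s * D = (\<Sum>i\<in>I. (s * d i) * (f x - f (x - (t i) *\<^sub>R w i)))"
    unfolding D_def sum_distrib_left
    by (intro sum.cong refl) (auto simp: d_def max_def power2_eq_square)
  also have "\<dots> \<le> f x - f (x - (\<Sum>i\<in>I. (s * d i) *\<^sub>R (t i *\<^sub>R w i)))"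
  proof (rule convex_step[OF fin])
    show "0 \<le> s * d i" for i using s d0 by simp
    show "(\<Sum>i\<in>I. s * d i) \<le> 1"
      using sd unfolding sum_distrib_left[symmetric] by (simp add: s_def divide_simps)
  qed
  also have "\<dots> \<le> f (\<Sum>i\<in>I. (s * d i * t i) *\<^sub>R w i)"
    using f_diff[of x "x - (\<Sum>i\<in>I. (s * d i) *\<^sub>R (t i *\<^sub>R w i))"] by simp
  also have "\<dots> \<le> sqrt (\<Sum>i\<in>I. (s * d i * t i)\<^sup>2)"
    by (rule weak2D[OF w])
  also have "\<dots> \<le> sqrt (s\<^sup>2 * T\<^sup>2 * D)"
  proof -
    have "(s * d i * t i)\<^sup>2 \<le> s\<^sup>2 * T\<^sup>2 * (d i)\<^sup>2" if "i \<in> I" for i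
    proof -
      have "(t i)\<^sup>2 \<le> T\<^sup>2" using t[OF that] by (simp add: abs_le_square_iff[symmetric])
      then have "(s\<^sup>2 * (d i)\<^sup>2) * (t i)\<^sup>2 \<le> (s\<^sup>2 * (d i)\<^sup>2) * T\<^sup>2" by (intro mult_left_mono) auto
      then show ?thesis by (simp add: power_mult_distrib mult_ac)
    qed
    then show ?thesis
      unfolding D_def sum_distrib_left by (intro real_sqrt_le_mono sum_mono)
  qed
  also have "\<dots> = s * (\<bar>T\<bar> * sqrt D)"
    using s by (simp add: real_sqrt_mult)
  finally have "D \<le> \<bar>T\<bar> * sqrt D"
    using s by simp
  then have "sqrt D * sqrt D \<le> \<bar>T\<bar> * sqrt D" using D0 by simp
  then have "sqrt D \<le> \<bar>T\<bar>"
    using D0 by (cases "D = 0") (auto simp: mult_le_cancel_right simp del: real_sqrt_mult_self)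
  then have "(sqrt D)\<^sup>2 \<le> \<bar>T\<bar>\<^sup>2" by (intro power_mono) (auto simp: D0)
  then have "D \<le> T\<^sup>2" using D0 by simp
  then show ?thesis by (simp add: D_def d_def)
qed

definition radsum :: "'i set \<Rightarrow> ('i \<Rightarrow> 'v) \<Rightarrow> 'i set \<Rightarrow> 'v" where
  "radsum I w S = (\<Sum>i\<in>I. sgnof S i *\<^sub>R w i)"

text \<open>
  By the Efron--Stein inequality the variance is at most a quarter of the summed mean squared
  effects of the single sign flips. Flipping a sign twice gives back the original pattern, so the
  mean squared effect of a flip is twice the mean squared drop, and at each pattern the squared
  drops add up to at most \<open>2\<^sup>2\<close>.
\<close>

lemma radsum_variance:
  assumes fin: "finite I" and w: "weak2 I w"
  shows "sign_mean I (\<lambda>S. (f (radsum I w S) - sign_mean I (\<lambda>S. f (radsum I w S)))\<^sup>2) \<le> 2"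
proof -
  define F where "F S = f (radsum I w S)" for S
  define m where "m = sign_mean I F"
  have drop: "radsum I w (sym_diff S {i}) = radsum I w S - (2 * sgnof S i) *\<^sub>R w i" if "i \<in> I" for i S
  proof -
    have "(\<Sum>k\<in>I-{i}. sgnof (sym_diff S {i}) k *\<^sub>R w k) = (\<Sum>k\<in>I-{i}. sgnof S k *\<^sub>R w k)"
      by (intro sum.cong) (auto simp: sgnof_def)
    then show ?thesis
      using that fin by (auto simp: radsum_def sum.remove sgnof_def algebra_simps scaleR_2)
  qed
  have i: "sign_mean I (\<lambda>S. (F (insert i S) - F (S - {i}))\<^sup>2) =
     2 * sign_mean I (\<lambda>S. (max 0 (F S - F (sym_diff S {i})))\<^sup>2)" if i: "i \<in> I" for i
  proof -
    have "(F (insert i S) - F (S - {i}))\<^sup>2 =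
      (max 0 (F S - F (sym_diff S {i})))\<^sup>2 + (max 0 (F (sym_diff S {i}) - F (sym_diff (sym_diff S {i}) {i})))\<^sup>2" for S
    proof (cases "i \<in> S")
      case True
      then have "insert i S = S" "sym_diff S {i} = S - {i}" "sym_diff (sym_diff S {i}) {i} = S" by auto
      then show ?thesis by (auto simp: max_def power2_eq_square algebra_simps)
    next
      case False
      then have "S - {i} = S" "sym_diff S {i} = insert i S" "sym_diff (sym_diff S {i}) {i} = S" by auto
      then show ?thesis by (auto simp: max_def power2_eq_square algebra_simps)
    qed
    then show ?thesis
      using sign_mean_flip[of "{i}" I "\<lambda>S. (max 0 (F S - F (sym_diff S {i})))\<^sup>2"] i
      by (simp add: sign_mean_add)
  qed
  have "sign_mean I (\<lambda>S. (F S - m)\<^sup>2) = sign_mean I (\<lambda>S. (F S)\<^sup>2) - m\<^sup>2"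
  proof -
    have "(\<lambda>S. (F S - m)\<^sup>2) = (\<lambda>S. (F S)\<^sup>2 - (2 * m) * F S + m\<^sup>2)"
      by (auto simp: power2_eq_square algebra_simps)
    then show ?thesis
      using fin m_def by (simp add: sign_mean_add sign_mean_diff sign_mean_cmult power2_eq_square)
  qed
  also have "\<dots> \<le> (\<Sum>i\<in>I. 2 * sign_mean I (\<lambda>S. (max 0 (F S - F (sym_diff S {i})))\<^sup>2)) / 4"
    using Efron_Stein[OF fin, of F] i by (simp add: m_def)
  also have "\<dots> = sign_mean I (\<lambda>S. \<Sum>i\<in>I. (max 0 (F S - F (sym_diff S {i})))\<^sup>2) / 2"
    by (simp add: sign_mean_sum flip: sum_distrib_left)
  also have "\<dots> \<le> sign_mean I (\<lambda>S. 2\<^sup>2) / 2"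
  proof (intro divide_right_mono sign_mean_mono)
    fix S assume "S \<subseteq> I"
    have "(\<Sum>i\<in>I. (max 0 (F S - F (sym_diff S {i})))\<^sup>2) =
      (\<Sum>i\<in>I. (max 0 (f (radsum I w S) - f (radsum I w S - (2 * sgnof S i) *\<^sub>R w i)))\<^sup>2)"
      by (intro sum.cong refl) (simp add: F_def drop)
    also have "\<dots> \<le> 2\<^sup>2"
      by (rule sum_sq_drops_le[OF fin w]) (auto simp: abs_mult)
    finally show "(\<Sum>i\<in>I. (max 0 (F S - F (sym_diff S {i})))\<^sup>2) \<le> 2\<^sup>2" .
  qed simp
  finally show ?thesis
    using fin by (simp add: F_def[abs_def] m_def)
qed

end

section \<open>A central limit theorem for sums of random signs\<close>

text \<open>
  Real polynomials in variables indexed by a set \<open>B\<close> of any type. The same class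
  serves two purposes: approximating seminorms in the central limit theorem, and approximating the
  connectives of continuous logic.
\<close>

inductive_set poly_fun :: "'b set \<Rightarrow> (('b \<Rightarrow> real) \<Rightarrow> real) set" for B where
  poly_const: "(\<lambda>_. c) \<in> poly_fun B"
| poly_coord: "b \<in> B \<Longrightarrow> (\<lambda>y. y b) \<in> poly_fun B"
| poly_add: "p \<in> poly_fun B \<Longrightarrow> q \<in> poly_fun B \<Longrightarrow> (\<lambda>y. p y + q y) \<in> poly_fun B"
| poly_mult: "p \<in> poly_fun B \<Longrightarrow> q \<in> poly_fun B \<Longrightarrow> (\<lambda>y. p y * q y) \<in> poly_fun B"

text \<open>
  Coordinates outside \<open>B\<close> are fixed to \<open>0\<close> so that the polynomials in
  the variables from \<open>B\<close> separate the points.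
\<close>

definition cube :: "'b set \<Rightarrow> real \<Rightarrow> ('b \<Rightarrow> real) set" where
  "cube B R = {y. (\<forall>b\<in>B. \<bar>y b\<bar> \<le> R) \<and> (\<forall>b. b \<notin> B \<longrightarrow> y b = 0)}"

lemma compact_cube: "compact (cube B R)"
proof -
  have "cube B R = PiE UNIV (\<lambda>b. if b \<in> B then {-R..R} else {0})"
    by (auto simp: cube_def PiE_iff abs_le_iff split: if_splits) (smt (verit))+
  moreover have "compactin (product_topology (\<lambda>_. euclidean) UNIV) (PiE UNIV (\<lambda>b. if b \<in> B then {-R..R} else {0}))"
    by (subst compactin_PiE) auto
  ultimately show ?thesis
    by (metis compactin_euclidean_iff euclidean_product_topology)
qed

lemma poly_fun_dense:
  fixes u :: "('b::countable \<Rightarrow> real) \<Rightarrow> real"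
  assumes "continuous_on (cube B R) u" "e > 0"
  obtains p where "p \<in> poly_fun B" "\<And>y. y \<in> cube B R \<Longrightarrow> \<bar>u y - p y\<bar> < e"
proof -
  interpret function_ring_on "poly_fun B" "cube B R"
  proof
    show "compact (cube B R)" by (rule compact_cube)
    show "continuous_on (cube B R) p" if "p \<in> poly_fun B" for p
      using that
    proof induction
      case (poly_coord b)
      show ?case
        by (rule continuous_on_subset[OF continuous_on_product_coordinates subset_UNIV])
    qed (intro continuous_intros | assumption)+
    show "\<exists>p\<in>poly_fun B. p x \<noteq> p y" if "x \<in> cube B R" "y \<in> cube B R" "x \<noteq> y" for x y
    proof -
      obtain b where b: "x b \<noteq> y b" using \<open>x \<noteq> y\<close> by auto
      then have "b \<in> B" using that by (auto simp: cube_def)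
      with b show ?thesis using poly_coord by (intro bexI[of _ "\<lambda>y. y b"]) auto
    qed
  qed (auto intro: poly_fun.intros)
  obtain p where "p \<in> poly_fun B" "\<forall>y\<in>cube B R. \<bar>u y - p y\<bar> < e"
    using Stone_Weierstrass_basic[OF assms] by auto
  then show thesis using that by blast
qed

lemma poly_fun_restrict:
  assumes "p \<in> poly_fun B"
  shows "p y = p (\<lambda>b. if b \<in> B then y b else 0)"
  using assms by induction simp_all

lemma abs_cos_minus_exp_le: "\<bar>cos t - exp (- (t\<^sup>2) / 2)\<bar> \<le> t ^ 4" for t :: real
proof -
  obtain s where s: "cos t = (\<Sum>m<4. cos_coeff m * t ^ m) + (cos (s + 1/2 * real 4 * pi) / fact 4) * t ^ 4"
    using Maclaurin_cos_expansion[of t 4] by blast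
  have "(\<Sum>m<4. cos_coeff m * t ^ m) = 1 - t\<^sup>2 / 2"
  proof -
    have "{..<4::nat} = {0, 1, 2, 3}" by auto
    then show ?thesis by (simp add: cos_coeff_def fact_numeral)
  qed
  then have "\<bar>cos t - (1 - t\<^sup>2 / 2)\<bar> = \<bar>cos (s + 1/2 * real 4 * pi)\<bar> * (t ^ 4 / 24)"
    using s by (simp add: abs_mult fact_numeral)
  also have "\<dots> \<le> 1 * (t ^ 4 / 24)"
    by (intro mult_right_mono) auto
  finally have 1: "\<bar>cos t - (1 - t\<^sup>2 / 2)\<bar> \<le> t ^ 4 / 24" by simp
  define u where "u = t\<^sup>2 / 2"
  have u: "u \<ge> 0" "u\<^sup>2 = t ^ 4 / 4" by (auto simp: u_def power_divide)
  have "1 - u \<le> exp (- u)" using exp_ge_add_one_self[of "- u"] by simp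
  moreover have "exp (- u) \<le> 1 - u + u\<^sup>2 / 2"
  proof -
    have pos: "0 < 1 + u + u\<^sup>2 / 2" using u(1) by (simp add: add_pos_nonneg)
    have "exp (- u) \<le> 1 / (1 + u + u\<^sup>2 / 2)"
      using exp_lower_Taylor_quadratic[OF u(1)] pos by (simp add: exp_minus inverse_eq_divide frac_le)
    also have "\<dots> \<le> 1 - u + u\<^sup>2 / 2"
    proof -
      have "(1 - u + u\<^sup>2 / 2) * (1 + u + u\<^sup>2 / 2) = 1 + (u\<^sup>2)\<^sup>2 / 4"
        by (simp add: power2_eq_square algebra_simps)
      then have "1 \<le> (1 - u + u\<^sup>2 / 2) * (1 + u + u\<^sup>2 / 2)"
        by simp
      then show ?thesis using pos by (simp add: divide_le_eq)
    qed
    finally show ?thesis .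
  qed
  ultimately have 2: "\<bar>exp (- u) - (1 - u)\<bar> \<le> t ^ 4 / 8" using u by simp
  have "t ^ 4 \<ge> 0" by simp
  have "\<bar>c - x\<bar> \<le> q" if "\<bar>c - y\<bar> \<le> q / 24" "\<bar>x - y\<bar> \<le> q / 8" "q \<ge> 0" for c x y q :: real
    using that by linarith
  from this[OF 1 _ \<open>t ^ 4 \<ge> 0\<close>] 2 show ?thesis by (simp add: u_def)
qed

text \<open>
  For every \<open>b\<close> there is a block of \<open>n * k\<close> signs. The sum over the
  block, with weight \<open>a j / sqrt k\<close> on the sign \<open>(b, j, l)\<close>, has
  variance \<open>\<Sum>j<n. (a j)\<^sup>2\<close>, and the sums for different \<open>b\<close>
  are independent.
\<close>

definition clt_index :: "'b set \<Rightarrow> nat \<Rightarrow> nat \<Rightarrow> ('b \<times> nat \<times> nat) set" where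
  "clt_index B n k = B \<times> {..<n} \<times> {..<k}"

definition clt_sum :: "nat \<Rightarrow> (nat \<Rightarrow> real) \<Rightarrow> nat \<Rightarrow> ('b \<times> nat \<times> nat) set \<Rightarrow> 'b \<Rightarrow> real" where
  "clt_sum n a k S b = (\<Sum>j<n. \<Sum>l<k. a j / sqrt (real k) * sgnof S (b, j, l))"

lemma finite_clt_index [simp]: "finite B \<Longrightarrow> finite (clt_index B n k)"
  by (simp add: clt_index_def)

lemma sum_clt_index: "(\<Sum>q\<in>clt_index B n k. h q) = (\<Sum>b\<in>B. \<Sum>j<n. \<Sum>l<k. h (b, j, l))"
  by (simp add: clt_index_def sum.cartesian_product split_def)

text \<open>
  The characteristic function of the vector of block sums is a product of cosines of small angles
  \<open>\<theta>\<close>. Replacing every \<open>cos \<theta>\<close> by \<open>exp (-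
  \<theta>\<^sup>2 / 2)\<close> costs at most the sum of the \<open>\<theta> ^ 4\<close>, which is
  of order \<open>1 / k\<close>. The limit, that of a standard Gaussian vector, does not depend on
  \<open>a\<close>.
\<close>

lemma clt_cos:
  assumes "finite B" "(\<Sum>j<n. (a j)\<^sup>2) = 1"
  shows "(\<lambda>k. sign_mean (clt_index B n k) (\<lambda>S. cos (\<phi> + (\<Sum>b\<in>B. s b * clt_sum n a k S b))))
     \<longlonglongrightarrow> cos \<phi> * exp (- (\<Sum>b\<in>B. (s b)\<^sup>2) / 2)"
proof -
  define \<theta> where "\<theta> k q = (case q of (b, j, l::nat) \<Rightarrow> s b * (a j / sqrt (real k)))" for k :: nat and q
  let ?I = "clt_index B n"
  define X where "X k = (\<Prod>q\<in>?I k. cos (\<theta> k q))" for k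
  define C where "C = (\<Sum>b\<in>B. (s b) ^ 4 * (\<Sum>j<n. (a j) ^ 4))"
  have sum: "(\<Sum>b\<in>B. s b * clt_sum n a k S b) = (\<Sum>q\<in>?I k. \<theta> k q * sgnof S q)" for k S
    by (simp add: sum_clt_index clt_sum_def sum_distrib_left \<theta>_def mult_ac)
  have mean: "sign_mean (?I k) (\<lambda>S. cos (\<phi> + (\<Sum>b\<in>B. s b * clt_sum n a k S b))) = cos \<phi> * X k" for k
    using assms(1) by (simp add: sum sign_mean_cos X_def)
  have bound: "norm (X k - exp (- (\<Sum>b\<in>B. (s b)\<^sup>2) / 2)) \<le> C / real k" if "k > 0" for k
  proof -
    have 2: "(\<Sum>q\<in>?I k. (\<theta> k q)\<^sup>2) = (\<Sum>b\<in>B. (s b)\<^sup>2)"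
    proof -
      have "(\<Sum>q\<in>?I k. (\<theta> k q)\<^sup>2) = (\<Sum>b\<in>B. (s b)\<^sup>2 * (\<Sum>j<n. (a j)\<^sup>2))"
        using that by (simp add: sum_clt_index \<theta>_def power_mult_distrib power_divide sum_distrib_left)
      then show ?thesis using assms(2) by simp
    qed
    have 4: "(\<Sum>q\<in>?I k. (\<theta> k q) ^ 4) = C / real k"
    proof -
      have "sqrt (real k) ^ 4 = real k * real k"
        by (simp add: eval_nat_numeral)
      then show ?thesis
        using that
        by (simp add: sum_clt_index \<theta>_def power_mult_distrib power_divide sum_distrib_left
            C_def sum_divide_distrib)
    qed
    have "exp (- (\<Sum>b\<in>B. (s b)\<^sup>2) / 2) = (\<Prod>q\<in>?I k. exp (- ((\<theta> k q)\<^sup>2) / 2))"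
      using assms(1) by (simp add: exp_sum[symmetric] sum_negf sum_divide_distrib[symmetric] 2)
    then have "norm (X k - exp (- (\<Sum>b\<in>B. (s b)\<^sup>2) / 2)) \<le>
        (\<Sum>q\<in>?I k. norm (cos (\<theta> k q) - exp (- ((\<theta> k q)\<^sup>2) / 2)))"
      unfolding X_def by (simp only:) (intro norm_prod_diff, auto)
    also have "\<dots> \<le> (\<Sum>q\<in>?I k. (\<theta> k q) ^ 4)"
      using abs_cos_minus_exp_le by (intro sum_mono) auto
    finally show ?thesis using 4 by simp
  qed
  have "(\<lambda>k. X k - exp (- (\<Sum>b\<in>B. (s b)\<^sup>2) / 2)) \<longlonglongrightarrow> 0"
  proof (rule Lim_null_comparison)
    show "\<forall>\<^sub>F k in sequentially. norm (X k - exp (- (\<Sum>b\<in>B. (s b)\<^sup>2) / 2)) \<le> C / real k"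
      using bound by (intro eventually_mono[OF eventually_gt_at_top[of 0]]) auto
    show "(\<lambda>k. C / real k) \<longlonglongrightarrow> 0"
      by (rule lim_const_over_n)
  qed
  then have "X \<longlonglongrightarrow> exp (- (\<Sum>b\<in>B. (s b)\<^sup>2) / 2)"
    by (simp add: LIM_zero_iff)
  then show ?thesis
    unfolding mean by (intro tendsto_intros)
qed

text \<open>
  Trigonometric polynomials: the functions whose limiting averages follow from the previous lemma.
  They are closed under products because a product of cosines is a sum of cosines.
\<close>

inductive_set trig_fun :: "'b set \<Rightarrow> (('b \<Rightarrow> real) \<Rightarrow> real) set" for B where
  trig_cos: "(\<lambda>x. cos (\<phi> + (\<Sum>b\<in>B. s b * x b))) \<in> trig_fun B"
| trig_cmult: "p \<in> trig_fun B \<Longrightarrow> (\<lambda>x. c * p x) \<in> trig_fun B"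
| trig_add: "p \<in> trig_fun B \<Longrightarrow> q \<in> trig_fun B \<Longrightarrow> (\<lambda>x. p x + q x) \<in> trig_fun B"

lemma trig_fun_cos_mult:
  assumes "q \<in> trig_fun B"
  shows "(\<lambda>x. cos (\<phi> + (\<Sum>b\<in>B. s b * x b)) * q x) \<in> trig_fun B"
  using assms
proof induction
  case (trig_cos \<psi> t)
  have eq: "(\<lambda>x. cos (\<phi> + (\<Sum>b\<in>B. s b * x b)) * cos (\<psi> + (\<Sum>b\<in>B. t b * x b))) =
     (\<lambda>x. (1 / 2) * cos ((\<phi> - \<psi>) + (\<Sum>b\<in>B. (s b - t b) * x b)) +
          (1 / 2) * cos ((\<phi> + \<psi>) + (\<Sum>b\<in>B. (s b + t b) * x b)))"
    by (simp add: cos_times_cos fun_eq_iff left_diff_distrib distrib_right sum_subtractf sum.distrib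
        algebra_simps add_divide_distrib)
  show ?case
    unfolding eq by (intro trig_fun.intros)
next
  case (trig_cmult p c)
  then show ?case
    using trig_fun.trig_cmult[of "\<lambda>x. cos (\<phi> + (\<Sum>b\<in>B. s b * x b)) * p x" B c]
    by (simp add: mult_ac)
next
  case (trig_add p q)
  then show ?case
    using trig_fun.trig_add by (fastforce simp: distrib_left)
qed

lemma trig_fun_mult:
  assumes "p \<in> trig_fun B" "q \<in> trig_fun B"
  shows "(\<lambda>x. p x * q x) \<in> trig_fun B"
  using assms(1)
proof induction
  case (trig_cos \<phi> s)
  show ?case using trig_fun_cos_mult[OF assms(2)] .
next
  case (trig_cmult p c)
  then show ?case
    using trig_fun.trig_cmult[of "\<lambda>x. p x * q x" B c] by (simp add: mult_ac)
next
  case (trig_add p p')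
  then show ?case
    using trig_fun.trig_add[of "\<lambda>x. p x * q x" B "\<lambda>x. p' x * q x"] by (simp add: distrib_right)
qed

lemma trig_fun_poly_sin:
  assumes "finite B" "p \<in> poly_fun B"
  shows "(\<lambda>x. p (\<lambda>b. sin (\<kappa> * x b))) \<in> trig_fun B"
  using assms(2)
proof induction
  case (poly_const c)
  show ?case using trig_cmult[OF trig_cos[where s = "\<lambda>_. 0" and \<phi> = 0], of c B] by simp
next
  case (poly_coord b)
  (* The phase \<open>- pi / 2\<close> turns the cosine into a sine. *)
  have eq: "(\<lambda>x. sin (\<kappa> * x b)) = (\<lambda>x. cos (- pi / 2 + (\<Sum>b'\<in>B. (if b' = b then \<kappa> else 0) * x b')))"
  proof
    fix x :: "'a \<Rightarrow> real"
    have "(\<Sum>b'\<in>B. (if b' = b then \<kappa> else 0) * x b') = (\<Sum>b'\<in>B. if b' = b then \<kappa> * x b' else 0)"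
      by (intro sum.cong) auto
    also have "\<dots> = \<kappa> * x b" using assms(1) poly_coord by simp
    finally show "sin (\<kappa> * x b) = cos (- pi / 2 + (\<Sum>b'\<in>B. (if b' = b then \<kappa> else 0) * x b'))"
      by (simp add: cos_add cos_diff)
  qed
  show ?case unfolding eq by (rule trig_cos)
next
  case (poly_add p q)
  show ?case using poly_add.IH by (rule trig_add)
next
  case (poly_mult p q)
  show ?case using poly_mult.IH by (rule trig_fun_mult)
qed

lemma trig_fun_limit:
  assumes "finite B" "p \<in> trig_fun B"
  shows "\<exists>L. \<forall>n a. (\<Sum>j<n. (a j)\<^sup>2) = 1 \<longrightarrow>
     (\<lambda>k. sign_mean (clt_index B n k) (\<lambda>S. p (clt_sum n a k S))) \<longlonglongrightarrow> L"
  using assms(2)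
proof induction
  case (trig_cos \<phi> s)
  show ?case using clt_cos[OF assms(1)] by blast
next
  case (trig_cmult p c)
  then obtain L where
     "\<And>n a. (\<Sum>j<n. (a j)\<^sup>2) = 1 \<Longrightarrow> (\<lambda>k. sign_mean (clt_index B n k) (\<lambda>S. p (clt_sum n a k S))) \<longlonglongrightarrow> L"
    by blast
  then show ?case
    by (intro exI[of _ "c * L"]) (auto simp: sign_mean_cmult intro: tendsto_mult_left)
next
  case (trig_add p q)
  then obtain L M where
     "\<And>n a. (\<Sum>j<n. (a j)\<^sup>2) = 1 \<Longrightarrow> (\<lambda>k. sign_mean (clt_index B n k) (\<lambda>S. p (clt_sum n a k S))) \<longlonglongrightarrow> L"
     "\<And>n a. (\<Sum>j<n. (a j)\<^sup>2) = 1 \<Longrightarrow> (\<lambda>k. sign_mean (clt_index B n k) (\<lambda>S. q (clt_sum n a k S))) \<longlonglongrightarrow> M"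
    by blast
  then show ?case
    by (intro exI[of _ "L + M"]) (auto simp: sign_mean_add intro: tendsto_add)
qed

lemma sign_mean_sgnof_mult:
  assumes "finite I" "p \<in> I" "q \<in> I" "p \<noteq> q"
  shows "sign_mean I (\<lambda>S. sgnof S p * sgnof S q) = 0"
proof -
  have "sign_mean I (\<lambda>S. sgnof (sym_diff S {p}) p * sgnof (sym_diff S {p}) q) =
      sign_mean I (\<lambda>S. sgnof S p * sgnof S q)"
    using sign_mean_flip[of "{p}" I "\<lambda>S. sgnof S p * sgnof S q"] assms by simp
  moreover have "(\<lambda>S. sgnof (sym_diff S {p}) p * sgnof (sym_diff S {p}) q) =
      (\<lambda>S. (-1) * (sgnof S p * sgnof S q))"
    using assms by (auto simp: sgnof_def fun_eq_iff)
  ultimately show ?thesis by (simp only: sign_mean_cmult)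
qed

lemma sign_mean_linear_sq:
  assumes "finite I"
  shows "sign_mean I (\<lambda>S. (\<Sum>q\<in>I. c q * sgnof S q)\<^sup>2) = (\<Sum>q\<in>I. (c q)\<^sup>2)"
proof -
  have "sign_mean I (\<lambda>S. (\<Sum>q\<in>I. c q * sgnof S q)\<^sup>2) =
     sign_mean I (\<lambda>S. \<Sum>p\<in>I. \<Sum>q\<in>I. (c p * c q) * (sgnof S p * sgnof S q))"
    by (simp add: power2_eq_square sum_product mult_ac)
  also have "\<dots> = (\<Sum>p\<in>I. \<Sum>q\<in>I. (c p * c q) * sign_mean I (\<lambda>S. sgnof S p * sgnof S q))"
    by (simp only: sign_mean_sum sign_mean_cmult)
  also have "\<dots> = (\<Sum>p\<in>I. \<Sum>q\<in>I. if q = p then (c p)\<^sup>2 else 0)"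
    using assms by (intro sum.cong refl) (auto simp: sign_mean_sgnof_mult power2_eq_square)
  also have "\<dots> = (\<Sum>q\<in>I. (c q)\<^sup>2)"
    using assms by simp
  finally show ?thesis .
qed

lemma clt_sum_second_moment:
  assumes "finite B" "b \<in> B" "k > 0"
  shows "sign_mean (clt_index B n k) (\<lambda>S. (clt_sum n a k S b)\<^sup>2) = (\<Sum>j<n. (a j)\<^sup>2)"
proof -
  define c where "c q = (case q of (b', j, l::nat) \<Rightarrow> if b' = b then a j / sqrt (real k) else 0)" for q
  have 1: "clt_sum n a k S b = (\<Sum>q\<in>clt_index B n k. c q * sgnof S q)" for S
  proof -
    have "(\<Sum>q\<in>clt_index B n k. c q * sgnof S q) =
       (\<Sum>b'\<in>B. if b' = b then clt_sum n a k S b' else 0)"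
      by (auto simp: sum_clt_index clt_sum_def c_def intro!: sum.cong)
    then show ?thesis using assms by simp
  qed
  have "(\<Sum>q\<in>clt_index B n k. (c q)\<^sup>2) = (\<Sum>b'\<in>B. if b' = b then (\<Sum>j<n. (a j)\<^sup>2) else 0)"
    using assms(3) by (auto simp: sum_clt_index c_def power_divide intro!: sum.cong)
  then show ?thesis
    using assms by (simp add: 1 sign_mean_linear_sq)
qed

context seminorm
begin

text \<open>
  The mean of \<open>f\<close> at the random vector \<open>\<Sum>b. Y\<^sub>b w\<^sub>b\<close> of
  block sums approaches a number that does not depend on the unit vector \<open>a\<close>. For
  trigonometric polynomials this is \<open>trig_fun_limit\<close>. To pass to \<open>f\<close>,
  replace each coordinate \<open>t\<close> by \<open>arcsin (sin (\<kappa> * t)) /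
  \<kappa>\<close>, which is \<open>t\<close> itself as long as \<open>\<bar>t\<bar> \<le>
  L\<close>; the result is a continuous function of the numbers \<open>sin (\<kappa> * t)\<close>
  in \<open>[-1, 1]\<close> and hence, by the theorem of Stone and Weierstrass, uniformly close to
  a polynomial in them. The effect of the replacement is controlled by the second moments of the
  block sums.
\<close>

lemma clt_seminorm:
  fixes w :: "'b::countable \<Rightarrow> 'v"
  assumes B: "finite B" and e: "e > 0"
  shows "\<exists>\<mu>. \<forall>n a. (\<Sum>j<n. (a j)\<^sup>2) = 1 \<longrightarrow>
     (\<forall>\<^sub>F k in sequentially.
        \<bar>sign_mean (clt_index B n k) (\<lambda>S. f (\<Sum>b\<in>B. clt_sum n a k S b *\<^sub>R w b)) - \<mu>\<bar> \<le> e)"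
proof -
  define g where "g x = f (\<Sum>b\<in>B. x b *\<^sub>R w b)" for x
  have lip: "\<bar>g x - g y\<bar> \<le> (\<Sum>b\<in>B. \<bar>x b - y b\<bar> * f (w b))" for x y
  proof -
    have "\<bar>g x - g y\<bar> \<le> f (\<Sum>b\<in>B. (x b - y b) *\<^sub>R w b)"
      using f_diff[of "\<Sum>b\<in>B. x b *\<^sub>R w b" "\<Sum>b\<in>B. y b *\<^sub>R w b"]
      by (simp add: g_def scaleR_left_diff_distrib sum_subtractf)
    also note f_sum_scaled_le
    finally show ?thesis by simp
  qed
  define M where "M = (\<Sum>b\<in>B. 2 * f (w b))"
  have M: "M \<ge> 0" by (simp add: M_def f_nonneg sum_nonneg)
  (* The replacement error has mean at most \<open>M / L\<close>; this choice makes it at most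
     \<open>e / 3\<close>. *)
  define L where "L = 3 * (M + 1) / e"
  have L: "L > 0" using M e by (simp add: L_def)
  define \<kappa> where "\<kappa> = pi / (2 * L)"
  have \<kappa>: "\<kappa> > 0" using L by (simp add: \<kappa>_def)
  define \<psi> where "\<psi> t = arcsin (sin (\<kappa> * t)) / \<kappa>" for t
  (* Nothing is lost below \<open>L\<close>, and above \<open>L\<close> the loss is at most
     \<open>2 * \<bar>t\<bar>\<close>, hence at most quadratic. *)
  have \<psi>: "\<bar>t - \<psi> t\<bar> \<le> 2 * t\<^sup>2 / L" for t
  proof (cases "\<bar>t\<bar> \<le> L")
    case True
    have "\<bar>\<kappa> * t\<bar> \<le> \<kappa> * L" using True \<kappa> by (simp add: abs_mult)
    also have "\<kappa> * L = pi / 2" using L by (simp add: \<kappa>_def)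
    finally have "arcsin (sin (\<kappa> * t)) = \<kappa> * t"
      by (intro arcsin_sin) auto
    then show ?thesis using \<kappa> L by (simp add: \<psi>_def)
  next
    case False
    have "- (pi / 2) \<le> arcsin (sin (\<kappa> * t)) \<and> arcsin (sin (\<kappa> * t)) \<le> pi / 2"
      using arcsin_bounded[of "sin (\<kappa> * t)"] by auto
    then have "\<bar>arcsin (sin (\<kappa> * t))\<bar> \<le> pi / 2"
      unfolding abs_le_iff by linarith
    then have "\<bar>\<psi> t\<bar> \<le> (pi / 2) / \<kappa>"
      using \<kappa> unfolding \<psi>_def abs_divide by (intro frac_le) auto
    also have "\<dots> = L" using L by (simp add: \<kappa>_def)
    finally have "\<bar>t - \<psi> t\<bar> \<le> 2 * \<bar>t\<bar>" using False by linarith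
    also have "\<dots> = 2 * \<bar>t\<bar> * 1" by simp
    also have "\<dots> \<le> 2 * \<bar>t\<bar> * (\<bar>t\<bar> / L)"
      using False L by (intro mult_left_mono) (auto simp: le_divide_eq)
    also have "\<dots> = 2 * t\<^sup>2 / L" by (simp add: power2_eq_square)
    finally show ?thesis .
  qed
  define u where "u y = g (\<lambda>b. arcsin (y b) / \<kappa>)" for y
  have "continuous_on (cube B 1) u"
  proof -
    have c: "continuous_on (cube B 1) (\<lambda>y. arcsin (y b) / \<kappa>)" if "b \<in> B" for b
    proof -
      have "continuous_on (cube B 1) (\<lambda>y. y b)"
        by (rule continuous_on_subset[OF continuous_on_product_coordinates subset_UNIV])
      moreover have "\<forall>y\<in>cube B 1. -1 \<le> y b \<and> y b \<le> 1"
      proof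
        fix y assume "y \<in> cube B 1"
        then have "\<bar>y b\<bar> \<le> 1" using that by (simp add: cube_def)
        then show "-1 \<le> y b \<and> y b \<le> 1" by linarith
      qed
      ultimately show ?thesis
        using \<kappa> by (intro continuous_intros) auto
    qed
    have "(u \<longlongrightarrow> u y) (at y within cube B 1)" if y: "y \<in> cube B 1" for y
    proof (rule Lim_null[THEN iffD2], rule Lim_null_comparison)
      show "\<forall>\<^sub>F z in at y within cube B 1. norm (u z - u y) \<le>
          (\<Sum>b\<in>B. \<bar>arcsin (z b) / \<kappa> - arcsin (y b) / \<kappa>\<bar> * f (w b))"
        using lip by (simp add: u_def)
      have "((\<lambda>z. \<Sum>b\<in>B. \<bar>arcsin (z b) / \<kappa> - arcsin (y b) / \<kappa>\<bar> * f (w b)) \<longlongrightarrow>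
          (\<Sum>b\<in>B. \<bar>arcsin (y b) / \<kappa> - arcsin (y b) / \<kappa>\<bar> * f (w b))) (at y within cube B 1)"
        using c y
        by (intro tendsto_sum tendsto_mult tendsto_rabs tendsto_diff tendsto_const)
           (auto simp: continuous_on_def)
      then show "((\<lambda>z. \<Sum>b\<in>B. \<bar>arcsin (z b) / \<kappa> - arcsin (y b) / \<kappa>\<bar> * f (w b)) \<longlongrightarrow> 0) (at y within cube B 1)"
        by simp
    qed
    then show ?thesis by (simp add: continuous_on_def)
  qed
  then obtain p where p: "p \<in> poly_fun B" "\<And>y. y \<in> cube B 1 \<Longrightarrow> \<bar>u y - p y\<bar> < e / 3"
    using poly_fun_dense[of B 1 u "e / 3"] e by auto
  define T where "T x = p (\<lambda>b. sin (\<kappa> * x b))" for x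
  have "(\<lambda>x. T x) \<in> trig_fun B"
    using trig_fun_poly_sin[OF B p(1), of \<kappa>] by (simp add: T_def)
  then obtain \<mu> where \<mu>: "\<And>n a. (\<Sum>j<n. (a j)\<^sup>2) = 1 \<Longrightarrow>
     (\<lambda>k. sign_mean (clt_index B n k) (\<lambda>S. T (clt_sum n a k S))) \<longlonglongrightarrow> \<mu>"
    using trig_fun_limit[OF B] by blast
  have poly_restrict: "p y = p (\<lambda>b. if b \<in> B then y b else 0)" for y
    using p(1) by (rule poly_fun_restrict)
  have near: "\<bar>g x - T x\<bar> \<le> e / 3 + (\<Sum>b\<in>B. 2 * f (w b) * (x b)\<^sup>2) / L" for x
  proof -
    define y where "y b = (if b \<in> B then sin (\<kappa> * x b) else 0)" for b
    have "y \<in> cube B 1" by (auto simp: y_def cube_def)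
    then have "\<bar>u y - T x\<bar> < e / 3"
      using p(2)[of y] poly_restrict[of "\<lambda>b. sin (\<kappa> * x b)"] by (simp add: T_def y_def[abs_def])
    moreover have "u y = g (\<lambda>b. \<psi> (x b))"
      by (auto simp: u_def g_def \<psi>_def y_def intro!: arg_cong[of _ _ f] sum.cong)
    moreover have "\<bar>g x - g (\<lambda>b. \<psi> (x b))\<bar> \<le> (\<Sum>b\<in>B. 2 * f (w b) * (x b)\<^sup>2) / L"
    proof -
      have "\<bar>g x - g (\<lambda>b. \<psi> (x b))\<bar> \<le> (\<Sum>b\<in>B. \<bar>x b - \<psi> (x b)\<bar> * f (w b))" by (rule lip)
      also have "\<dots> \<le> (\<Sum>b\<in>B. (2 * (x b)\<^sup>2 / L) * f (w b))"
        using \<psi> f_nonneg by (intro sum_mono mult_right_mono) auto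
      finally show ?thesis by (simp add: sum_divide_distrib mult_ac)
    qed
    ultimately show ?thesis by linarith
  qed
  show ?thesis
  proof (rule exI[of _ \<mu>], intro allI impI)
    fix n :: nat and a :: "nat \<Rightarrow> real" assume a: "(\<Sum>j<n. (a j)\<^sup>2) = 1"
    let ?E = "\<lambda>k. sign_mean (clt_index B n k)"
    have diff: "\<bar>?E k (\<lambda>S. g (clt_sum n a k S)) - ?E k (\<lambda>S. T (clt_sum n a k S))\<bar> \<le> 2 * e / 3"
      if k: "k > 0" for k
    proof -
      define R where "R S = e / 3 + (\<Sum>b\<in>B. (2 * f (w b) / L) * (clt_sum n a k S b)\<^sup>2)" for S
      have "?E k R = e / 3 + (\<Sum>b\<in>B. (2 * f (w b) / L) * ?E k (\<lambda>S. (clt_sum n a k S b)\<^sup>2))"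
        using B unfolding R_def by (simp only: sign_mean_add sign_mean_sum sign_mean_cmult) simp
      also have "\<dots> = e / 3 + M / L"
        using B k a by (simp add: clt_sum_second_moment M_def sum_divide_distrib)
      also have "M / L \<le> e / 3"
        using M e by (simp add: L_def divide_simps)
      finally have R: "?E k R \<le> 2 * e / 3" by simp
      have nR: "\<bar>g (clt_sum n a k S) - T (clt_sum n a k S)\<bar> \<le> R S" for S
        using near[of "clt_sum n a k S"] by (simp add: R_def sum_divide_distrib)
      have "?E k (\<lambda>S. g (clt_sum n a k S)) - ?E k (\<lambda>S. T (clt_sum n a k S)) \<le> ?E k R"
        unfolding sign_mean_diff[symmetric] using nR by (intro sign_mean_mono) (simp add: abs_le_iff)
      moreover have "?E k (\<lambda>S. T (clt_sum n a k S)) - ?E k (\<lambda>S. g (clt_sum n a k S)) \<le> ?E k R"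
        unfolding sign_mean_diff[symmetric] using nR by (intro sign_mean_mono) (simp add: abs_le_iff)
      ultimately show ?thesis using R by linarith
    qed
    have "\<forall>\<^sub>F k in sequentially. \<bar>?E k (\<lambda>S. T (clt_sum n a k S)) - \<mu>\<bar> < e / 3"
      using tendstoD[OF \<mu>[OF a], of "e / 3"] e by (simp add: dist_real_def)
    then show "\<forall>\<^sub>F k in sequentially. \<bar>?E k (\<lambda>S. f (\<Sum>b\<in>B. clt_sum n a k S b *\<^sub>R w b)) - \<mu>\<bar> \<le> e"
      using eventually_gt_at_top[of 0]
    proof eventually_elim
      case (elim k)
      have "\<bar>x - z\<bar> \<le> e" if "\<bar>x - y\<bar> \<le> 2 * e / 3" "\<bar>y - z\<bar> < e / 3" for x y z :: real
        using that by linarith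
      from this[OF diff elim(1)] elim(2) show ?case by (simp add: g_def)
    qed
  qed
qed

end

section \<open>Systems of vectors with small weak norm and large random sums\<close>

lemma sign_mean_swap:
  "sign_mean I (\<lambda>S. sign_mean J (\<lambda>R. F S R)) = sign_mean J (\<lambda>R. sign_mean I (\<lambda>S. F S R))"
proof -
  have "sign_mean I (\<lambda>S. sign_mean J (\<lambda>R. F S R)) =
     (\<Sum>S\<in>Pow I. \<Sum>R\<in>Pow J. F S R) / (2 ^ card I * 2 ^ card J)"
    by (simp add: sign_mean_def mult.commute flip: sum_divide_distrib)
  also have "(\<Sum>S\<in>Pow I. \<Sum>R\<in>Pow J. F S R) = (\<Sum>R\<in>Pow J. \<Sum>S\<in>Pow I. F S R)"
    by (rule sum.swap)
  finally show ?thesis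
    by (simp add: sign_mean_def flip: sum_divide_distrib)
qed

lemma sgnof_sym_diff:
  "sgnof (sym_diff S D) i = (if i \<in> D then - sgnof S i else sgnof S i)"
  by (auto simp: sgnof_def)

context seminorm
begin

text \<open>
  Jensen's inequality for the convex function \<open>f\<close> and random coefficients.
\<close>

lemma sign_mean_Jensen:
  "f (\<Sum>b\<in>B. sign_mean I (h b) *\<^sub>R w b) \<le> sign_mean I (\<lambda>S. f (\<Sum>b\<in>B. h b S *\<^sub>R w b))"
proof -
  let ?c = "1 / 2 ^ card I :: real"
  have "(\<Sum>b\<in>B. sign_mean I (h b) *\<^sub>R w b) = ?c *\<^sub>R (\<Sum>S\<in>Pow I. \<Sum>b\<in>B. h b S *\<^sub>R w b)"
    by (subst sum.swap) (simp add: sign_mean_def scaleR_sum_right scaleR_sum_left sum_divide_distrib)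
  then have "f (\<Sum>b\<in>B. sign_mean I (h b) *\<^sub>R w b) = ?c * f (\<Sum>S\<in>Pow I. \<Sum>b\<in>B. h b S *\<^sub>R w b)"
    by (simp add: homog)
  also have "\<dots> \<le> ?c * (\<Sum>S\<in>Pow I. f (\<Sum>b\<in>B. h b S *\<^sub>R w b))"
    by (intro mult_left_mono f_sum) auto
  finally show ?thesis by (simp add: sign_mean_def)
qed

text \<open>
  Replacing each sign by a normalized sum \<open>Y\<^sub>b\<close> of \<open>k\<close> signs does
  not destroy a large average. Since \<open>Y\<^sub>b\<close> is symmetric, it may be replaced by
  \<open>\<epsilon>\<^sub>b \<bar>Y\<^sub>b\<bar>\<close> with a fresh sign
  \<open>\<epsilon>\<^sub>b\<close>; Jensen's inequality then replaces
  \<open>\<bar>Y\<^sub>b\<bar>\<close> by its mean \<open>c k\<close>. This mean is eventually at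
  least \<open>1 / 4\<close>, because \<open>\<bar>t\<bar> \<ge> 1 - cos t\<close> and the mean of
  \<open>cos Y\<^sub>b\<close> tends to \<open>exp (- 1 / 2) < 3 / 4\<close>.
\<close>

lemma repeated_signs_mean_ge:
  fixes w :: "'b::countable \<Rightarrow> 'v"
  assumes B: "finite B"
  shows "\<forall>\<^sub>F k in sequentially. sign_mean B (\<lambda>R. f (radsum B w R)) / 4
     \<le> sign_mean (clt_index B 1 k) (\<lambda>S. f (\<Sum>b\<in>B. clt_sum 1 (\<lambda>_. 1) k S b *\<^sub>R w b))"
proof (cases "B = {}")
  case True
  then show ?thesis by (simp add: radsum_def clt_index_def)
next
  case False
  then obtain b0 where b0: "b0 \<in> B" by auto
  let ?I = "\<lambda>k. clt_index B 1 k"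
  let ?Y = "\<lambda>k S b. clt_sum 1 (\<lambda>_. 1) k S b"
  define c where "c k = sign_mean {..<k} (\<lambda>S. \<bar>\<Sum>l<k. 1 / sqrt (real k) * sgnof S l\<bar>)" for k
  have c: "sign_mean (?I k) (\<lambda>S. \<bar>?Y k S b\<bar>) = c k" if "b \<in> B" for b k
  proof -
    define h where "h l = (b, 0::nat, l::nat)" for l
    have "sign_mean (?I k) (\<lambda>S. \<bar>?Y k S b\<bar>) = sign_mean (h ` {..<k}) (\<lambda>S. \<bar>?Y k S b\<bar>)"
    proof (rule sign_mean_marginal)
      show "h ` {..<k} \<subseteq> ?I k" using that by (auto simp: h_def clt_index_def)
      show "\<bar>?Y k S b\<bar> = \<bar>?Y k (S \<inter> h ` {..<k}) b\<bar>" for S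
        by (intro arg_cong[of _ _ abs]) (auto simp: clt_sum_def sgnof_def h_def intro!: sum.cong)
    qed (use B in auto)
    also have "\<dots> = sign_mean {..<k} (\<lambda>S. \<bar>?Y k (h ` S) b\<bar>)"
      by (rule sign_mean_reindex) (auto simp: h_def inj_on_def)
    also have "\<dots> = c k"
      unfolding c_def
      by (intro sign_mean_cong arg_cong[of _ _ abs])
         (auto simp: clt_sum_def sgnof_def h_def intro!: sum.cong)
    finally show ?thesis .
  qed
  have "(\<lambda>k. sign_mean (?I k) (\<lambda>S. cos (0 + (\<Sum>b\<in>B. (if b = b0 then 1 else 0) * ?Y k S b)))) \<longlonglongrightarrow>
      cos 0 * exp (- (\<Sum>b\<in>B. (if b = b0 then 1 else 0 :: real)\<^sup>2) / 2)"
    by (rule clt_cos[OF B]) simp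
  moreover have "(\<Sum>b\<in>B. (if b = b0 then 1 else 0 :: real)\<^sup>2) = 1"
    using B b0 by (simp add: if_distrib[of "\<lambda>x. x\<^sup>2"] cong: if_cong)
  moreover have "(\<Sum>b\<in>B. (if b = b0 then 1 else 0) * ?Y k S b) = ?Y k S b0" for k S
    using B b0 by (simp add: if_distrib[of "\<lambda>x. x * _"] cong: if_cong)
  ultimately have "(\<lambda>k. sign_mean (?I k) (\<lambda>S. cos (?Y k S b0))) \<longlonglongrightarrow> exp (- 1 / 2)"
    by simp
  moreover have "exp (- 1 / 2 :: real) < 3 / 4"
  proof -
    have "1 + 1 / 2 \<le> exp (1 / 2 :: real)" by (rule exp_ge_add_one_self)
    moreover have "exp (- 1 / 2 :: real) = inverse (exp (1 / 2))" by (simp flip: exp_minus)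
    ultimately show ?thesis
      by (simp add: inverse_eq_divide divide_less_eq)
  qed
  ultimately have "\<forall>\<^sub>F k in sequentially. sign_mean (?I k) (\<lambda>S. cos (?Y k S b0)) < 3 / 4"
    by (rule order_tendstoD(2))
  then show ?thesis
  proof eventually_elim
    case (elim k)
    have "sign_mean (?I k) (\<lambda>S. 1 - cos (?Y k S b0)) \<le> sign_mean (?I k) (\<lambda>S. \<bar>?Y k S b0\<bar>)"
    proof (rule sign_mean_mono)
      fix S
      have "1 - cos t \<le> \<bar>t\<bar>" for t :: real
      proof -
        have "1 - cos t = 2 * (\<bar>sin (t / 2)\<bar> * \<bar>sin (t / 2)\<bar>)"
          using cos_double_sin[of "t / 2"] by (simp add: power2_eq_square)
        also have "\<dots> \<le> 2 * (\<bar>t / 2\<bar> * 1)"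
          by (intro mult_left_mono mult_mono abs_sin_x_le_abs_x) auto
        finally show ?thesis by simp
      qed
      then show "1 - cos (?Y k S b0) \<le> \<bar>?Y k S b0\<bar>" .
    qed
    then have "1 - sign_mean (?I k) (\<lambda>S. cos (?Y k S b0)) \<le> c k"
      using B unfolding sign_mean_diff c[OF b0] by simp
    with elim have ck: "1 / 4 \<le> c k" by linarith
    have "sign_mean (?I k) (\<lambda>S. f (\<Sum>b\<in>B. ?Y k S b *\<^sub>R w b)) =
       sign_mean B (\<lambda>R. sign_mean (?I k) (\<lambda>S. f (\<Sum>b\<in>B. (sgnof R b * ?Y k S b) *\<^sub>R w b)))"
    proof -
      have "sign_mean (?I k) (\<lambda>S. f (\<Sum>b\<in>B. ?Y k S b *\<^sub>R w b)) =
        sign_mean (?I k) (\<lambda>S. f (\<Sum>b\<in>B. (sgnof R b * ?Y k S b) *\<^sub>R w b))" for R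
      proof -
        (* Flipping whole blocks multiplies the block sums by the signs of \<open>R\<close>. *)
        define D where "D = (B - R) \<times> {0::nat} \<times> {..<k}"
        have "?Y k (sym_diff S D) b = sgnof R b * ?Y k S b" if "b \<in> B" for S b
          using that by (auto simp: clt_sum_def sgnof_sym_diff D_def sgnof_def[of R] sum_negf[symmetric] intro!: sum.cong)
        then have "sign_mean (?I k) (\<lambda>S. f (\<Sum>b\<in>B. (sgnof R b * ?Y k S b) *\<^sub>R w b)) =
           sign_mean (?I k) (\<lambda>S. f (\<Sum>b\<in>B. ?Y k (sym_diff S D) b *\<^sub>R w b))"
          by (intro sign_mean_cong arg_cong[of _ _ f] sum.cong) auto
        then show ?thesis
          using sign_mean_flip[of D "?I k" "\<lambda>S. f (\<Sum>b\<in>B. ?Y k S b *\<^sub>R w b)"]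
          by (simp add: D_def clt_index_def Sigma_mono)
      qed
      then show ?thesis using B by (metis (no_types, lifting) sign_mean_const sign_mean_cong)
    qed
    also have "\<dots> = sign_mean (?I k) (\<lambda>S. sign_mean B (\<lambda>R. f (\<Sum>b\<in>B. (sgnof R b * ?Y k S b) *\<^sub>R w b)))"
      by (rule sign_mean_swap)
    (* For a fixed \<open>S\<close> the signs of the block sums can be absorbed into those of
       \<open>R\<close>. *)
    also have "\<dots> = sign_mean (?I k) (\<lambda>S. sign_mean B (\<lambda>R. f (\<Sum>b\<in>B. (sgnof R b * \<bar>?Y k S b\<bar>) *\<^sub>R w b)))"
    proof (rule sign_mean_cong)
      fix S
      define D where "D = {b \<in> B. ?Y k S b < 0}"
      have "sgnof (sym_diff R D) b * ?Y k S b = sgnof R b * \<bar>?Y k S b\<bar>" if "b \<in> B" for R b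
        using that by (auto simp: sgnof_sym_diff D_def)
      then have "sign_mean B (\<lambda>R. f (\<Sum>b\<in>B. (sgnof R b * \<bar>?Y k S b\<bar>) *\<^sub>R w b)) =
         sign_mean B (\<lambda>R. f (\<Sum>b\<in>B. (sgnof (sym_diff R D) b * ?Y k S b) *\<^sub>R w b))"
        by (intro sign_mean_cong arg_cong[of _ _ f] sum.cong) auto
      also have "\<dots> = sign_mean B (\<lambda>R. f (\<Sum>b\<in>B. (sgnof R b * ?Y k S b) *\<^sub>R w b))"
        by (rule sign_mean_flip) (auto simp: D_def)
      finally show "sign_mean B (\<lambda>R. f (\<Sum>b\<in>B. (sgnof R b * ?Y k S b) *\<^sub>R w b)) =
         sign_mean B (\<lambda>R. f (\<Sum>b\<in>B. (sgnof R b * \<bar>?Y k S b\<bar>) *\<^sub>R w b))" ..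
    qed
    also have "\<dots> = sign_mean B (\<lambda>R. sign_mean (?I k) (\<lambda>S. f (\<Sum>b\<in>B. (sgnof R b * \<bar>?Y k S b\<bar>) *\<^sub>R w b)))"
      by (rule sign_mean_swap)
    also have "\<dots> \<ge> sign_mean B (\<lambda>R. f (radsum B w R) / 4)"
    proof (rule sign_mean_mono)
      fix R
      have "(1 / 4) * f (radsum B w R) \<le> c k * f (radsum B w R)"
        using ck by (intro mult_right_mono) (auto simp: f_nonneg)
      also have "\<dots> = f (c k *\<^sub>R radsum B w R)"
        using ck by (simp add: homog)
      also have "c k *\<^sub>R radsum B w R = (\<Sum>b\<in>B. sign_mean (?I k) (\<lambda>S. sgnof R b * \<bar>?Y k S b\<bar>) *\<^sub>R w b)"
        unfolding radsum_def scaleR_sum_right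
          by (intro sum.cong refl) (simp only: sign_mean_cmult c scaleR_scaleR mult.commute)
      also have "f \<dots> \<le> sign_mean (?I k) (\<lambda>S. f (\<Sum>b\<in>B. (sgnof R b * \<bar>?Y k S b\<bar>) *\<^sub>R w b))"
        by (rule sign_mean_Jensen)
      finally show "f (radsum B w R) / 4 \<le> sign_mean (?I k) (\<lambda>S. f (\<Sum>b\<in>B. (sgnof R b * \<bar>?Y k S b\<bar>) *\<^sub>R w b))"
        by simp
    qed
    finally show ?case
      using sign_mean_cmult[of B "1 / 4" "\<lambda>R. f (radsum B w R)"] by simp
  qed
qed

end

text \<open>
  The probability that among \<open>m\<close> independent rows of \<open>L\<close> signs at least
  one row is entirely positive.
\<close>

lemma sign_mean_some_full_row:
  "sign_mean ({..<m::nat} \<times> {..<L::nat}) (\<lambda>S. if \<exists>i<m. {i} \<times> {..<L} \<subseteq> S then 1 else 0)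
    = 1 - (1 - 1 / 2 ^ L) ^ m"
proof -
  let ?g = "\<lambda>m S. if \<forall>i<m. \<not> {i} \<times> {..<L} \<subseteq> S then 1 else 0 :: real"
  have row: "sign_mean J (\<lambda>R. if J \<subseteq> R then 0 else 1) = 1 - 1 / 2 ^ card J" if "finite J"
    for J :: "(nat \<times> nat) set"
  proof -
    have "(\<Sum>R\<in>Pow J. if J \<subseteq> R then 0 else 1 :: real) = (\<Sum>R\<in>Pow J. 1 - (if R = J then 1 else 0))"
      by (intro sum.cong) auto
    also have "\<dots> = 2 ^ card J - 1"
      using that by (simp add: sum_subtractf card_Pow)
    finally show ?thesis by (simp add: sign_mean_def diff_divide_distrib)
  qed
  have none: "sign_mean ({..<m} \<times> {..<L}) (?g m) = (1 - 1 / 2 ^ L) ^ m" for m :: nat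
  proof (induction m)
    case (Suc m)
    have "{..<Suc m} \<times> {..<L} = ({..<m} \<times> {..<L}) \<union> ({m} \<times> {..<L})"
      by (auto simp: less_Suc_eq)
    then have "sign_mean ({..<Suc m} \<times> {..<L}) (?g (Suc m)) =
      sign_mean ({..<m} \<times> {..<L}) (\<lambda>S. sign_mean ({m} \<times> {..<L}) (\<lambda>R. ?g (Suc m) (S \<union> R)))"
      by (simp only:) (rule sign_mean_Un, auto)
    also have "\<dots> = sign_mean ({..<m} \<times> {..<L})
       (\<lambda>S. sign_mean ({m} \<times> {..<L}) (\<lambda>R. ?g m S * (if {m} \<times> {..<L} \<subseteq> R then 0 else 1)))"
    proof (intro sign_mean_cong)
      fix S R :: "(nat \<times> nat) set"
      assume SR: "S \<subseteq> {..<m} \<times> {..<L}" "R \<subseteq> {m} \<times> {..<L}"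
      then have "{i} \<times> {..<L} \<subseteq> S \<union> R \<longleftrightarrow> {i} \<times> {..<L} \<subseteq> S" if "i < m" for i
        using that by auto
      moreover have "{m} \<times> {..<L} \<subseteq> S \<union> R \<longleftrightarrow> {m} \<times> {..<L} \<subseteq> R"
        using SR by auto
      ultimately show "?g (Suc m) (S \<union> R) = ?g m S * (if {m} \<times> {..<L} \<subseteq> R then 0 else 1)"
        by (auto simp: less_Suc_eq)
    qed
    also have "\<dots> = (1 - 1 / 2 ^ L) * sign_mean ({..<m} \<times> {..<L}) (?g m)"
      by (simp only: sign_mean_cmult) (simp add: row card_cartesian_product flip: sign_mean_cmult, simp add: mult.commute)
    finally show ?case using Suc by simp
  qed simp
  have "(\<lambda>S. if \<exists>i<m. {i} \<times> {..<L} \<subseteq> S then 1 else 0 :: real) = (\<lambda>S. 1 - ?g m S)"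
    by auto
  then show ?thesis
    by (simp only: sign_mean_diff none) simp
qed

text \<open>
  \<open>f m\<close> is a seminorm on the span of \<open>d 0, \<dots>, d (m - 1)\<close> for which
  the coordinate projections that set one coefficient to zero are contractions. A family with one
  seminorm for each \<open>m\<close>, instead of a single one, is what iterated limits of
  increasing length provide.
\<close>

locale suppression_family =
  fixes f :: "nat \<Rightarrow> 'v::real_vector \<Rightarrow> real" and d :: "nat \<Rightarrow> 'v" and \<delta> :: real
  assumes seminorm: "seminorm (f m)"
    and suppress: "f m (\<Sum>j<m. (x(i := 0)) j *\<^sub>R d j) \<le> f m (\<Sum>j<m. x j *\<^sub>R d j)"
    and f_d: "i < m \<Longrightarrow> f m (d i) = \<delta>"
    and \<delta>_pos: "\<delta> > 0"
begin

lemma suppress_set: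
  assumes "finite A"
  shows "f m (\<Sum>j<m. (if j \<in> A then 0 else x j) *\<^sub>R d j) \<le> f m (\<Sum>j<m. x j *\<^sub>R d j)"
  using assms
proof (induction A rule: finite_induct)
  case (insert a A)
  have eq: "(if j \<in> insert a A then 0 else x j) = ((\<lambda>j. if j \<in> A then 0 else x j)(a := 0)) j" for j
    by auto
  show ?case
    unfolding eq by (rule order_trans[OF suppress insert.IH])
qed simp

lemma coordinate_le:
  assumes "i < m"
  shows "\<delta> * \<bar>x i\<bar> \<le> f m (\<Sum>j<m. x j *\<^sub>R d j)"
proof -
  interpret seminorm "f m" by (rule seminorm)
  have "(\<Sum>j<m. (if j \<in> {..<m} - {i} then 0 else x j) *\<^sub>R d j) = (\<Sum>j<m. if j = i then x i *\<^sub>R d i else 0)"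
    by (intro sum.cong) auto
  also have "\<dots> = x i *\<^sub>R d i" using assms by simp
  finally show ?thesis
    using suppress_set[of "{..<m} - {i}" m x] assms by (simp add: homog f_d mult.commute)
qed

text \<open>
  Suppose that all \<open>f m\<close> are dominated by a fixed multiple \<open>C\<close> of the
  Euclidean norm. Take \<open>L\<close> scaled copies of each \<open>d i\<close>: the scale for
  which the system has weak 2-norm at most 1 is of order \<open>1 / sqrt L\<close>. If the number
  \<open>m\<close> of rows is large, then with probability at least \<open>1 / 2\<close> the signs
  of some row are all positive; the corresponding coefficient is of order \<open>sqrt L\<close>,
  and by suppression the norm is at least as large.
\<close>

lemma growth_upper_2_estimate:
  assumes C: "C > 0" "\<And>m x. f m (\<Sum>j<m. x j *\<^sub>R d j) \<le> C * sqrt (\<Sum>j<m. (x j)\<^sup>2)"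
  shows "\<exists>m (B :: (nat \<times> nat) set) w. finite B \<and> seminorm.weak2 (f m) B w \<and>
     K \<le> sign_mean B (\<lambda>S. f m (seminorm.radsum B w S))"
proof -
  obtain L :: nat where L: "(2 * \<bar>K\<bar> * C / \<delta>)\<^sup>2 < real L" using reals_Archimedean2 by blast
  have Lpos: "L > 0" using L by (cases L) auto
  have Lbig: "\<bar>K\<bar> \<le> \<delta> * sqrt (real L) / C / 2"
  proof -
    have "2 * \<bar>K\<bar> * C / \<delta> \<le> sqrt (real L)" using L by (simp add: real_le_rsqrt)
    then show ?thesis using C \<delta>_pos by (simp add: field_simps)
  qed
  have "(\<lambda>m. (1 - 1 / 2 ^ L :: real) ^ m) \<longlonglongrightarrow> 0"
    by (rule LIMSEQ_realpow_zero) (auto simp: divide_simps)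
  then have "\<forall>\<^sub>F m in sequentially. (1 - 1 / 2 ^ L :: real) ^ m < 1 / 2"
    by (rule order_tendstoD(2)) simp
  then obtain m where m: "(1 - 1 / 2 ^ L :: real) ^ m < 1 / 2"
    by (auto simp: eventually_sequentially)
  interpret seminorm "f m" by (rule seminorm)
  define t where "t = 1 / (C * sqrt (real L))"
  have t: "t > 0" using C Lpos by (simp add: t_def)
  define B where "B = {..<m} \<times> {..<L}"
  define w where "w = (\<lambda>(i, l::nat). t *\<^sub>R d i)"
  have comb: "(\<Sum>b\<in>B. c b *\<^sub>R w b) = (\<Sum>i<m. (\<Sum>l<L. c (i, l) * t) *\<^sub>R d i)" for c
    by (simp add: B_def w_def scaleR_sum_left split_def sum.cartesian_product')
  have "weak2 B w"
    unfolding weak2_def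
  proof
    fix c
    have "f m (\<Sum>b\<in>B. c b *\<^sub>R w b) \<le> C * sqrt (\<Sum>i<m. (\<Sum>l<L. c (i, l) * t)\<^sup>2)"
      unfolding comb by (rule C)
    also have "\<dots> \<le> C * sqrt (\<Sum>i<m. t\<^sup>2 * (real L * (\<Sum>l<L. (c (i, l))\<^sup>2)))"
    proof -
      have "(\<Sum>l<L. c (i, l) * t)\<^sup>2 \<le> t\<^sup>2 * (real L * (\<Sum>l<L. (c (i, l))\<^sup>2))" for i
      proof -
        have "(\<Sum>l<L. c (i, l) * t)\<^sup>2 = t\<^sup>2 * (\<Sum>l<L. c (i, l))\<^sup>2"
          by (simp add: power_mult_distrib flip: sum_distrib_right)
        then show ?thesis
          using sum_squared_le_sum_of_squares[of "\<lambda>l. c (i, l)" "{..<L}"]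
          by (simp add: mult_left_mono mult.commute)
      qed
      then show ?thesis using C by (intro mult_left_mono real_sqrt_le_mono sum_mono) auto
    qed
    also have "(\<Sum>i<m. t\<^sup>2 * (real L * (\<Sum>l<L. (c (i, l))\<^sup>2))) = (t\<^sup>2 * real L) * (\<Sum>b\<in>B. (c b)\<^sup>2)"
      by (simp add: B_def sum_distrib_left mult.assoc split_def sum.cartesian_product')
    also have "t\<^sup>2 * real L = (1 / C)\<^sup>2"
      using Lpos by (simp add: t_def power_mult_distrib power_divide)
    also have "C * sqrt ((1 / C)\<^sup>2 * (\<Sum>b\<in>B. (c b)\<^sup>2)) = sqrt (\<Sum>b\<in>B. (c b)\<^sup>2)"
      using C by (simp add: real_sqrt_mult real_sqrt_divide)
    finally show "f m (\<Sum>b\<in>B. c b *\<^sub>R w b) \<le> sqrt (\<Sum>b\<in>B. (c b)\<^sup>2)" .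
  qed
  moreover have "K \<le> sign_mean B (\<lambda>S. f m (radsum B w S))"
  proof -
    let ?full = "\<lambda>S. if \<exists>i<m. {i} \<times> {..<L} \<subseteq> S then 1 else 0 :: real"
    have "real L * t = sqrt (real L) / C"
      using Lpos C by (simp add: t_def field_simps)
    then have "K \<le> (\<delta> * (real L * t)) * (1 / 2)"
      using Lbig by simp
    also have "\<dots> \<le> (\<delta> * (real L * t)) * sign_mean B ?full"
      using m t \<delta>_pos unfolding B_def sign_mean_some_full_row by (intro mult_left_mono) auto
    also have "\<dots> = sign_mean B (\<lambda>S. (\<delta> * (real L * t)) * ?full S)"
      by (simp only: sign_mean_cmult)
    also have "\<dots> \<le> sign_mean B (\<lambda>S. f m (radsum B w S))"
    proof (rule sign_mean_mono)
      fix S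
      show "(\<delta> * (real L * t)) * ?full S \<le> f m (radsum B w S)"
      proof (cases "\<exists>i<m. {i} \<times> {..<L} \<subseteq> S")
        case True
        then obtain i where i: "i < m" "{i} \<times> {..<L} \<subseteq> S" by auto
        then have "(\<Sum>l<L. sgnof S (i, l) * t) = real L * t"
          by (simp add: sgnof_def subset_iff)
        then show ?thesis
          using coordinate_le[OF i(1), of "\<lambda>i. \<Sum>l<L. sgnof S (i, l) * t"] True t
          by (simp add: radsum_def comb)
      qed (auto simp: f_nonneg)
    qed
    finally show ?thesis .
  qed
  ultimately show ?thesis by (intro exI[of _ m] exI[of _ B] exI[of _ w]) (simp add: B_def)
qed

text \<open>
  Suppose that for no \<open>C\<close> the seminorms are dominated by \<open>C\<close> times the
  Euclidean norm. Then for some \<open>m\<close> the supremum \<open>\<sigma>\<close> of \<open>f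
  m\<close> over the Euclidean unit ball is large. Take \<open>y\<close> in this ball with
  \<open>f m y > \<sigma> / 2\<close> and remove its coordinates of modulus at least
  \<open>\<eta>\<close>; there are at most \<open>1 / \<eta>\<^sup>2\<close> of them, so for large
  \<open>\<sigma>\<close> the remaining \<open>z\<close> still has \<open>f m z \<ge> \<sigma> /
  4\<close>. Because the coordinates of \<open>z\<close> are at most \<open>\<eta>\<close>, the
  vectors \<open>z i d i / (\<eta> * \<sigma>)\<close> have weak 2-norm at most 1, and because
  \<open>z\<close> is a difference of two suppressions of any of its sign changes, every signed
  sum of them has norm at least \<open>1 / (8 * \<eta>)\<close>.
\<close>

lemma growth_no_upper_2_estimate:
  assumes C: "\<And>C. C > 0 \<Longrightarrow> \<exists>m x. f m (\<Sum>j<m. x j *\<^sub>R d j) > C * sqrt (\<Sum>j<m. (x j)\<^sup>2)"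
  shows "\<exists>m (B :: (nat \<times> nat) set) w. finite B \<and> seminorm.weak2 (f m) B w \<and>
     K \<le> sign_mean B (\<lambda>S. f m (seminorm.radsum B w S))"
proof -
  (* Chosen such that \<open>1 / (8 * \<eta>) = \<bar>K\<bar> + 1\<close>, the lower bound
     obtained for all signed sums. *)
  define \<eta> where "\<eta> = 1 / (8 * (\<bar>K\<bar> + 1))"
  have \<eta>: "\<eta> > 0" by (simp add: \<eta>_def)
  (* With this constant the removed coordinates contribute at most \<open>\<delta> /
     \<eta>\<^sup>2 = C0 / 4 \<le> \<sigma> / 4\<close>. *)
  define C0 where "C0 = 4 * \<delta> / \<eta>\<^sup>2"
  have C0: "C0 > 0" using \<eta> \<delta>_pos by (simp add: C0_def)
  obtain m x where x: "f m (\<Sum>j<m. x j *\<^sub>R d j) > C0 * sqrt (\<Sum>j<m. (x j)\<^sup>2)"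
    using C[OF C0] by auto
  interpret seminorm "f m" by (rule seminorm)
  let ?v = "\<lambda>x. \<Sum>j<m. x j *\<^sub>R d j"
  let ?n = "\<lambda>x. sqrt (\<Sum>j<m. (x j)\<^sup>2)"
  have vscale: "?v (\<lambda>j. c * y j) = c *\<^sub>R ?v y" for c y by (simp add: scaleR_sum_right)
  have nscale: "?n (\<lambda>j. c * y j) = \<bar>c\<bar> * ?n y" for c y
    by (simp add: power_mult_distrib real_sqrt_mult flip: sum_distrib_left)
  have coord: "\<bar>y j\<bar> \<le> ?n y" if "j < m" for y j
    using that member_le_sum[of j "{..<m}" "\<lambda>j. (y j)\<^sup>2"] by (intro real_le_rsqrt) simp
  have vle: "f m (?v y) \<le> real m * \<delta>" if "?n y \<le> 1" for y
  proof -
    have "f m (?v y) \<le> (\<Sum>j<m. \<bar>y j\<bar> * f m (d j))" by (rule f_sum_scaled_le)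
    also have "\<dots> \<le> (\<Sum>j<m. 1 * \<delta>)"
      using order_trans[OF coord[of _ y] that] \<delta>_pos
      by (intro sum_mono mult_mono) (auto simp: f_d f_nonneg)
    finally show ?thesis by simp
  qed
  define \<sigma> where "\<sigma> = Sup {f m (?v y) | y. ?n y \<le> 1}"
  have bdd: "bdd_above {f m (?v y) | y. ?n y \<le> 1}" using vle by (auto intro!: bdd_aboveI)
  have le_\<sigma>: "f m (?v y) \<le> \<sigma>" if "?n y \<le> 1" for y
    unfolding \<sigma>_def using that bdd by (intro cSup_upper) auto
  have le_\<sigma>_n: "f m (?v y) \<le> \<sigma> * ?n y" for y
  proof (cases "?n y = 0")
    case True
    then have "y j = 0" if "j < m" for j using coord[OF that, of y] by simp
    then have "?v y = 0" by simp
    with True show ?thesis by simp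
  next
    case False
    then have pos: "?n y > 0" by (simp add: sum_nonneg order_less_le)
    have "f m (?v (\<lambda>j. (1 / ?n y) * y j)) \<le> \<sigma>"
      using pos by (intro le_\<sigma>) (simp only: nscale, simp)
    then show ?thesis using pos unfolding vscale homog by (simp add: divide_le_eq)
  qed
  have \<sigma>: "\<sigma> > C0"
  proof (rule ccontr)
    assume "\<not> ?thesis"
    then have "\<sigma> * ?n x \<le> C0 * ?n x" by (intro mult_right_mono) (auto simp: sum_nonneg)
    with le_\<sigma>_n[of x] x show False by simp
  qed
  then have \<sigma>0: "\<sigma> > 0" using C0 by simp
  have "\<sigma> / 2 < Sup {f m (?v y) | y. ?n y \<le> 1}"
    using \<sigma>0 unfolding \<sigma>_def[symmetric] by simp
  then obtain y where y: "?n y \<le> 1" "\<sigma> / 2 < f m (?v y)"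
    by (subst (asm) less_cSup_iff) (use bdd in \<open>auto intro!: exI[of _ "\<lambda>_. 0"]\<close>)
  define A where "A = {j\<in>{..<m}. \<bar>y j\<bar> \<ge> \<eta>}"
  define z where "z j = (if j \<in> A then 0 else y j)" for j
  have fz: "\<sigma> / 4 \<le> f m (?v z)"
  proof -
    have "real (card A) * \<eta>\<^sup>2 \<le> (\<Sum>j\<in>A. (y j)\<^sup>2)"
    proof -
      have "(\<Sum>j\<in>A. \<eta>\<^sup>2) \<le> (\<Sum>j\<in>A. (y j)\<^sup>2)"
        using \<eta> by (intro sum_mono) (auto simp: A_def abs_le_square_iff[symmetric])
      then show ?thesis by simp
    qed
    also have "\<dots> \<le> (\<Sum>j<m. (y j)\<^sup>2)" by (intro sum_mono2) (auto simp: A_def)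
    also have "\<dots> \<le> 1" using y(1) by simp
    finally have card: "real (card A) \<le> 1 / \<eta>\<^sup>2" using \<eta> by (simp add: field_simps)
    have "?v y = ?v z + (\<Sum>j\<in>A. y j *\<^sub>R d j)"
    proof -
      have "?v y = (\<Sum>j<m. z j *\<^sub>R d j + (if j \<in> A then y j *\<^sub>R d j else 0))"
        by (intro sum.cong) (auto simp: z_def)
      also have "\<dots> = ?v z + (\<Sum>j<m. if j \<in> A then y j *\<^sub>R d j else 0)" by (simp add: sum.distrib)
      also have "(\<Sum>j<m. if j \<in> A then y j *\<^sub>R d j else 0) = (\<Sum>j\<in>A. y j *\<^sub>R d j)"
        by (subst sum.inter_restrict[symmetric]) (auto simp: A_def intro!: sum.cong)
      finally show ?thesis .
    qed
    then have "f m (?v y) \<le> f m (?v z) + f m (\<Sum>j\<in>A. y j *\<^sub>R d j)" using subadd by simp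
    also have "f m (\<Sum>j\<in>A. y j *\<^sub>R d j) \<le> (\<Sum>j\<in>A. \<bar>y j\<bar> * f m (d j))" by (rule f_sum_scaled_le)
    also have "\<dots> \<le> (\<Sum>j\<in>A. 1 * \<delta>)"
      using order_trans[OF coord[of _ y] y(1)] \<delta>_pos
      by (intro sum_mono mult_mono) (auto simp: f_d f_nonneg A_def)
    also have "\<dots> \<le> \<delta> / \<eta>\<^sup>2" using card \<delta>_pos mult_right_mono[OF card, of \<delta>] by simp
    also have "\<dots> = C0 / 4" by (simp add: C0_def)
    finally show ?thesis using y(2) \<sigma> by linarith
  qed
  have z_small: "\<bar>z j\<bar> \<le> \<eta>" if "j < m" for j using that \<eta> by (auto simp: z_def A_def)
  define B where "B = {..<m} \<times> {0::nat}"
  define w where "w = (\<lambda>(i, l::nat). (z i / (\<eta> * \<sigma>)) *\<^sub>R d i)"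
  have comb: "(\<Sum>b\<in>B. c b *\<^sub>R w b) = (1 / (\<eta> * \<sigma>)) *\<^sub>R ?v (\<lambda>i. c (i, 0) * z i)" for c
    by (simp add: B_def w_def split_def scaleR_sum_right sum.cartesian_product')
  have "weak2 B w"
    unfolding weak2_def
  proof
    fix c :: "nat \<times> nat \<Rightarrow> real"
    have "f m (?v (\<lambda>i. c (i, 0) * z i)) \<le> \<sigma> * ?n (\<lambda>i. c (i, 0) * z i)" by (rule le_\<sigma>_n)
    also have "\<dots> \<le> \<sigma> * ?n (\<lambda>i. \<eta> * c (i, 0))"
    proof -
      have "(c (i, 0) * z i)\<^sup>2 \<le> (\<eta> * c (i, 0))\<^sup>2" if "i < m" for i
        using mult_right_mono[OF z_small[OF that], of "\<bar>c (i, 0)\<bar>"] \<eta>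
        by (simp add: abs_le_square_iff[symmetric] abs_mult mult.commute)
      then show ?thesis using \<sigma>0 by (intro mult_left_mono real_sqrt_le_mono sum_mono) auto
    qed
    also have "\<dots> = \<sigma> * \<eta> * sqrt (\<Sum>b\<in>B. (c b)\<^sup>2)"
      using \<eta> by (simp only: nscale) (simp add: B_def sum.cartesian_product')
    finally show "f m (\<Sum>b\<in>B. c b *\<^sub>R w b) \<le> sqrt (\<Sum>b\<in>B. (c b)\<^sup>2)"
      using \<sigma>0 \<eta> unfolding comb homog by (simp add: divide_le_eq mult_ac)
  qed
  moreover have "K \<le> sign_mean B (\<lambda>S. f m (radsum B w S))"
  proof -
    have "K \<le> sign_mean B (\<lambda>S. \<bar>K\<bar> + 1)" by (simp add: B_def)
    also have "\<dots> \<le> sign_mean B (\<lambda>S. f m (radsum B w S))"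
    proof (rule sign_mean_mono)
      fix S :: "(nat \<times> nat) set"
      define u where "u i = sgnof S (i, 0) * z i" for i
      define P where "P = {i\<in>{..<m}. (i, 0) \<in> S}"
      have "?v z = ?v (\<lambda>j. if j \<in> {..<m} - P then 0 else u j) - ?v (\<lambda>j. if j \<in> P then 0 else u j)"
        unfolding sum_subtractf[symmetric] by (intro sum.cong) (auto simp: u_def P_def sgnof_def)
      then have "f m (?v z) \<le> f m (?v (\<lambda>j. if j \<in> {..<m} - P then 0 else u j)) + f m (?v (\<lambda>j. if j \<in> P then 0 else u j))"
        using subadd[of "?v (\<lambda>j. if j \<in> {..<m} - P then 0 else u j)" "- ?v (\<lambda>j. if j \<in> P then 0 else u j)"]
        by (simp add: f_minus)
      also have "\<dots> \<le> f m (?v u) + f m (?v u)"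
        by (intro add_mono suppress_set) (auto simp: P_def)
      finally have "\<sigma> / 8 \<le> f m (?v u)" using fz by simp
      moreover have "f m (radsum B w S) = f m (?v u) / (\<eta> * \<sigma>)"
        using \<eta> \<sigma>0 by (simp add: radsum_def comb homog u_def abs_mult)
      ultimately have "(\<sigma> / 8) / (\<eta> * \<sigma>) \<le> f m (radsum B w S)"
        using \<eta> \<sigma>0 by (simp only:) (intro divide_right_mono, auto)
      moreover have "(\<sigma> / 8) / (\<eta> * \<sigma>) = \<bar>K\<bar> + 1" using \<sigma>0 by (simp add: \<eta>_def field_simps)
      ultimately show "\<bar>K\<bar> + 1 \<le> f m (radsum B w S)" by simp
    qed
    finally show ?thesis .
  qed
  ultimately show ?thesis by (intro exI[of _ m] exI[of _ B] exI[of _ w]) (simp add: B_def)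
qed

lemma growth:
  "\<exists>m (B :: (nat \<times> nat) set) w. finite B \<and> seminorm.weak2 (f m) B w \<and>
     K \<le> sign_mean B (\<lambda>S. f m (seminorm.radsum B w S))"
proof (cases "\<exists>C>0. \<forall>m x. f m (\<Sum>j<m. x j *\<^sub>R d j) \<le> C * sqrt (\<Sum>j<m. (x j)\<^sup>2)")
  case True
  then show ?thesis using growth_upper_2_estimate by blast
next
  case False
  show ?thesis
  proof (rule growth_no_upper_2_estimate)
    show "\<exists>m x. f m (\<Sum>j<m. x j *\<^sub>R d j) > C * sqrt (\<Sum>j<m. (x j)\<^sup>2)" if "C > 0" for C
      using False that by (meson not_le)
  qed
qed

end

section \<open>Almost Euclidean sections of suppression unconditional norms\<close>

text \<open>
  Splitting each vector into scaled copies, with scales that form a unit vector, preserves the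
  weak 2-norm, by the Cauchy--Schwarz inequality. Hence the variance bound is independent of
  \<open>k\<close>.
\<close>

lemma (in seminorm) weak2_repeated_signs:
  fixes w :: "'b \<Rightarrow> 'v" and n k :: nat
  assumes B: "finite B" and w: "weak2 B w" and a: "(\<Sum>j<n. (a j)\<^sup>2) = 1" and k: "k > 0"
  shows "weak2 (clt_index B n k) (\<lambda>(b, j, l). (a j / sqrt (real k)) *\<^sub>R w b)"
  unfolding weak2_def
proof
  fix c :: "'b \<times> nat \<times> nat \<Rightarrow> real"
  define g where "g b = (\<Sum>j<n. \<Sum>l<k. c (b, j, l) * (a j / sqrt (real k)))" for b
  have "(\<Sum>q\<in>clt_index B n k. c q *\<^sub>R (case q of (b, j, l) \<Rightarrow> (a j / sqrt (real k)) *\<^sub>R w b)) =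
      (\<Sum>b\<in>B. g b *\<^sub>R w b)"
    by (simp add: sum_clt_index g_def scaleR_sum_left)
  then have "f (\<Sum>q\<in>clt_index B n k. c q *\<^sub>R (case q of (b, j, l) \<Rightarrow> (a j / sqrt (real k)) *\<^sub>R w b))
      \<le> sqrt (\<Sum>b\<in>B. (g b)\<^sup>2)"
    using weak2D[OF w, of g] by simp
  also have "\<dots> \<le> sqrt (\<Sum>b\<in>B. \<Sum>j<n. \<Sum>l<k. (c (b, j, l))\<^sup>2)"
  proof (intro real_sqrt_le_mono sum_mono)
    fix b
    have "(g b)\<^sup>2 = (\<Sum>p\<in>{..<n} \<times> {..<k}. c (b, p) * (a (fst p) / sqrt (real k)))\<^sup>2"
      by (simp add: g_def sum.cartesian_product')
    also have "\<dots> \<le> (\<Sum>p\<in>{..<n} \<times> {..<k}. (c (b, p))\<^sup>2) * (\<Sum>p\<in>{..<n} \<times> {..<k}. (a (fst p) / sqrt (real k))\<^sup>2)"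
      by (rule Cauchy_Schwarz_ineq_sum)
    also have "(\<Sum>p\<in>{..<n} \<times> {..<k}. (a (fst p) / sqrt (real k))\<^sup>2) = 1"
      using a k by (simp add: sum.cartesian_product' power_divide)
    finally show "(g b)\<^sup>2 \<le> (\<Sum>j<n. \<Sum>l<k. (c (b, j, l))\<^sup>2)"
      by (simp add: sum.cartesian_product')
  qed
  finally show "f (\<Sum>q\<in>clt_index B n k. c q *\<^sub>R (case q of (b, j, l) \<Rightarrow> (a j / sqrt (real k)) *\<^sub>R w b))
      \<le> sqrt (\<Sum>q\<in>clt_index B n k. (c q)\<^sup>2)"
    by (simp add: sum_clt_index)
qed

lemma (in seminorm) radsum_repeated_signs:
  "radsum (clt_index B n k) (\<lambda>(b, j, l). (a j / sqrt (real k)) *\<^sub>R w b) S =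
   (\<Sum>b\<in>B. clt_sum n a k S b *\<^sub>R w b)"
  by (simp add: radsum_def sum_clt_index clt_sum_def scaleR_sum_left mult.commute)

text \<open>
  For each of the finitely many directions \<open>u x\<close> the random value \<open>F (u x) k
  S\<close> has a mean within 1 of the same number \<open>\<mu>\<close> and variance at most 2.
  Therefore some sign pattern \<open>S\<close> is within \<open>sqrt (2 * card A1) + 1\<close> of
  \<open>\<mu>\<close> in all directions simultaneously, and after division by \<open>\<mu> >
  K\<close> this is a small relative error.
\<close>

theorem (in suppression_family) almost_Euclidean:
  fixes n :: nat
  assumes A: "finite A" and \<eta>: "\<eta> > 0"
  shows "\<exists>m v. \<forall>x\<in>A. \<bar>f m (\<Sum>j<n. x j *\<^sub>R v j) - sqrt (\<Sum>j<n. (x j)\<^sup>2)\<bar> < \<eta>"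
proof -
  define r where "r x = sqrt (\<Sum>j<n. (x j :: real)\<^sup>2)" for x
  define A1 where "A1 = {x\<in>A. r x \<noteq> 0}"
  have A1: "finite A1" using A by (simp add: A1_def)
  have r0: "r x \<ge> 0" for x by (simp add: r_def sum_nonneg)
  define R where "R = (\<Sum>x\<in>A. r x) + 1"
  have R: "R > 0" using r0 by (simp add: R_def add_nonneg_pos sum_nonneg)
  have rR: "r x \<le> R" if "x \<in> A" for x
    using member_le_sum[OF that, of r] r0 A by (simp add: R_def)
  define \<tau> where "\<tau> = sqrt (2 * real (card A1))"
  have \<tau>: "\<tau> \<ge> 0" by (simp add: \<tau>_def)
  (* An absolute deviation \<open>\<tau> + 1\<close> becomes \<open>R * (\<tau> + 1) / K = \<eta>
     / 2\<close> after scaling. *)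
  define K where "K = 2 * R * (\<tau> + 1) / \<eta>"
  have K: "K > 0" using R \<tau> \<eta> by (simp add: K_def)
  obtain m B and w :: "nat \<times> nat \<Rightarrow> 'v" where B: "finite B" and weak: "seminorm.weak2 (f m) B w"
    and big: "4 * (K + 2) \<le> sign_mean B (\<lambda>S. f m (seminorm.radsum B w S))"
    using growth[of "4 * (K + 2)"] by blast
  interpret seminorm "f m" by (rule seminorm)
  define F where "F a k S = f m (\<Sum>b\<in>B. clt_sum n a k S b *\<^sub>R w b)" for a :: "nat \<Rightarrow> real" and k S
  let ?I = "clt_index B n"
  obtain \<mu> where \<mu>: "\<And>N a. (\<Sum>j<N. (a j)\<^sup>2) = 1 \<Longrightarrow> \<forall>\<^sub>F k in sequentially.
       \<bar>sign_mean (clt_index B N k) (\<lambda>S. f m (\<Sum>b\<in>B. clt_sum N a k S b *\<^sub>R w b)) - \<mu>\<bar> \<le> 1"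
    using clt_seminorm[OF B zero_less_one, of w] by blast
  (* The number \<open>\<mu>\<close> is also within 1 of the averages for \<open>n = 1\<close>,
     which were bounded below. *)
  have "\<mu> \<ge> K + 1"
  proof -
    have one: "(\<Sum>j<1::nat. 1\<^sup>2) = (1 :: real)" by simp
    have "\<forall>\<^sub>F k in sequentially. \<mu> \<ge> K + 1"
      using \<mu>[OF one] repeated_signs_mean_ge[OF B, of w]
    proof eventually_elim
      case (elim k)
      have "K + 1 \<le> \<mu>" if "\<bar>x - \<mu>\<bar> \<le> 1" "y / 4 \<le> x" "4 * (K + 2) \<le> y" for x y :: real
        using abs_le_D1[OF that(1)] that(2,3) by (simp add: field_simps)
      from this[OF elim big] show ?case .
    qed
    then show ?thesis by simp
  qed
  with K have \<mu>0: "\<mu> > 0" by simp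
  define u where "u x j = x j / r x" for x j
  have u: "(\<Sum>j<n. (u x j)\<^sup>2) = 1" if "x \<in> A1" for x
  proof -
    have "(r x)\<^sup>2 = (\<Sum>j<n. (x j)\<^sup>2)" by (simp add: r_def sum_nonneg)
    then show ?thesis
      using that zero_less_power2[of "r x"]
      by (auto simp: u_def power_divide A1_def simp flip: sum_divide_distrib)
  qed
  have "\<forall>\<^sub>F k in sequentially. k > 0 \<and> (\<forall>x\<in>A1. \<bar>sign_mean (?I k) (F (u x) k) - \<mu>\<bar> \<le> 1)"
  proof (intro eventually_conj eventually_gt_at_top)
    show "\<forall>\<^sub>F k in sequentially. \<forall>x\<in>A1. \<bar>sign_mean (?I k) (F (u x) k) - \<mu>\<bar> \<le> 1"
      using \<mu> u A1 unfolding F_def by (intro eventually_ball_finite) auto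
  qed
  then obtain k where k: "k > 0" "\<And>x. x \<in> A1 \<Longrightarrow> \<bar>sign_mean (?I k) (F (u x) k) - \<mu>\<bar> \<le> 1"
    by (auto simp: eventually_sequentially)
  have var: "sign_mean (?I k) (\<lambda>S. (F (u x) k S - sign_mean (?I k) (F (u x) k))\<^sup>2) \<le> 2"
    if "x \<in> A1" for x
    using radsum_variance[OF _ weak2_repeated_signs[OF B weak u[OF that] k(1)]] B
    by (simp add: radsum_repeated_signs F_def[abs_def])
  have "sign_mean (?I k) (\<lambda>S. \<Sum>x\<in>A1. (F (u x) k S - sign_mean (?I k) (F (u x) k))\<^sup>2) \<le> 2 * real (card A1)"
    using sum_mono[of A1, OF var] by (simp add: sign_mean_sum mult.commute)
  then obtain S where S: "(\<Sum>x\<in>A1. (F (u x) k S - sign_mean (?I k) (F (u x) k))\<^sup>2) \<le> 2 * real (card A1)"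
    using sign_mean_le_exists[of "?I k"] B by (metis (no_types, lifting) finite_clt_index)
  have dev: "\<bar>F (u x) k S - \<mu>\<bar> \<le> \<tau> + 1" if "x \<in> A1" for x
  proof -
    have "(F (u x) k S - sign_mean (?I k) (F (u x) k))\<^sup>2 \<le> 2 * real (card A1)"
      using S member_le_sum[OF that, of "\<lambda>x. (F (u x) k S - sign_mean (?I k) (F (u x) k))\<^sup>2"] A1
      by simp
    then have "\<bar>F (u x) k S - sign_mean (?I k) (F (u x) k)\<bar> \<le> \<tau>"
      unfolding \<tau>_def by (intro real_le_rsqrt) simp
    moreover have "\<bar>p - q\<bar> \<le> \<tau> + 1" if "\<bar>p - s\<bar> \<le> \<tau>" "\<bar>s - q\<bar> \<le> 1" for p q s :: real
      using that by linarith
    ultimately show ?thesis using k(2)[OF that] by blast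
  qed
  define v where "v j = (1 / \<mu>) *\<^sub>R (\<Sum>b\<in>B. (\<Sum>l<k. 1 / sqrt (real k) * sgnof S (b, j, l)) *\<^sub>R w b)" for j
  have comb: "(\<Sum>j<n. x j *\<^sub>R v j) = (r x / \<mu>) *\<^sub>R (\<Sum>b\<in>B. clt_sum n (u x) k S b *\<^sub>R w b)"
    if "x \<in> A1" for x
  proof -
    have "(\<Sum>j<n. x j *\<^sub>R v j) =
       (1 / \<mu>) *\<^sub>R (\<Sum>b\<in>B. \<Sum>j<n. (x j * (\<Sum>l<k. 1 / sqrt (real k) * sgnof S (b, j, l))) *\<^sub>R w b)"
      unfolding v_def by (subst sum.swap) (simp add: scaleR_sum_right mult_ac)
    also have "(\<Sum>b\<in>B. \<Sum>j<n. (x j * (\<Sum>l<k. 1 / sqrt (real k) * sgnof S (b, j, l))) *\<^sub>R w b) =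
       (\<Sum>b\<in>B. (r x * clt_sum n (u x) k S b) *\<^sub>R w b)"
      using that
      by (intro sum.cong refl)
         (simp add: clt_sum_def u_def sum_distrib_left scaleR_sum_left[symmetric] A1_def)
    finally show ?thesis by (simp add: scaleR_sum_right)
  qed
  show ?thesis
  proof (intro exI ballI)
    fix x assume x: "x \<in> A"
    show "\<bar>f m (\<Sum>j<n. x j *\<^sub>R v j) - sqrt (\<Sum>j<n. (x j)\<^sup>2)\<bar> < \<eta>"
    proof (cases "r x = 0")
      case True
      then have "(\<Sum>j<n. (x j)\<^sup>2) = 0" by (simp add: r_def)
      then have "\<And>j. j < n \<Longrightarrow> x j = 0" by (simp add: sum_nonneg_eq_0_iff)
      then show ?thesis using \<eta> by simp
    next
      case False
      with x have x1: "x \<in> A1" by (simp add: A1_def)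
      have "f m (\<Sum>j<n. x j *\<^sub>R v j) = (r x / \<mu>) * F (u x) k S"
        using \<mu>0 r0[of x] by (simp add: comb[OF x1] homog F_def)
      then have "\<bar>f m (\<Sum>j<n. x j *\<^sub>R v j) - r x\<bar> = \<bar>(r x / \<mu>) * (F (u x) k S - \<mu>)\<bar>"
        using \<mu>0 by (simp add: right_diff_distrib)
      also have "\<dots> = (r x / \<mu>) * \<bar>F (u x) k S - \<mu>\<bar>"
        using \<mu>0 r0[of x] by (simp add: abs_mult)
      also have "\<dots> \<le> (R / K) * (\<tau> + 1)"
        using rR[OF x] r0[of x] R K \<mu>0 \<open>\<mu> \<ge> K + 1\<close> dev[OF x1] \<tau>
        by (intro mult_mono frac_le) auto
      also have "\<dots> = \<eta> / 2"
      proof -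
        have "K * \<eta> = 2 * R * (\<tau> + 1)" using \<eta> by (simp add: K_def)
        then show ?thesis using K by (simp add: field_simps)
      qed
      also have "\<dots> < \<eta>" using \<eta> by simp
      finally show ?thesis by (simp add: r_def)
    qed
  qed
qed

section \<open>Limits along an ultrafilter\<close>

definition free_ultrafilter :: "nat filter \<Rightarrow> bool" where
  "free_ultrafilter U \<longleftrightarrow> U \<noteq> bot \<and> U \<le> sequentially \<and>
     (\<forall>P. eventually P U \<or> eventually (\<lambda>n. \<not> P n) U)"

text \<open>
  Zorn's lemma for filters of sets that contain the cofinite sets; a maximal one contains every
  set or its complement.
\<close>

lemma free_ultrafilter_exists: "\<exists>U. free_ultrafilter U"
proof -
  define \<A> where "\<A> = {G :: nat set set. (\<forall>X. finite (- X) \<longrightarrow> X \<in> G) \<and> {} \<notin> G \<and>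
     (\<forall>X\<in>G. \<forall>Y\<in>G. X \<inter> Y \<in> G) \<and> (\<forall>X\<in>G. \<forall>Y. X \<subseteq> Y \<longrightarrow> Y \<in> G)}"
  have D: "finite (- X) \<Longrightarrow> X \<in> G" "{} \<notin> G" "X \<in> G \<Longrightarrow> Y \<in> G \<Longrightarrow> X \<inter> Y \<in> G"
    "X \<in> G \<Longrightarrow> X \<subseteq> Y \<Longrightarrow> Y \<in> G" if "G \<in> \<A>" for G X Y
    using that unfolding \<A>_def by simp_all
  have I: "G \<in> \<A>" if "\<And>X. finite (- X) \<Longrightarrow> X \<in> G" "{} \<notin> G"
    "\<And>X Y. X \<in> G \<Longrightarrow> Y \<in> G \<Longrightarrow> X \<inter> Y \<in> G" "\<And>X Y. X \<in> G \<Longrightarrow> X \<subseteq> Y \<Longrightarrow> Y \<in> G" for G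
    using that unfolding \<A>_def by simp
  have "{X. finite (- X)} \<in> \<A>"
    by (auto simp: \<A>_def Compl_Int intro: finite_subset)
  then have ne: "\<A> \<noteq> {}" by auto
  have "\<exists>M\<in>\<A>. \<forall>X\<in>\<A>. M \<subseteq> X \<longrightarrow> X = M"
  proof (rule subset_Zorn_nonempty[OF ne])
    fix \<C> assume C: "\<C> \<noteq> {}" "subset.chain \<A> \<C>"
    then have sub: "\<C> \<subseteq> \<A>" and lin: "\<And>G H. G \<in> \<C> \<Longrightarrow> H \<in> \<C> \<Longrightarrow> G \<subseteq> H \<or> H \<subseteq> G"
      by (auto simp: subset.chain_def)
    obtain G0 where G0: "G0 \<in> \<C>" using C by auto
    show "\<Union>\<C> \<in> \<A>"
    proof (rule I)
      show "X \<in> \<Union>\<C>" if "finite (- X)" for X using D(1)[OF _ that] G0 sub by blast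
      show "{} \<notin> \<Union>\<C>" using D(2) sub by blast
      show "Y \<in> \<Union>\<C>" if "X \<in> \<Union>\<C>" "X \<subseteq> Y" for X Y using that D(4)[of _ X Y] sub by blast
      show "X \<inter> Y \<in> \<Union>\<C>" if XY: "X \<in> \<Union>\<C>" "Y \<in> \<Union>\<C>" for X Y
      proof -
        obtain G H where GH: "X \<in> G" "G \<in> \<C>" "Y \<in> H" "H \<in> \<C>" using XY by blast
        then obtain K where "K \<in> \<C>" "X \<in> K" "Y \<in> K" using lin[of G H] by blast
        then show ?thesis using D(3)[of K X Y] sub by blast
      qed
    qed
  qed
  then obtain M where M: "M \<in> \<A>" and max0: "\<forall>X\<in>\<A>. M \<subseteq> X \<longrightarrow> X = M" by (rule bexE)
  note max = max0[rule_format]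
  have cof: "finite (- X) \<Longrightarrow> X \<in> M" and emp: "{} \<notin> M"
    and int: "X \<in> M \<Longrightarrow> Y \<in> M \<Longrightarrow> X \<inter> Y \<in> M" and up: "X \<in> M \<Longrightarrow> X \<subseteq> Y \<Longrightarrow> Y \<in> M" for X Y
    using D[OF M] by blast+
  have ultra: "P \<in> M \<or> - P \<in> M" for P
  proof (rule ccontr)
    assume not: "\<not> (P \<in> M \<or> - P \<in> M)"
    (* The filter generated by \<open>M\<close> and \<open>P\<close>. *)
    define M' where "M' = {Z. \<exists>Y\<in>M. Y \<inter> P \<subseteq> Z}"
    have "{} \<notin> M'"
    proof
      assume "{} \<in> M'"
      then obtain Y where "Y \<in> M" "Y \<subseteq> - P" unfolding M'_def by blast
      with up not show False by blast
    qed
    moreover have "X \<inter> Y \<in> M'" if XY: "X \<in> M'" "Y \<in> M'" for X Y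
    proof -
      obtain A B where "A \<in> M" "A \<inter> P \<subseteq> X" "B \<in> M" "B \<inter> P \<subseteq> Y"
        using XY unfolding M'_def by blast
      then show ?thesis using int[of A B] unfolding M'_def by blast
    qed
    moreover have "X \<in> M'" if "finite (- X)" for X using cof[OF that] unfolding M'_def by blast
    moreover have "Y \<in> M'" if "X \<in> M'" "X \<subseteq> Y" for X Y using that unfolding M'_def by blast
    ultimately have "M' \<in> \<A>" by (intro I) blast+
    moreover have "M \<subseteq> M'" unfolding M'_def by blast
    ultimately have "M' = M" by (rule max)
    moreover have "P \<in> M'" using cof[of UNIV] unfolding M'_def by auto
    ultimately show False using not by simp
  qed
  have "is_filter (\<lambda>P. {n. P n} \<in> M)"
  proof
    show "{n. True} \<in> M" using cof[of UNIV] by simp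
    show "{n. P n \<and> Q n} \<in> M" if "{n. P n} \<in> M" "{n. Q n} \<in> M" for P Q
      using int[OF that] by (simp add: Int_def)
    show "{n. Q n} \<in> M" if "\<forall>n. P n \<longrightarrow> Q n" "{n. P n} \<in> M" for P Q
      using up[OF that(2), of "{n. Q n}"] that(1) by auto
  qed
  then have ev: "eventually P (Abs_filter (\<lambda>P. {n. P n} \<in> M)) \<longleftrightarrow> {n. P n} \<in> M" for P
    by (rule eventually_Abs_filter)
  define U where "U = Abs_filter (\<lambda>P. {n. P n} \<in> M)"
  have "U \<noteq> bot" using emp ev[of "\<lambda>_. False"] by (auto simp: U_def trivial_limit_def)
  moreover have "U \<le> sequentially"
  proof (rule filter_leI)
    fix P :: "nat \<Rightarrow> bool" assume "eventually P sequentially"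
    then obtain N where "\<And>n. n \<ge> N \<Longrightarrow> P n" by (auto simp: eventually_sequentially)
    then have "- {n. P n} \<subseteq> {..<N}" by (force simp: not_le[symmetric])
    then show "eventually P U" unfolding U_def ev by (intro cof) (rule finite_subset, auto)
  qed
  moreover have "eventually P U \<or> eventually (\<lambda>n. \<not> P n) U" for P
    using ultra[of "{n. P n}"] by (simp add: U_def ev Compl_eq)
  ultimately show ?thesis by (auto simp: free_ultrafilter_def)
qed

locale ultra =
  fixes U :: "nat filter"
  assumes free: "free_ultrafilter U"
begin

lemma U_not_bot [simp]: "U \<noteq> bot"
  and U_le: "U \<le> sequentially"
  and ultra: "eventually P U \<or> eventually (\<lambda>n. \<not> P n) U"
  using free by (auto simp: free_ultrafilter_def)

lemma eventually_U: "eventually P sequentially \<Longrightarrow> eventually P U"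
  using U_le by (rule filter_leD)

definition ulim :: "(nat \<Rightarrow> real) \<Rightarrow> real" where "ulim g = Lim U g"

lemma bounded_tendsto_ulim:
  assumes "\<And>n. a \<le> g n" "\<And>n. g n \<le> b"
  shows "(g \<longlongrightarrow> ulim g) U"
proof -
  have "filtermap g U \<noteq> bot" by (simp add: filtermap_bot_iff)
  moreover have "eventually (\<lambda>x. x \<in> {a..b}) (filtermap g U)"
    using assms by (simp add: eventually_filtermap)
  ultimately obtain x where x: "inf (nhds x) (filtermap g U) \<noteq> bot"
    using compact_Icc[of a b] unfolding compact_filter by blast
  have "(g \<longlongrightarrow> x) U"
  proof (rule topological_tendstoI)
    fix S :: "real set" assume S: "open S" "x \<in> S"
    show "eventually (\<lambda>n. g n \<in> S) U"
    proof (rule ccontr)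
      assume "\<not> ?thesis"
      then have "eventually (\<lambda>n. g n \<notin> S) U" using ultra[of "\<lambda>n. g n \<in> S"] by auto
      then have "eventually (\<lambda>y. y \<notin> S) (filtermap g U)" by (simp add: eventually_filtermap)
      moreover have "eventually (\<lambda>y. y \<in> S) (nhds x)" using S by (rule eventually_nhds_in_open)
      ultimately have "eventually (\<lambda>_. False) (inf (nhds x) (filtermap g U))"
        unfolding eventually_inf by blast
      with x show False by (simp add: trivial_limit_def)
    qed
  qed
  then show ?thesis unfolding ulim_def by (simp add: tendsto_Lim)
qed

lemma ulim_eqI: "(g \<longlongrightarrow> l) U \<Longrightarrow> ulim g = l"
  unfolding ulim_def by (rule tendsto_Lim) simp_all

end

section \<open>Linear combinations and vector arithmetic in a space with a carrier set\<close>

context vnormed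
begin

lemma zero_norm [simp]: "vnorm V (vzero V) = 0"
  using norm_eq_zero zero_closed by blast

lemmas closed = zero_closed add_closed scale_closed

lemma add_zero_right: "x \<in> vcarrier V \<Longrightarrow> vadd V x (vzero V) = x"
  using add_commute add_zero zero_closed by simp

lemma add_left_commute:
  "\<lbrakk>x \<in> vcarrier V; y \<in> vcarrier V; z \<in> vcarrier V\<rbrakk> \<Longrightarrow> vadd V x (vadd V y z) = vadd V y (vadd V x z)"
  using add_assoc add_commute add_closed by metis

lemmas add_ac = add_assoc add_commute add_left_commute

lemma scale_zero: "vscale V r (vzero V) = vzero V"
  using norm_eq_zero[OF scale_closed[OF zero_closed]] norm_scale[OF zero_closed] by simp

text \<open>
  Linear combinations of the first \<open>m\<close> vectors of a sequence. Coefficients given by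
  functions, unlike lists, can be added pointwise and do not have to be cut when \<open>m\<close>
  varies.
\<close>

primrec lin :: "(nat \<Rightarrow> 'a) \<Rightarrow> (nat \<Rightarrow> real) \<Rightarrow> nat \<Rightarrow> 'a" where
  "lin z x 0 = vzero V"
| "lin z x (Suc m) = vadd V (lin z x m) (vscale V (x m) (z m))"

lemma lin_closed: "(\<And>i. z i \<in> vcarrier V) \<Longrightarrow> lin z x m \<in> vcarrier V"
  by (induction m) (auto simp: closed)

lemma lin_add:
  assumes "\<And>i. z i \<in> vcarrier V"
  shows "lin z (\<lambda>i. x i + y i) m = vadd V (lin z x m) (lin z y m)"
  by (induction m) (simp_all add: closed lin_closed assms add_zero scale_add_left add_ac)

lemma lin_scale:
  assumes "\<And>i. z i \<in> vcarrier V"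
  shows "lin z (\<lambda>i. c * x i) m = vscale V c (lin z x m)"
  by (induction m) (simp_all add: closed lin_closed assms scale_zero scale_add_right scale_scale)

lemma lin_zero:
  assumes "\<And>i. z i \<in> vcarrier V"
  shows "lin z (\<lambda>i. 0) m = vzero V"
  by (induction m) (simp_all add: closed assms zero_scale add_zero)

lemma lin_cong:
  assumes "\<And>i. i < m \<Longrightarrow> x i = y i"
  shows "lin z x m = lin z y m"
  using assms by (induction m) simp_all

lemma lin_extend:
  assumes "\<And>i. z i \<in> vcarrier V" "\<And>i. n \<le> i \<Longrightarrow> x i = 0" "n \<le> m"
  shows "lin z x m = lin z x n"
  using assms(3)
  by (induction m rule: dec_induct) (simp_all add: assms lin_closed zero_scale add_zero_right)

lemma lin_lin:
  assumes "\<And>i. z i \<in> vcarrier V"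
  shows "lin (\<lambda>j. lin z (v j) m) x n = lin z (\<lambda>i. \<Sum>j<n. x j * v j i) m"
proof (induction n)
  case 0
  show ?case by (simp add: lin_zero assms)
next
  case (Suc n)
  then show ?case by (simp add: lin_add lin_scale assms)
qed

lemma norm_diff_le:
  assumes "x \<in> vcarrier V" "y \<in> vcarrier V"
  shows "\<bar>vnorm V x - vnorm V y\<bar> \<le> vnorm V (vadd V x (vscale V (- 1) y))"
proof -
  let ?d = "vadd V x (vscale V (- 1) y)"
  have "vadd V ?d y = x"
    using assms by (simp add: add_assoc closed add_commute[of "vscale V (- 1) y"] add_neg add_zero_right)
  moreover have "vadd V x (vscale V (- 1) ?d) = y"
    using assms by (simp add: scale_add_right closed scale_scale scale_one add_neg add_zero flip: add_assoc)
  ultimately show ?thesis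
    using norm_triangle[of ?d y] norm_triangle[of x "vscale V (- 1) ?d"] assms
    by (simp add: closed norm_scale)
qed

end

section \<open>Iterated limits: a spreading norm\<close>

locale separated_sequence = vnormed V + ultra U for V :: "'a space" and U +
  fixes e :: "nat \<Rightarrow> 'a"
  assumes e_closed [simp]: "e n \<in> vcarrier V"
    and e_norm: "vnorm V (e n) \<le> 1"
    and e_sep: "n \<noteq> m \<Longrightarrow> 1 / 2 \<le> vdist V (e n) (e m)"
begin

text \<open>
  \<open>iter_lim [a\<^sub>1, \<dots>, a\<^sub>r] y\<close> is the limit of \<open>\<parallel>y +
  a\<^sub>1 e(n\<^sub>1) + \<dots> + a\<^sub>r e(n\<^sub>r)\<parallel>\<close> along the
  ultrafilter, first in \<open>n\<^sub>r\<close>, then in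
  \<open>n\<^sub>r\<^sub>-\<^sub>1\<close>, and so on. The vector \<open>y\<close> is what makes
  it definable by recursion.
\<close>

primrec iter_lim :: "real list \<Rightarrow> 'a \<Rightarrow> real" where
  "iter_lim [] y = vnorm V y"
| "iter_lim (a # as) y = ulim (\<lambda>n. iter_lim as (vadd V y (vscale V a (e n))))"

lemma iter_lim_bounds:
  "y \<in> vcarrier V \<Longrightarrow> 0 \<le> iter_lim as y \<and> iter_lim as y \<le> vnorm V y + (\<Sum>a\<leftarrow>as. \<bar>a\<bar>)"
proof (induction as arbitrary: y)
  case Nil
  then show ?case by (simp add: norm_nonneg)
next
  case (Cons a as)
  let ?g = "\<lambda>n. iter_lim as (vadd V y (vscale V a (e n)))"
  have g: "0 \<le> ?g n \<and> ?g n \<le> vnorm V y + (\<Sum>a\<leftarrow>a # as. \<bar>a\<bar>)" for n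
  proof -
    have "vnorm V (vadd V y (vscale V a (e n))) \<le> vnorm V y + \<bar>a\<bar>"
      using norm_triangle[of y "vscale V a (e n)"] mult_left_mono[OF e_norm[of n], of "\<bar>a\<bar>"] Cons.prems
      by (simp add: closed norm_scale)
    then show ?thesis
      using Cons.IH[of "vadd V y (vscale V a (e n))"] Cons.prems by (simp add: closed)
  qed
  then have "(?g \<longlongrightarrow> ulim ?g) U" by (intro bounded_tendsto_ulim) blast+
  then show ?case
    using g by (auto intro: tendsto_lowerbound tendsto_upperbound)
qed

lemma iter_lim_tendsto:
  assumes "y \<in> vcarrier V"
  shows "((\<lambda>n. iter_lim as (vadd V y (vscale V a (e n)))) \<longlongrightarrow> iter_lim (a # as) y) U"
proof -
  let ?g = "\<lambda>n. iter_lim as (vadd V y (vscale V a (e n)))"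
  have g: "0 \<le> ?g n \<and> ?g n \<le> vnorm V y + \<bar>a\<bar> + (\<Sum>a\<leftarrow>as. \<bar>a\<bar>)" for n
  proof -
    have "vnorm V (vadd V y (vscale V a (e n))) \<le> vnorm V y + \<bar>a\<bar>"
      using norm_triangle[of y "vscale V a (e n)"] mult_left_mono[OF e_norm[of n], of "\<bar>a\<bar>"] assms
      by (simp add: closed norm_scale)
    then show ?thesis
      using iter_lim_bounds[of "vadd V y (vscale V a (e n))" as] assms by (simp add: closed)
  qed
  then have "(?g \<longlongrightarrow> ulim ?g) U" by (intro bounded_tendsto_ulim) blast+
  then show ?thesis by simp
qed

lemma iter_lim_add:
  "length as = length bs \<Longrightarrow> y \<in> vcarrier V \<Longrightarrow> z \<in> vcarrier V \<Longrightarrow>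
   iter_lim (map2 (+) as bs) (vadd V y z) \<le> iter_lim as y + iter_lim bs z"
proof (induction as bs arbitrary: y z rule: list_induct2)
  case Nil
  then show ?case by (simp add: norm_triangle)
next
  case (Cons a as b bs)
  have "((\<lambda>n. iter_lim as (vadd V y (vscale V a (e n))) + iter_lim bs (vadd V z (vscale V b (e n))))
      \<longlongrightarrow> iter_lim (a # as) y + iter_lim (b # bs) z) U"
    using Cons.prems by (intro tendsto_add iter_lim_tendsto)
  moreover have "((\<lambda>n. iter_lim (map2 (+) as bs) (vadd V (vadd V y z) (vscale V (a + b) (e n))))
      \<longlongrightarrow> iter_lim ((a + b) # map2 (+) as bs) (vadd V y z)) U"
    by (rule iter_lim_tendsto[OF add_closed[OF Cons.prems]])
  moreover have "iter_lim (map2 (+) as bs) (vadd V (vadd V y z) (vscale V (a + b) (e n))) \<le>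
      iter_lim as (vadd V y (vscale V a (e n))) + iter_lim bs (vadd V z (vscale V b (e n)))" for n
  proof -
    have "vadd V (vadd V y z) (vscale V (a + b) (e n)) =
      vadd V (vadd V y (vscale V a (e n))) (vadd V z (vscale V b (e n)))"
      using Cons.prems by (simp add: closed scale_add_left add_ac)
    then show ?thesis using Cons.IH Cons.prems by (simp add: closed)
  qed
  ultimately have "iter_lim ((a + b) # map2 (+) as bs) (vadd V y z) \<le> iter_lim (a # as) y + iter_lim (b # bs) z"
    by (intro tendsto_le[OF U_not_bot]) auto
  then show ?case by simp
qed

lemma iter_lim_scale:
  "y \<in> vcarrier V \<Longrightarrow> iter_lim (map ((*) c) as) (vscale V c y) = \<bar>c\<bar> * iter_lim as y"
proof (induction as arbitrary: y)
  case Nil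
  then show ?case by (simp add: norm_scale)
next
  case (Cons a as)
  have "iter_lim (map ((*) c) as) (vadd V (vscale V c y) (vscale V (c * a) (e n))) =
      \<bar>c\<bar> * iter_lim as (vadd V y (vscale V a (e n)))" for n
    using Cons.IH[of "vadd V y (vscale V a (e n))"] Cons.prems
    by (simp add: closed scale_add_right scale_scale)
  moreover have "((\<lambda>n. \<bar>c\<bar> * iter_lim as (vadd V y (vscale V a (e n)))) \<longlongrightarrow> \<bar>c\<bar> * iter_lim (a # as) y) U"
    using Cons.prems by (intro tendsto_mult_left iter_lim_tendsto)
  ultimately show ?case
    using ulim_eqI by simp
qed

text \<open>
  The limit norm is spreading: the values depend only on the order of the nonzero coefficients,
  not on their positions.
\<close>

lemma iter_lim_insert_zero:
  "y \<in> vcarrier V \<Longrightarrow> iter_lim (as @ 0 # bs) y = iter_lim (as @ bs) y"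
proof (induction as arbitrary: y)
  case Nil
  have "vadd V y (vscale V 0 (e n)) = y" for n
    using Nil by (simp add: zero_scale add_zero_right)
  then show ?case
    by (simp add: ulim_eqI[OF tendsto_const])
next
  case (Cons a as)
  then show ?case by (simp add: closed)
qed

lemma iter_lim_filter:
  "y \<in> vcarrier V \<Longrightarrow> iter_lim (filter (\<lambda>a. a \<noteq> 0) as) y = iter_lim as y"
proof (induction as arbitrary: y)
  case (Cons a as)
  then show ?case
    using iter_lim_insert_zero[of y "[]" as] by (cases "a = 0") (simp_all add: closed)
qed simp

text \<open>
  Because zeros can be inserted, \<open>(\<dots>, c, - c, 0, \<dots>)\<close> and \<open>(\<dots>,
  0, c, - c, \<dots>)\<close> have the same norm. Their mean is \<open>(\<dots>, c / 2, 0, - c /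
  2, \<dots>)\<close>, and the zero can be deleted again.
\<close>

lemma iter_lim_halve:
  assumes "y \<in> vcarrier V"
  shows "iter_lim (as @ c / 2 # - (c / 2) # bs) y \<le> iter_lim (as @ c # - c # bs) y"
proof -
  have map2_same: "map2 (+) xs xs = map ((*) 2) xs" for xs :: "real list"
    by (induction xs) auto
  have "map2 (+) (as @ c # - c # 0 # bs) (as @ 0 # c # - c # bs) =
      map ((*) 2) (as @ c / 2 # 0 # - (c / 2) # bs)"
    by (simp add: map2_same)
  moreover have "vadd V y y = vscale V 2 y"
    using assms scale_add_left[of y 1 1] by (simp add: scale_one)
  ultimately have "iter_lim (map ((*) 2) (as @ c / 2 # 0 # - (c / 2) # bs)) (vscale V 2 y) \<le>
     iter_lim (as @ c # - c # 0 # bs) y + iter_lim (as @ 0 # c # - c # bs) y"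
    using iter_lim_add[of "as @ c # - c # 0 # bs" "as @ 0 # c # - c # bs" y y] assms by simp
  then have "2 * iter_lim (as @ c / 2 # 0 # - (c / 2) # bs) y \<le>
     iter_lim (as @ c # - c # 0 # bs) y + iter_lim (as @ 0 # c # - c # bs) y"
    using assms by (simp only: iter_lim_scale abs_numeral)
  then show ?thesis
    using iter_lim_insert_zero[OF assms, of "as @ [c / 2]" "- (c / 2) # bs"]
      iter_lim_insert_zero[OF assms, of "as @ [c, - c]" bs]
      iter_lim_insert_zero[OF assms, of as "c # - c # bs"] by simp
qed

text \<open>
  Halving the pair \<open>c, - c\<close> again and again does not increase the norm, and in the
  limit the pair vanishes.
\<close>

lemma iter_lim_suppress:
  assumes "y \<in> vcarrier V"
  shows "iter_lim (as @ 0 # 0 # bs) y \<le> iter_lim (as @ c # - c # bs) y"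
proof -
  let ?h = "\<lambda>c. iter_lim (as @ c # - c # bs) y"
  have h: "?h (c / 2 ^ n) \<le> ?h c" for n
  proof (induction n)
    case (Suc n)
    have "?h (c / 2 ^ Suc n) \<le> ?h (c / 2 ^ n)"
      using iter_lim_halve[OF assms, of as "c / 2 ^ n" bs] by (simp add: mult.commute)
    with Suc show ?case by simp
  qed simp
  have z: "?h 0 \<le> ?h t + 2 * \<bar>t\<bar>" for t
  proof -
    let ?as = "map (\<lambda>_. 0 :: real) as" and ?bs = "map (\<lambda>_. 0 :: real) bs"
    have m0: "map2 (+) xs (map (\<lambda>_. 0) xs) = xs" for xs :: "real list"
      by (induction xs) auto
    have s0: "(\<Sum>a\<leftarrow>map (\<lambda>_. 0 :: real) xs. \<bar>a\<bar>) = 0" for xs :: "real list"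
      by (induction xs) auto
    have "map2 (+) (as @ t # - t # bs) (?as @ - t # t # ?bs) = as @ 0 # 0 # bs"
      by (simp add: m0)
    then have "?h 0 \<le> ?h t + iter_lim (?as @ - t # t # ?bs) (vzero V)"
      using iter_lim_add[of "as @ t # - t # bs" "?as @ - t # t # ?bs" y "vzero V"] assms
      by (simp add: closed add_zero_right)
    also have "iter_lim (?as @ - t # t # ?bs) (vzero V) \<le> 2 * \<bar>t\<bar>"
      using iter_lim_bounds[OF zero_closed, of "?as @ - t # t # ?bs"] s0[of as] s0[of bs]
      by simp
    finally show ?thesis by simp
  qed
  have "?h 0 \<le> ?h c + 2 * \<bar>c\<bar> / 2 ^ n" for n
    using h[of n] z[of "c / 2 ^ n"] by (simp add: abs_divide)
  moreover have "(\<lambda>n. ?h c + 2 * \<bar>c\<bar> / 2 ^ n) \<longlonglongrightarrow> ?h c + 0"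
  proof (intro tendsto_intros)
    have "(\<lambda>n. (2 * \<bar>c\<bar>) * (1 / 2) ^ n) \<longlonglongrightarrow> (2 * \<bar>c\<bar>) * 0"
      by (intro tendsto_mult_left LIMSEQ_realpow_zero) auto
    then show "(\<lambda>n. 2 * \<bar>c\<bar> / 2 ^ n) \<longlonglongrightarrow> 0" by (simp add: power_divide)
  qed
  ultimately have "?h 0 \<le> ?h c + 0"
    by (intro LIMSEQ_le_const) auto
  then show ?thesis by simp
qed

text \<open>
  The vector whose norm \<open>iter_lim\<close> approximates once indices have been chosen for the
  iterated limits.
\<close>

fun apply_terms :: "'a \<Rightarrow> real list \<Rightarrow> nat list \<Rightarrow> 'a" where
  "apply_terms y (a # as) (n # ns) = apply_terms (vadd V y (vscale V a (e n))) as ns"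
| "apply_terms y _ _ = y"

lemma apply_terms_append:
  "length as = length ns \<Longrightarrow>
   apply_terms y (as @ bs) (ns @ ms) = apply_terms (apply_terms y as ns) bs ms"
  by (induction as ns arbitrary: y rule: list_induct2) auto

lemma dist_halves: "\<bar>a - b\<bar> < d / 2 \<Longrightarrow> \<bar>a - c\<bar> < d / 2 \<Longrightarrow> \<bar>c - b\<bar> < d" for a b c d :: real
  by linarith

text \<open>
  Finitely many iterated limits with the same number of coefficients are approximated by one
  common choice of indices: a property that holds eventually along the ultrafilter for each of
  finitely many members holds at some index for all of them.
\<close>

lemma iter_lim_approx:
  assumes "finite Q" "\<eta> > 0" "\<And>as y. (as, y) \<in> Q \<Longrightarrow> length as = r \<and> y \<in> vcarrier V"
  shows "\<exists>ns. length ns = r \<and> (\<forall>(as, y)\<in>Q. \<bar>iter_lim as y - vnorm V (apply_terms y as ns)\<bar> < \<eta>)"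
  using assms
proof (induction r arbitrary: Q \<eta>)
  case 0
  then show ?case by (intro exI[of _ "[]"]) (auto, fastforce)
next
  case (Suc r)
  define step where "step n = (\<lambda>(as, y). (tl as, vadd V y (vscale V (hd as) (e n))))" for n
  have "\<forall>\<^sub>F n in U. \<forall>q\<in>Q. \<bar>case_prod iter_lim (step n q) - case_prod iter_lim q\<bar> < \<eta> / 2"
  proof (rule eventually_ball_finite[OF Suc.prems(1)], rule ballI)
    fix q assume q: "q \<in> Q"
    obtain as y where [simp]: "q = (as, y)" by (cases q)
    obtain a as' where [simp]: "as = a # as'" using Suc.prems(3)[of as y] q by (cases as) auto
    have "y \<in> vcarrier V" using Suc.prems(3)[of as y] q by simp
    from tendstoD[OF iter_lim_tendsto[OF this, of as' a], of "\<eta> / 2"] Suc.prems(2)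
    show "\<forall>\<^sub>F n in U. \<bar>case_prod iter_lim (step n q) - case_prod iter_lim q\<bar> < \<eta> / 2"
      by (simp add: step_def dist_real_def)
  qed
  then obtain n where n: "\<And>q. q \<in> Q \<Longrightarrow> \<bar>case_prod iter_lim (step n q) - case_prod iter_lim q\<bar> < \<eta> / 2"
    using eventually_happens'[OF U_not_bot] by blast
  have "\<exists>ns. length ns = r \<and> (\<forall>(as, y)\<in>step n ` Q. \<bar>iter_lim as y - vnorm V (apply_terms y as ns)\<bar> < \<eta> / 2)"
  proof (rule Suc.IH)
    show "length as = r \<and> y \<in> vcarrier V" if "(as, y) \<in> step n ` Q" for as y
      using that Suc.prems(3) by (force simp: step_def closed)
  qed (use Suc.prems in auto)
  then obtain ns where ns: "length ns = r"
    "\<And>as y. (as, y) \<in> step n ` Q \<Longrightarrow> \<bar>iter_lim as y - vnorm V (apply_terms y as ns)\<bar> < \<eta> / 2"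
    by blast
  have "\<bar>iter_lim as y - vnorm V (apply_terms y as (n # ns))\<bar> < \<eta>" if q: "(as, y) \<in> Q" for as y
  proof -
    obtain a as' where as: "as = a # as'" using Suc.prems(3)[OF q] by (cases as) auto
    have "(as', vadd V y (vscale V a (e n))) \<in> step n ` Q"
      using q by (force simp: step_def as)
    from ns(2)[OF this] n[OF q]
    have "\<bar>iter_lim as' (vadd V y (vscale V a (e n))) - vnorm V (apply_terms y as (n # ns))\<bar> < \<eta> / 2"
      "\<bar>iter_lim as' (vadd V y (vscale V a (e n))) - iter_lim as y\<bar> < \<eta> / 2"
      by (simp_all add: as step_def)
    then show ?thesis by (rule dist_halves)
  qed
  then show ?case using ns(1) by (intro exI[of _ "n # ns"]) auto
qed

text \<open>
  The coefficients of \<open>\<Sum>i<m. x i (e(n\<^sub>2\<^sub>i) -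
  e(n\<^sub>2\<^sub>i\<^sub>+\<^sub>1))\<close> with respect to the \<open>e(n\<^sub>j)\<close>.
\<close>

primrec diff_coeffs :: "(nat \<Rightarrow> real) \<Rightarrow> nat \<Rightarrow> real list" where
  "diff_coeffs x 0 = []"
| "diff_coeffs x (Suc m) = diff_coeffs x m @ [x m, - x m]"

lemma length_diff_coeffs [simp]: "length (diff_coeffs x m) = 2 * m"
  by (induction m) auto

lemma diff_coeffs_add:
  "diff_coeffs (\<lambda>i. x i + y i) m = map2 (+) (diff_coeffs x m) (diff_coeffs y m)"
  by (induction m) auto

lemma diff_coeffs_scale: "diff_coeffs (\<lambda>i. c * x i) m = map ((*) c) (diff_coeffs x m)"
  by (induction m) auto

lemma diff_coeffs_cong: "(\<And>i. i < m \<Longrightarrow> x i = y i) \<Longrightarrow> diff_coeffs x m = diff_coeffs y m"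
  by (induction m) auto

lemma diff_coeffs_update:
  "i < m \<Longrightarrow> \<exists>as bs. diff_coeffs x m = as @ x i # - x i # bs \<and> diff_coeffs (x(i := 0)) m = as @ 0 # 0 # bs"
proof (induction m)
  case (Suc m)
  show ?case
  proof (cases "i = m")
    case True
    then have "diff_coeffs (x(i := 0)) m = diff_coeffs x m" by (intro diff_coeffs_cong) auto
    then have eq: "diff_coeffs (x(m := 0)) m = diff_coeffs x m" by (simp only: True)
    show ?thesis
      by (rule exI[of _ "diff_coeffs x m"], rule exI[of _ "[]"]) (simp add: True eq del: fun_upd_apply, simp)
  next
    case False
    with Suc obtain as bs where
      "diff_coeffs x m = as @ x i # - x i # bs" "diff_coeffs (x(i := 0)) m = as @ 0 # 0 # bs"
      by (auto simp del: fun_upd_apply)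
    note eq = this
    show ?thesis
      by (rule exI[of _ as], rule exI[of _ "bs @ [x m, - x m]"])
         (simp add: eq False[symmetric] del: fun_upd_apply, simp add: False[symmetric])
  qed
qed simp

lemma filter_diff_coeffs_unit:
  "filter (\<lambda>a. a \<noteq> 0) (diff_coeffs (\<lambda>j. if j = i then 1 else 0) m) = (if i < m then [1, -1] else [])"
  by (induction m) auto

text \<open>
  Separation of the sequence enters here: without it the limit norm of the differences could
  vanish.
\<close>

lemma iter_lim_difference_pos: "0 < iter_lim [1, -1] (vzero V)"
proof -
  have "1 / 2 \<le> iter_lim [-1] (vadd V (vzero V) (vscale V 1 (e n)))" for n
  proof (rule tendsto_lowerbound[OF iter_lim_tendsto])
    have "\<forall>\<^sub>F m in U. m \<noteq> n"
      by (rule eventually_U) (auto simp: eventually_sequentially intro!: exI[of _ "Suc n"])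
    then show "\<forall>\<^sub>F m in U. 1 / 2 \<le> iter_lim [] (vadd V (vadd V (vzero V) (vscale V 1 (e n))) (vscale V (- 1) (e m)))"
    proof eventually_elim
      case (elim m)
      then show ?case using e_sep[of n m] by (simp add: vdist_def scale_one add_zero)
    qed
  qed (simp_all add: closed)
  then have "1 / 2 \<le> iter_lim [1, -1] (vzero V)"
    by (intro tendsto_lowerbound[OF iter_lim_tendsto]) (simp_all add: closed)
  then show ?thesis by linarith
qed

lemma apply_terms_diff_coeffs:
  assumes "y \<in> vcarrier V"
  shows "length ns = 2 * m \<Longrightarrow> apply_terms y (diff_coeffs x m) ns =
     vadd V y (lin (\<lambda>i. vadd V (e (ns ! (2 * i))) (vscale V (- 1) (e (ns ! Suc (2 * i))))) x m)"
proof (induction m arbitrary: ns)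
  case 0
  then show ?case using assms by (simp add: add_zero_right)
next
  case (Suc m)
  let ?z = "\<lambda>ns i. vadd V (e (ns ! (2 * i))) (vscale V (- 1) (e (ns ! Suc (2 * i))))"
  define ms where "ms = take (2 * m) ns"
  have ms: "length ms = 2 * m" using Suc.prems by (simp add: ms_def)
  have "drop (2 * m) ns = [ns ! (2 * m), ns ! Suc (2 * m)]"
    using Suc.prems by (simp add: Cons_nth_drop_Suc[symmetric])
  then have ns: "ns = ms @ [ns ! (2 * m), ns ! Suc (2 * m)]"
    unfolding ms_def by (metis append_take_drop_id)
  have z: "?z ns i \<in> vcarrier V" for i by (simp add: closed)
  have lin_eq: "lin (?z ms) x m = lin (?z ns) x m"
  proof -
    have "lin (?z ms) x k = lin (?z ns) x k" if "k \<le> m" for k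
      using that by (induction k) (auto simp: ms_def)
    then show ?thesis by simp
  qed
  have "apply_terms y (diff_coeffs x (Suc m)) ns =
      apply_terms (apply_terms y (diff_coeffs x m) ms) [x m, - x m] [ns ! (2 * m), ns ! Suc (2 * m)]"
    by (subst ns) (simp add: apply_terms_append ms)
  also have "\<dots> = vadd V (vadd V (vadd V y (lin (?z ns) x m)) (vscale V (x m) (e (ns ! (2 * m)))))
      (vscale V (- x m) (e (ns ! Suc (2 * m))))"
    using Suc.IH[OF ms] by (simp add: lin_eq)
  also have "\<dots> = vadd V y (lin (?z ns) x (Suc m))"
    using assms by (simp add: closed lin_closed[OF z] scale_add_right scale_scale add_assoc)
  finally show ?case .
qed

end

text \<open>
  Coefficient sequences \<open>nat \<Rightarrow> real\<close> are made a real vector space, so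
  that the results about seminorms apply to norms of linear combinations as functions of the
  coefficients.
\<close>

instantiation "fun" :: (type, scaleR) scaleR
begin
definition scaleR_fun :: "real \<Rightarrow> ('a \<Rightarrow> 'b) \<Rightarrow> 'a \<Rightarrow> 'b" where
  "scaleR_fun c x = (\<lambda>i. c *\<^sub>R x i)"
instance ..
end

instance "fun" :: (type, real_vector) real_vector
  by standard (auto simp: scaleR_fun_def fun_eq_iff scaleR_add_right scaleR_add_left)

lemma sum_fun_apply: "(\<Sum>j\<in>J. w j) i = (\<Sum>j\<in>J. w j i)" for w :: "'j \<Rightarrow> 'i \<Rightarrow> real"
  by (induction J rule: infinite_finite_induct) auto

context separated_sequence
begin

definition difference_norm :: "nat \<Rightarrow> (nat \<Rightarrow> real) \<Rightarrow> real" where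
  "difference_norm m x = iter_lim (diff_coeffs x m) (vzero V)"

definition unit :: "nat \<Rightarrow> nat \<Rightarrow> real" where
  "unit i j = (if j = i then 1 else 0)"

lemma suppression_family_difference_norm:
  "suppression_family difference_norm unit (iter_lim [1, -1] (vzero V))"
proof (rule suppression_family.intro)
  fix m
  show "seminorm (difference_norm m)"
  proof
    show "difference_norm m (x + y) \<le> difference_norm m x + difference_norm m y" for x y
      using iter_lim_add[of "diff_coeffs x m" "diff_coeffs y m" "vzero V" "vzero V"]
      by (simp add: difference_norm_def plus_fun_def diff_coeffs_add closed add_zero)
    show "difference_norm m (c *\<^sub>R x) = \<bar>c\<bar> * difference_norm m x" for c x
      using iter_lim_scale[of "vzero V" c "diff_coeffs x m"]
      by (simp add: difference_norm_def scaleR_fun_def diff_coeffs_scale closed scale_zero)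
  qed
  have comb: "difference_norm m (\<Sum>j<m. x j *\<^sub>R unit j) = difference_norm m x" for x
  proof -
    have "(\<Sum>j<m. x j *\<^sub>R unit j) i = x i" if "i < m" for i
    proof -
      have "(\<Sum>j<m. x j *\<^sub>R unit j) i = (\<Sum>j<m. if j = i then x i else 0)"
        unfolding sum_fun_apply by (intro sum.cong) (auto simp: scaleR_fun_def unit_def)
      then show ?thesis using that by simp
    qed
    then show ?thesis
      unfolding difference_norm_def by (intro arg_cong2[of _ _ _ _ iter_lim] diff_coeffs_cong) auto
  qed
  show "difference_norm m (\<Sum>j<m. (x(i := 0)) j *\<^sub>R unit j) \<le> difference_norm m (\<Sum>j<m. x j *\<^sub>R unit j)"
    for x i
  proof (cases "i < m")
    case True
    then obtain as bs where "diff_coeffs x m = as @ x i # - x i # bs"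
      "diff_coeffs (x(i := 0)) m = as @ 0 # 0 # bs" using diff_coeffs_update by blast
    then show ?thesis
      unfolding comb unfolding difference_norm_def by (simp only: iter_lim_suppress[OF zero_closed])
  next
    case False
    then have "diff_coeffs (x(i := 0)) m = diff_coeffs x m" by (intro diff_coeffs_cong) auto
    then show ?thesis unfolding comb unfolding difference_norm_def by (simp only: order.refl)
  qed
  show "difference_norm m (unit i) = iter_lim [1, -1] (vzero V)" if "i < m" for i
    using iter_lim_filter[OF zero_closed, of "diff_coeffs (unit i) m"] filter_diff_coeffs_unit[of i m] that
    by (simp add: difference_norm_def unit_def[abs_def])
qed (rule iter_lim_difference_pos)

text \<open>
  The almost Euclidean section is found for the limit norm, and the limits are then replaced by
  suitable members of the sequence.
\<close>

theorem Dvoretzky_sequence: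
  fixes A :: "(nat \<Rightarrow> real) set"
  assumes A: "finite A" and \<eta>: "\<eta> > 0"
  shows "\<exists>z. (\<forall>j. z j \<in> vcarrier V) \<and>
     (\<forall>x\<in>A. \<bar>vnorm V (lin z x n) - sqrt (\<Sum>j<n. (x j)\<^sup>2)\<bar> < \<eta>)"
proof -
  interpret suppression_family difference_norm unit "iter_lim [1, -1] (vzero V)"
    by (rule suppression_family_difference_norm)
  obtain m v where v: "\<And>x. x \<in> A \<Longrightarrow> \<bar>difference_norm m (\<Sum>j<n. x j *\<^sub>R v j) - sqrt (\<Sum>j<n. (x j)\<^sup>2)\<bar> < \<eta> / 2"
    using almost_Euclidean[OF A, of "\<eta> / 2" n] \<eta> by auto
  define u where "u x = (\<lambda>i. \<Sum>j<n. x j * v j i)" for x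
  have u: "(\<Sum>j<n. x j *\<^sub>R v j) = u x" for x
    by (auto simp: u_def fun_eq_iff sum_fun_apply scaleR_fun_def)
  define Q where "Q = (\<lambda>x. (diff_coeffs (u x) m, vzero V)) ` A"
  have "\<exists>ns. length ns = 2 * m \<and> (\<forall>(as, y)\<in>Q. \<bar>iter_lim as y - vnorm V (apply_terms y as ns)\<bar> < \<eta> / 2)"
    using A \<eta> by (intro iter_lim_approx) (auto simp: Q_def closed)
  then obtain ns where ns: "length ns = 2 * m"
    "\<And>as y. (as, y) \<in> Q \<Longrightarrow> \<bar>iter_lim as y - vnorm V (apply_terms y as ns)\<bar> < \<eta> / 2" by blast
  define z0 where "z0 i = vadd V (e (ns ! (2 * i))) (vscale V (- 1) (e (ns ! Suc (2 * i))))" for i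
  have z0: "z0 i \<in> vcarrier V" for i by (simp add: z0_def closed)
  show ?thesis
  proof (intro exI[of _ "\<lambda>j. lin z0 (v j) m"] conjI allI ballI)
    show "lin z0 (v j) m \<in> vcarrier V" for j using z0 by (rule lin_closed)
    fix x assume x: "x \<in> A"
    have "apply_terms (vzero V) (diff_coeffs (u x) m) ns = lin (\<lambda>j. lin z0 (v j) m) x n"
      using apply_terms_diff_coeffs[OF zero_closed ns(1), of "u x"]
      by (simp add: lin_lin[OF z0] u_def lin_closed[OF z0] add_zero flip: z0_def)
    moreover have "\<bar>difference_norm m (u x) - vnorm V (apply_terms (vzero V) (diff_coeffs (u x) m) ns)\<bar> < \<eta> / 2"
      unfolding difference_norm_def using x by (intro ns(2)) (auto simp: Q_def)
    ultimately have "\<bar>difference_norm m (u x) - vnorm V (lin (\<lambda>j. lin z0 (v j) m) x n)\<bar> < \<eta> / 2"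
      by (simp only:)
    from v[OF x, unfolded u] this
    show "\<bar>vnorm V (lin (\<lambda>j. lin z0 (v j) m) x n) - sqrt (\<Sum>j<n. (x j)\<^sup>2)\<bar> < \<eta>"
      by (rule dist_halves)
  qed
qed

end

section \<open>Dvoretzky's theorem\<close>

lemma (in vnormed) vdist_eq:
  "x \<in> vcarrier V \<Longrightarrow> y \<in> vcarrier V \<Longrightarrow> vdist V x y = vnorm V (vadd V x (vscale V (- 1) y))"
  by (simp add: vdist_def)

lemma (in vnormed) lin_norm_le:
  assumes "\<And>i. z i \<in> vcarrier V"
  shows "vnorm V (lin z x m) \<le> (\<Sum>i<m. \<bar>x i\<bar> * vnorm V (z i))"
proof (induction m)
  case (Suc m)
  then show ?case
    using norm_triangle[of "lin z x m" "vscale V (x m) (z m)"] lin_closed[OF assms] assms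
    by (simp add: closed norm_scale)
qed simp

lemma (in vnormed) lin_comb_snoc:
  assumes "length cs = length bs" "set bs \<subseteq> vcarrier V" "b \<in> vcarrier V"
  shows "lin_comb V (cs @ [c]) (bs @ [b]) = vadd V (lin_comb V cs bs) (vscale V c b) \<and>
    lin_comb V cs bs \<in> vcarrier V"
  using assms
proof (induction cs bs rule: list_induct2)
  case Nil
  then show ?case by (simp add: lin_comb_def closed add_zero add_zero_right)
next
  case (Cons c' cs b' bs)
  then show ?case by (simp add: lin_comb_def closed add_assoc)
qed

lemma (in vnormed) lin_comb_eq_lin:
  assumes "\<And>i. z i \<in> vcarrier V"
  shows "lin_comb V (map x [0..<m]) (map z [0..<m]) = lin z x m"
proof (induction m)
  case 0
  then show ?case by (simp add: lin_comb_def)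
next
  case (Suc m)
  have "set (map z [0..<m]) \<subseteq> vcarrier V" using assms by auto
  then show ?case
    using lin_comb_snoc[of "map x [0..<m]" "map z [0..<m]" "z m" "x m"] assms Suc by simp
qed

text \<open>
  If the unit ball is covered by the balls of radius \<open>1 / 2\<close> around \<open>z 0,
  \<dots>, z (m - 1)\<close>, then the \<open>z i\<close> span the space: subtract from a vector
  of the unit ball some \<open>z i\<close> closer than \<open>1 / 2\<close>, double the remainder,
  which again lies in the unit ball, and repeat. This writes the vector as a series of terms
  \<open>(1 / 2) ^ k z i\<close>, whose coefficients can be collected.
\<close>

lemma (in vnormed) spanned_if_half_net:
  assumes z: "\<And>i. z i \<in> vcarrier V" "\<And>i. vnorm V (z i) \<le> 1"
    and net: "\<And>x. x \<in> vcarrier V \<Longrightarrow> vnorm V x \<le> 1 \<Longrightarrow> \<exists>i<m. vdist V x (z i) < 1 / 2"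
    and x: "x \<in> vcarrier V"
  shows "\<exists>c. x = lin z c m"
proof -
  define near where "near r = (SOME i. i < m \<and> vdist V r (z i) < 1 / 2)" for r
  have near: "near r < m \<and> vdist V r (z (near r)) < 1 / 2" if "r \<in> vcarrier V" "vnorm V r \<le> 1" for r
    using someI_ex[OF net[OF that]] by (simp add: near_def)
  have unit: "\<exists>c. x = lin z c m" if x: "x \<in> vcarrier V" "vnorm V x \<le> 1" for x
  proof -
    define r where "r = rec_nat x (\<lambda>_ r. vscale V 2 (vadd V r (vscale V (- 1) (z (near r)))))"
    have r0: "r 0 = x" and rS: "r (Suc k) = vscale V 2 (vadd V (r k) (vscale V (- 1) (z (near (r k)))))" for k
      by (simp_all add: r_def)
    have r: "r k \<in> vcarrier V \<and> vnorm V (r k) \<le> 1" for k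
    proof (induction k)
      case (Suc k)
      then show ?case
        using near[of "r k"] z(1) by (simp add: rS closed norm_scale vdist_eq)
    qed (simp add: r0 x)
    (* \<open>c K i\<close> collects the coefficients of \<open>z i\<close> in the first
       \<open>K\<close> terms of the series. *)
    define c where "c K i = (\<Sum>k<K. if near (r k) = i then (1 / 2) ^ k else 0 :: real)" for K i
    have split: "x = vadd V (lin z (c K) m) (vscale V ((1 / 2) ^ K) (r K))" for K
    proof (induction K)
      case 0
      then show ?case using x by (simp add: c_def lin_zero z r0 scale_one add_zero)
    next
      case (Suc K)
      let ?i = "near (r K)"
      have i: "?i < m" using near r by blast
      have unit: "lin z (\<lambda>i. if ?i = i then t else 0) k = (if ?i < k then vscale V t (z ?i) else vzero V)" for t k
        by (induction k) (auto simp: z closed add_zero add_zero_right zero_scale less_Suc_eq)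
      have "lin z (c (Suc K)) m = vadd V (lin z (c K) m) (vscale V ((1 / 2) ^ K) (z ?i))"
        using lin_add[of z "c K" "\<lambda>i. if ?i = i then (1 / 2) ^ K else 0" m] z(1) i
        by (simp add: c_def[abs_def] unit)
      moreover have "vscale V ((1 / 2) ^ Suc K) (r (Suc K)) =
         vadd V (vscale V ((1 / 2) ^ K) (r K)) (vscale V (- ((1 / 2) ^ K)) (z ?i))"
        using r z(1) by (simp add: rS scale_add_right scale_scale closed)
      moreover have "vadd V (vscale V t (z ?i)) (vadd V a (vscale V (- t) (z ?i))) = a" if "a \<in> vcarrier V" for t a
        using that z(1) scale_add_left[of "z ?i" t "- t", symmetric]
        by (simp add: closed add_left_commute zero_scale add_zero_right)
      ultimately have "vadd V (lin z (c (Suc K)) m) (vscale V ((1 / 2) ^ Suc K) (r (Suc K))) =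
         vadd V (lin z (c K) m) (vscale V ((1 / 2) ^ K) (r K))"
        using r z(1) by (simp add: add_assoc closed lin_closed)
      with Suc show ?case by simp
    qed
    have geo: "summable (\<lambda>k. if near (r k) = i then (1 / 2) ^ k else 0 :: real)" for i
      by (rule summable_comparison_test[of _ "\<lambda>k. (1 / 2) ^ k"]) (auto intro: summable_geometric)
    define c' where "c' i = (\<Sum>k. if near (r k) = i then (1 / 2) ^ k else 0 :: real)" for i
    have lim: "(\<lambda>K. c K i) \<longlonglongrightarrow> c' i" for i
      unfolding c_def c'_def by (rule summable_LIMSEQ[OF geo])
    have "vdist V x (lin z c' m) \<le> (1 / 2) ^ K + (\<Sum>i<m. \<bar>c K i - c' i\<bar>)" for K
    proof -
      let ?N = "vscale V (- 1) (lin z c' m)"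
      have lin: "lin z (\<lambda>i. c K i + (- 1) * c' i) m = vadd V (lin z (c K) m) ?N"
        by (simp only: lin_add[OF z(1)] lin_scale[OF z(1)])
      have "vadd V (vadd V P Q) N = vadd V Q (vadd V P N)"
        if "P \<in> vcarrier V" "Q \<in> vcarrier V" "N \<in> vcarrier V" for P Q N
        using that by (simp add: add_assoc add_left_commute)
      from this[of "lin z (c K) m" "vscale V ((1 / 2) ^ K) (r K)" ?N]
      have "vadd V x ?N = vadd V (vscale V ((1 / 2) ^ K) (r K)) (lin z (\<lambda>i. c K i + (- 1) * c' i) m)"
        using r z(1) unfolding split[of K, symmetric] lin by (simp add: closed lin_closed)
      then have "vdist V x (lin z c' m) \<le> vnorm V (vscale V ((1 / 2) ^ K) (r K)) + vnorm V (lin z (\<lambda>i. c K i + (- 1) * c' i) m)"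
        using x z(1) r by (simp add: vdist_eq lin_closed closed norm_triangle)
      moreover have "vnorm V (vscale V ((1 / 2) ^ K) (r K)) \<le> (1 / 2) ^ K * 1"
        using r[of K] unfolding norm_scale[OF conjunct1[OF r]]
        by (intro mult_mono) (auto simp: norm_nonneg)
      moreover have "vnorm V (lin z (\<lambda>i. c K i + (- 1) * c' i) m) \<le> (\<Sum>i<m. \<bar>c K i - c' i\<bar>)"
      proof -
        have "vnorm V (lin z (\<lambda>i. c K i + (- 1) * c' i) m) \<le> (\<Sum>i<m. \<bar>c K i + (- 1) * c' i\<bar> * vnorm V (z i))"
          by (rule lin_norm_le[OF z(1)])
        also have "\<dots> \<le> (\<Sum>i<m. \<bar>c K i + (- 1) * c' i\<bar> * 1)"
          by (intro sum_mono mult_left_mono z(2)) auto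
        finally show ?thesis by simp
      qed
      ultimately show ?thesis by linarith
    qed
    moreover have "(\<lambda>K. (1 / 2) ^ K + (\<Sum>i<m. \<bar>c K i - c' i\<bar>)) \<longlonglongrightarrow> 0 + (\<Sum>i<m. \<bar>c' i - c' i\<bar>)"
      by (intro tendsto_intros lim LIMSEQ_realpow_zero) auto
    ultimately have "vdist V x (lin z c' m) \<le> 0 + (\<Sum>i<m. \<bar>c' i - c' i\<bar>)"
      by (intro LIMSEQ_le_const) auto
    then have "vdist V x (lin z c' m) = 0"
      using norm_nonneg[of "vadd V x (vscale V (- 1) (lin z c' m))"] x z(1) by (simp add: vdist_eq lin_closed closed)
    then have "x = lin z c' m"
      using Metric_space.zero[OF Metric_space_vdist x(1) lin_closed[OF z(1)]] by simp
    then show ?thesis by blast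
  qed
  show ?thesis
  proof (cases "vnorm V x = 0")
    case True
    then show ?thesis using unit[OF x] by simp
  next
    case False
    define t where "t = vnorm V x"
    have t: "t > 0" using False norm_nonneg[OF x] by (simp add: t_def)
    have "vnorm V (vscale V (1 / t) x) \<le> 1" using t x by (simp add: norm_scale t_def)
    then obtain c where "vscale V (1 / t) x = lin z c m" using unit x closed by blast
    then have "vscale V t (vscale V (1 / t) x) = lin z (\<lambda>i. t * c i) m" using z(1) by (simp add: lin_scale)
    then show ?thesis using t x by (auto simp: scale_scale scale_one)
  qed
qed

text \<open>
  In an infinite-dimensional space no finite subset of the unit ball is a \<open>1 /
  2\<close>-net, so the sequence can always be continued.
\<close>

lemma (in vnormed) separated_sequence_exists:
  assumes "infinite_dimensional V"
  shows "\<exists>e :: nat \<Rightarrow> 'a. (\<forall>n. e n \<in> vcarrier V \<and> vnorm V (e n) \<le> 1) \<and>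
     (\<forall>n m. n \<noteq> m \<longrightarrow> 1 / 2 \<le> vdist V (e n) (e m))"
proof -
  have step: "\<exists>r. (r \<in> vcarrier V \<and> vnorm V r \<le> 1) \<and> (\<forall>y<n. 1 / 2 \<le> vdist V r (f y))"
    if f: "\<And>y. y < n \<Longrightarrow> f y \<in> vcarrier V \<and> vnorm V (f y) \<le> 1" for f :: "nat \<Rightarrow> 'a" and n
  proof (rule ccontr)
    assume not: "\<not> ?thesis"
    define z where "z i = (if i < n then f i else vzero V)" for i
    have z: "z i \<in> vcarrier V" "vnorm V (z i) \<le> 1" for i
      using f by (auto simp: z_def closed)
    have "\<exists>c. x = lin z c n" if "x \<in> vcarrier V" for x
    proof (rule spanned_if_half_net[OF z _ that])
      show "\<exists>i<n. vdist V x (z i) < 1 / 2" if "x \<in> vcarrier V" "vnorm V x \<le> 1" for x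
        using not that by (force simp: z_def not_le)
    qed
    then have "\<exists>cs. length cs = length (map z [0..<n]) \<and> x = lin_comb V cs (map z [0..<n])"
      if x: "x \<in> vcarrier V" for x
    proof -
      obtain c where "x = lin z c n" using \<open>\<And>x. x \<in> vcarrier V \<Longrightarrow> \<exists>c. x = lin z c n\<close>[OF x] by blast
      then show ?thesis
        by (intro exI[of _ "map c [0..<n]"]) (simp add: lin_comb_eq_lin[OF z(1)])
    qed
    moreover have "set (map z [0..<n]) \<subseteq> vcarrier V" using z by auto
    ultimately show False
      using assms unfolding infinite_dimensional_def by blast
  qed
  define P where "P f n r \<longleftrightarrow> (r \<in> vcarrier V \<and> vnorm V r \<le> 1) \<and> (\<forall>y<n. 1 / 2 \<le> vdist V r (f y))"
    for f :: "nat \<Rightarrow> 'a" and n r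
  have "\<exists>e. \<forall>n. P e n (e n)"
  proof (rule dependent_wellorder_choice)
    show "\<exists>r. P f n r" if "\<And>y. y < n \<Longrightarrow> P f y (f y)" for n and f :: "nat \<Rightarrow> 'a"
      using step[of n f] that unfolding P_def by blast
  qed (simp add: P_def)
  then obtain e where "\<forall>n. P e n (e n)" ..
  then have e: "\<And>n. e n \<in> vcarrier V \<and> vnorm V (e n) \<le> 1"
    "\<And>n y. y < n \<Longrightarrow> 1 / 2 \<le> vdist V (e n) (e y)" by (simp_all add: P_def)
  have "1 / 2 \<le> vdist V (e n) (e m)" if "n \<noteq> m" for n m
    using e(2)[of n m] e(2)[of m n] that vdist_commute[of "e n" "e m"] by (cases "n < m") auto
  with e(1) show ?thesis by blast
qed

theorem (in vnormed) Dvoretzky: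
  fixes A :: "(nat \<Rightarrow> real) set"
  assumes "infinite_dimensional V" "finite A" "\<eta> > 0"
  shows "\<exists>z. (\<forall>j. z j \<in> vcarrier V) \<and>
     (\<forall>x\<in>A. \<bar>vnorm V (lin z x n) - sqrt (\<Sum>j<n. (x j)\<^sup>2)\<bar> < \<eta>)"
proof -
  obtain U where U: "free_ultrafilter U" using free_ultrafilter_exists by blast
  obtain e :: "nat \<Rightarrow> 'a" where e: "\<And>n. e n \<in> vcarrier V \<and> vnorm V (e n) \<le> 1"
    "\<And>n m. n \<noteq> m \<Longrightarrow> 1 / 2 \<le> vdist V (e n) (e m)"
    using separated_sequence_exists[OF assms(1)] by blast
  interpret separated_sequence V U e
    by unfold_locales (use U e in auto)
  show ?thesis using Dvoretzky_sequence[OF assms(2,3)] .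
qed

section \<open>Approximation of formulas by countably many formulas\<close>

text \<open>
  Formulas with rational scalars in the terms and with rational constants, sums and products as
  the only connectives. There are only countably many of them, but by the theorem of Stone and
  Weierstrass they approximate all formulas.
\<close>

datatype rterm = RVar nat | RZero | RAdd rterm rterm | RScale rat rterm

datatype rform = RNorm rterm | RConst rat | RPlus rform rform | RTimes rform rform
  | RSup nat nat rform | RInf nat nat rform

instance rterm :: countable by countable_datatype
instance rform :: countable by countable_datatype

primrec term_of_rterm :: "rterm \<Rightarrow> bterm" where
  "term_of_rterm (RVar x) = Var x"
| "term_of_rterm RZero = Zero"
| "term_of_rterm (RAdd s t) = Add (term_of_rterm s) (term_of_rterm t)"
| "term_of_rterm (RScale q t) = Scale (of_rat q) (term_of_rterm t)"

primrec form_of_rform :: "rform \<Rightarrow> bform" where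
  "form_of_rform (RNorm t) = Norm (term_of_rterm t)"
| "form_of_rform (RConst q) = Conn (\<lambda>_. of_rat q) []"
| "form_of_rform (RPlus a b) = Conn (\<lambda>y. y 0 + y 1) [form_of_rform a, form_of_rform b]"
| "form_of_rform (RTimes a b) = Conn (\<lambda>y. y 0 * y 1) [form_of_rform a, form_of_rform b]"
| "form_of_rform (RSup x n a) = FSup x n (form_of_rform a)"
| "form_of_rform (RInf x n a) = FInf x n (form_of_rform a)"

lemma abs_cSUP_diff_le:
  fixes f g :: "'b \<Rightarrow> real"
  assumes "A \<noteq> {}" "\<And>a. a \<in> A \<Longrightarrow> \<bar>f a\<bar> \<le> B" "\<And>a. a \<in> A \<Longrightarrow> \<bar>f a - g a\<bar> \<le> c"
  shows "\<bar>(SUP a\<in>A. f a) - (SUP a\<in>A. g a)\<bar> \<le> c"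
proof -
  have fB: "f a \<le> B" and gB: "g a \<le> B + c" and fg: "f a \<le> g a + c" "g a \<le> f a + c" if "a \<in> A" for a
    using assms(2,3)[OF that] unfolding abs_le_iff by linarith+
  have bf: "bdd_above (f ` A)" using fB by (rule bdd_aboveI2)
  have bg: "bdd_above (g ` A)" using gB by (rule bdd_aboveI2)
  have "(SUP a\<in>A. f a) \<le> (SUP a\<in>A. g a) + c"
    by (rule cSUP_least[OF assms(1)]) (use fg(1) cSUP_upper[OF _ bg] in force)
  moreover have "(SUP a\<in>A. g a) \<le> (SUP a\<in>A. f a) + c"
    by (rule cSUP_least[OF assms(1)]) (use fg(2) cSUP_upper[OF _ bf] in force)
  ultimately show ?thesis by linarith
qed

lemma INF_real_uminus: "(INF a\<in>A. f a) = - (SUP a\<in>A. - f a)" for f :: "'b \<Rightarrow> real"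
  by (simp add: Inf_real_def image_image)

lemma abs_cINF_diff_le:
  fixes f g :: "'b \<Rightarrow> real"
  assumes "A \<noteq> {}" "\<And>a. a \<in> A \<Longrightarrow> \<bar>f a\<bar> \<le> B" "\<And>a. a \<in> A \<Longrightarrow> \<bar>f a - g a\<bar> \<le> c"
  shows "\<bar>(INF a\<in>A. f a) - (INF a\<in>A. g a)\<bar> \<le> c"
  using abs_cSUP_diff_le[of A "\<lambda>a. - f a" B "\<lambda>a. - g a" c] assms
  by (simp add: INF_real_uminus abs_minus_commute)

lemma abs_cSUP_le:
  fixes f :: "'b \<Rightarrow> real"
  assumes "A \<noteq> {}" "\<And>a. a \<in> A \<Longrightarrow> \<bar>f a\<bar> \<le> B"
  shows "\<bar>SUP a\<in>A. f a\<bar> \<le> B"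
  using abs_cSUP_diff_le[of A f B "\<lambda>_. 0" B] assms by simp

lemma abs_cINF_le:
  fixes f :: "'b \<Rightarrow> real"
  assumes "A \<noteq> {}" "\<And>a. a \<in> A \<Longrightarrow> \<bar>f a\<bar> \<le> B"
  shows "\<bar>INF a\<in>A. f a\<bar> \<le> B"
  using abs_cINF_diff_le[of A f B "\<lambda>_. 0" B] assms by simp

context vnormed
begin

definition bounded_assignment :: "real \<Rightarrow> (nat \<Rightarrow> 'a) \<Rightarrow> bool" where
  "bounded_assignment R s \<longleftrightarrow> (\<forall>x. s x \<in> vcarrier V \<and> vnorm V (s x) \<le> R)"

lemma bounded_assignment_mono: "bounded_assignment R s \<Longrightarrow> R \<le> R' \<Longrightarrow> bounded_assignment R' s"
  by (auto simp: bounded_assignment_def intro: order_trans)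

lemma bounded_assignment_update:
  "bounded_assignment R s \<Longrightarrow> a \<in> vball V (real n) \<Longrightarrow> bounded_assignment (max R (real n)) (s(x := a))"
  by (auto simp: bounded_assignment_def vball_def max_def intro: order_trans)

lemma zero_in_vball: "vzero V \<in> vball V (real n)"
  by (simp add: vball_def closed)

lemma vball_nonempty: "vball V (real n) \<noteq> {}"
  using zero_in_vball by blast

lemma tvalue_closed: "(\<And>x. s x \<in> vcarrier V) \<Longrightarrow> tvalue V s t \<in> vcarrier V"
  by (induction t) (auto simp: closed)

lemma add_interchange:
  assumes "a \<in> vcarrier V" "b \<in> vcarrier V" "c \<in> vcarrier V" "d \<in> vcarrier V"
  shows "vadd V (vadd V a b) (vadd V c d) = vadd V (vadd V a c) (vadd V b d)"
  using assms add_left_commute[of b c d] by (simp add: add_assoc closed)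

lemma vdist_add_le:
  assumes "x \<in> vcarrier V" "y \<in> vcarrier V" "x' \<in> vcarrier V" "y' \<in> vcarrier V"
  shows "vdist V (vadd V x y) (vadd V x' y') \<le> vdist V x x' + vdist V y y'"
proof -
  have "vadd V (vadd V x y) (vscale V (- 1) (vadd V x' y')) =
     vadd V (vadd V x (vscale V (- 1) x')) (vadd V y (vscale V (- 1) y'))"
    using assms by (simp add: closed scale_add_right add_interchange)
  then show ?thesis using assms by (simp add: vdist_eq closed norm_triangle)
qed

lemma vdist_scale:
  assumes "x \<in> vcarrier V" "y \<in> vcarrier V"
  shows "vdist V (vscale V r x) (vscale V r y) = \<bar>r\<bar> * vdist V x y"
proof -
  have "vadd V (vscale V r x) (vscale V (- 1) (vscale V r y)) = vscale V r (vadd V x (vscale V (- 1) y))"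
    using assms by (simp add: closed scale_add_right scale_scale)
  then show ?thesis using assms by (simp add: vdist_eq closed norm_scale)
qed

lemma vdist_scale_diff:
  assumes "x \<in> vcarrier V"
  shows "vdist V (vscale V r x) (vscale V q x) = \<bar>r - q\<bar> * vnorm V x"
  using assms scale_add_left[of x r "- q"] by (simp add: vdist_eq closed scale_scale flip: norm_scale)

lemma abs_norm_diff_le: "x \<in> vcarrier V \<Longrightarrow> y \<in> vcarrier V \<Longrightarrow> \<bar>vnorm V x - vnorm V y\<bar> \<le> vdist V x y"
  using norm_diff_le by (simp add: vdist_eq)

lemma vdist_nonneg: "0 \<le> vdist V x y"
  using Metric_space.nonneg[OF Metric_space_vdist] .

lemma tvalue_lipschitz:
  "\<exists>L\<ge>0. \<forall>s s' d. bounded_assignment R s \<longrightarrow> bounded_assignment R s' \<longrightarrow> 0 \<le> d \<longrightarrow>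
     (\<forall>x\<in>tvars t. vdist V (s x) (s' x) \<le> d) \<longrightarrow>
     vnorm V (tvalue V s t) \<le> L \<and> vdist V (tvalue V s t) (tvalue V s' t) \<le> L * d"
proof (induction t)
  case (Var x)
  have "vnorm V (s x) \<le> max 1 R" if "bounded_assignment R s" for s
    using that by (auto simp: bounded_assignment_def le_max_iff_disj)
  moreover have "vdist V (s x) (s' x) \<le> max 1 R * d" if "vdist V (s x) (s' x) \<le> d" "0 \<le> d" for s s' d
    using that mult_right_mono[of 1 "max 1 R" d] by linarith
  ultimately show ?case by (intro exI[of _ "max 1 R"]) simp
next
  case Zero
  have "vdist V (vzero V) (vzero V) = 0" by (simp add: vdist_eq closed scale_zero add_zero)
  then show ?case by (intro exI[of _ 0]) simp
next
  case (Add t u)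
  obtain L where L: "L \<ge> 0" "\<And>s s' d. bounded_assignment R s \<Longrightarrow> bounded_assignment R s' \<Longrightarrow> 0 \<le> d \<Longrightarrow>
     (\<forall>x\<in>tvars t. vdist V (s x) (s' x) \<le> d) \<Longrightarrow>
     vnorm V (tvalue V s t) \<le> L \<and> vdist V (tvalue V s t) (tvalue V s' t) \<le> L * d"
    using Add.IH(1) by blast
  obtain M where M: "M \<ge> 0" "\<And>s s' d. bounded_assignment R s \<Longrightarrow> bounded_assignment R s' \<Longrightarrow> 0 \<le> d \<Longrightarrow>
     (\<forall>x\<in>tvars u. vdist V (s x) (s' x) \<le> d) \<Longrightarrow>
     vnorm V (tvalue V s u) \<le> M \<and> vdist V (tvalue V s u) (tvalue V s' u) \<le> M * d"
    using Add.IH(2) by blast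
  show ?case
  proof (intro exI[of _ "L + M"] conjI allI impI)
    fix s s' d assume s: "bounded_assignment R s" "bounded_assignment R s'" "0 \<le> (d::real)"
      and d: "\<forall>x\<in>tvars (Add t u). vdist V (s x) (s' x) \<le> d"
    have c: "tvalue V s w \<in> vcarrier V" "tvalue V s' w \<in> vcarrier V" for w
      using s by (auto intro!: tvalue_closed simp: bounded_assignment_def)
    show "vnorm V (tvalue V s (Add t u)) \<le> L + M"
      using norm_triangle[OF c(1)[of t] c(1)[of u]] L(2)[OF s] M(2)[OF s] d by fastforce
    have "vdist V (tvalue V s t) (tvalue V s' t) \<le> L * d" "vdist V (tvalue V s u) (tvalue V s' u) \<le> M * d"
      using L(2)[OF s] M(2)[OF s] d by auto
    then show "vdist V (tvalue V s (Add t u)) (tvalue V s' (Add t u)) \<le> (L + M) * d"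
      using vdist_add_le[OF c(1)[of t] c(1)[of u] c(2)[of t] c(2)[of u]] by (simp add: distrib_right)
  qed (use L M in auto)
next
  case (Scale r t)
  obtain L where L: "L \<ge> 0" "\<And>s s' d. bounded_assignment R s \<Longrightarrow> bounded_assignment R s' \<Longrightarrow> 0 \<le> d \<Longrightarrow>
     (\<forall>x\<in>tvars t. vdist V (s x) (s' x) \<le> d) \<Longrightarrow>
     vnorm V (tvalue V s t) \<le> L \<and> vdist V (tvalue V s t) (tvalue V s' t) \<le> L * d"
    using Scale.IH by blast
  show ?case
  proof (intro exI[of _ "\<bar>r\<bar> * L"] conjI allI impI)
    fix s s' d assume s: "bounded_assignment R s" "bounded_assignment R s'" "0 \<le> (d::real)"
      and d: "\<forall>x\<in>tvars (Scale r t). vdist V (s x) (s' x) \<le> d"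
    have c: "tvalue V s w \<in> vcarrier V" "tvalue V s' w \<in> vcarrier V" for w
      using s by (auto intro!: tvalue_closed simp: bounded_assignment_def)
    show "vnorm V (tvalue V s (Scale r t)) \<le> \<bar>r\<bar> * L"
      using L(2)[OF s] d c by (simp add: norm_scale mult_left_mono)
    show "vdist V (tvalue V s (Scale r t)) (tvalue V s' (Scale r t)) \<le> \<bar>r\<bar> * L * d"
      using L(2)[OF s] d c by (simp add: vdist_scale mult_left_mono mult.assoc)
  qed (use L in auto)
qed

text \<open>
  One constant bounds both the values of \<open>\<phi>\<close> and its Lipschitz modulus on the
  assignments of norm at most \<open>R\<close>; products of formulas need both bounds.
\<close>

definition form_lip :: "real \<Rightarrow> bform \<Rightarrow> real \<Rightarrow> bool" where
  "form_lip R \<phi> L \<longleftrightarrow> L \<ge> 0 \<and>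
    (\<forall>s s' d. bounded_assignment R s \<longrightarrow> bounded_assignment R s' \<longrightarrow> 0 \<le> d \<longrightarrow>
     (\<forall>x\<in>fvars \<phi>. vdist V (s x) (s' x) \<le> d) \<longrightarrow>
     \<bar>fvalue V s \<phi>\<bar> \<le> L \<and> \<bar>fvalue V s \<phi> - fvalue V s' \<phi>\<bar> \<le> L * d)"

lemma form_lipD:
  assumes "form_lip R \<phi> L" "bounded_assignment R s"
  shows "\<bar>fvalue V s \<phi>\<bar> \<le> L"
    "bounded_assignment R s' \<Longrightarrow> 0 \<le> d \<Longrightarrow> (\<And>x. x \<in> fvars \<phi> \<Longrightarrow> vdist V (s x) (s' x) \<le> d) \<Longrightarrow>
       \<bar>fvalue V s \<phi> - fvalue V s' \<phi>\<bar> \<le> L * d"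
proof -
  have "\<forall>x\<in>fvars \<phi>. vdist V (s x) (s x) \<le> 0"
    using assms(2) by (simp add: vdist_eq bounded_assignment_def add_neg)
  then show "\<bar>fvalue V s \<phi>\<bar> \<le> L" using assms unfolding form_lip_def by blast
qed (use assms in \<open>auto simp: form_lip_def\<close>)

lemma vdist_refl: "x \<in> vcarrier V \<Longrightarrow> vdist V x x = 0"
  by (simp add: vdist_eq add_neg)

text \<open>
  Arbitrary connectives are only uniformly continuous on bounded sets, but polynomials are
  Lipschitz there. A quantifier over a ball of radius \<open>n\<close> enlarges the bound on the
  assignments to \<open>max R n\<close>.
\<close>

lemma rform_lipschitz: "\<exists>L. form_lip R (form_of_rform r) L"
proof (induction r arbitrary: R)
  case (RNorm t)
  obtain L where L: "L \<ge> 0" "\<And>s s' d. bounded_assignment R s \<Longrightarrow> bounded_assignment R s' \<Longrightarrow> 0 \<le> d \<Longrightarrow>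
     (\<forall>x\<in>tvars (term_of_rterm t). vdist V (s x) (s' x) \<le> d) \<Longrightarrow>
     vnorm V (tvalue V s (term_of_rterm t)) \<le> L \<and>
     vdist V (tvalue V s (term_of_rterm t)) (tvalue V s' (term_of_rterm t)) \<le> L * d"
    using tvalue_lipschitz[of R "term_of_rterm t"] by blast
  have "form_lip R (form_of_rform (RNorm t)) L"
    unfolding form_lip_def
  proof (intro conjI allI impI)
    fix s s' d assume s: "bounded_assignment R s" "bounded_assignment R s'" "0 \<le> (d::real)"
      and d: "\<forall>x\<in>fvars (form_of_rform (RNorm t)). vdist V (s x) (s' x) \<le> d"
    have c: "tvalue V s w \<in> vcarrier V" "tvalue V s' w \<in> vcarrier V" for w
      using s by (auto intro!: tvalue_closed simp: bounded_assignment_def)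
    show "\<bar>fvalue V s (form_of_rform (RNorm t))\<bar> \<le> L"
      using L(2)[OF s] d c by (simp add: norm_nonneg)
    show "\<bar>fvalue V s (form_of_rform (RNorm t)) - fvalue V s' (form_of_rform (RNorm t))\<bar> \<le> L * d"
      using L(2)[OF s] d abs_norm_diff_le[OF c(1) c(2)] by (fastforce intro: order_trans)
  qed (rule L)
  then show ?case by blast
next
  case (RConst q)
  then show ?case by (intro exI[of _ "\<bar>of_rat q\<bar>"]) (simp add: form_lip_def)
next
  case (RPlus a b)
  obtain L M where L: "form_lip R (form_of_rform a) L" and M: "form_lip R (form_of_rform b) M"
    using RPlus.IH by blast
  have "form_lip R (form_of_rform (RPlus a b)) (L + M)"
    unfolding form_lip_def
  proof (intro conjI allI impI)
    fix s s' d assume s: "bounded_assignment R s" "bounded_assignment R s'" "0 \<le> (d::real)"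
      and d: "\<forall>x\<in>fvars (form_of_rform (RPlus a b)). vdist V (s x) (s' x) \<le> d"
    have "\<bar>fvalue V s (form_of_rform a)\<bar> \<le> L" "\<bar>fvalue V s (form_of_rform b)\<bar> \<le> M"
      using form_lipD(1) L M s by blast+
    then show "\<bar>fvalue V s (form_of_rform (RPlus a b))\<bar> \<le> L + M" by simp
    have "\<bar>fvalue V s (form_of_rform a) - fvalue V s' (form_of_rform a)\<bar> \<le> L * d"
      "\<bar>fvalue V s (form_of_rform b) - fvalue V s' (form_of_rform b)\<bar> \<le> M * d"
      using form_lipD(2)[OF L s] form_lipD(2)[OF M s] d by auto
    then show "\<bar>fvalue V s (form_of_rform (RPlus a b)) - fvalue V s' (form_of_rform (RPlus a b))\<bar> \<le> (L + M) * d"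
      by (simp add: distrib_right)
  qed (use L M in \<open>auto simp: form_lip_def\<close>)
  then show ?case by blast
next
  case (RTimes a b)
  obtain L M where L: "form_lip R (form_of_rform a) L" and M: "form_lip R (form_of_rform b) M"
    using RTimes.IH by blast
  have LM: "L \<ge> 0" "M \<ge> 0" using L M by (auto simp: form_lip_def)
  have "form_lip R (form_of_rform (RTimes a b)) (2 * L * M)"
    unfolding form_lip_def
  proof (intro conjI allI impI)
    fix s s' d assume s: "bounded_assignment R s" "bounded_assignment R s'" "0 \<le> (d::real)"
      and d: "\<forall>x\<in>fvars (form_of_rform (RTimes a b)). vdist V (s x) (s' x) \<le> d"
    let ?a = "\<lambda>s. fvalue V s (form_of_rform a)" and ?b = "\<lambda>s. fvalue V s (form_of_rform b)"
    have b: "\<bar>?a s\<bar> \<le> L" "\<bar>?b s\<bar> \<le> M" "\<bar>?b s'\<bar> \<le> M"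
      using form_lipD(1) L M s by blast+
    have "\<bar>?a s\<bar> * \<bar>?b s\<bar> \<le> L * M" using b LM by (intro mult_mono) auto
    then show "\<bar>fvalue V s (form_of_rform (RTimes a b))\<bar> \<le> 2 * L * M"
      using mult_nonneg_nonneg[OF LM] by (simp add: abs_mult)
    have "\<bar>?a s - ?a s'\<bar> \<le> L * d" "\<bar>?b s - ?b s'\<bar> \<le> M * d"
      using form_lipD(2)[OF L s] form_lipD(2)[OF M s] d by auto
    then have "\<bar>?a s\<bar> * \<bar>?b s - ?b s'\<bar> \<le> L * (M * d)" "\<bar>?a s - ?a s'\<bar> * \<bar>?b s'\<bar> \<le> (L * d) * M"
      using b LM s by (auto intro!: mult_mono)
    moreover have "?a s * ?b s - ?a s' * ?b s' = ?a s * (?b s - ?b s') + (?a s - ?a s') * ?b s'"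
      by (simp add: algebra_simps)
    ultimately have "\<bar>?a s * ?b s - ?a s' * ?b s'\<bar> \<le> L * (M * d) + (L * d) * M"
      by (simp only:) (rule order_trans[OF abs_triangle_ineq add_mono], simp_all only: abs_mult)
    then show "\<bar>fvalue V s (form_of_rform (RTimes a b)) - fvalue V s' (form_of_rform (RTimes a b))\<bar> \<le> 2 * L * M * d"
      by (simp add: mult_ac)
  qed (use LM in auto)
  then show ?case by blast
next
  case (RSup x n a)
  obtain L where L: "form_lip (max R (real n)) (form_of_rform a) L" using RSup.IH by blast
  have "form_lip R (form_of_rform (RSup x n a)) L"
    unfolding form_lip_def
  proof (intro conjI allI impI)
    fix s s' d assume s: "bounded_assignment R s" "bounded_assignment R s'" "0 \<le> (d::real)"
      and d: "\<forall>y\<in>fvars (form_of_rform (RSup x n a)). vdist V (s y) (s' y) \<le> d"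
    have b: "\<bar>fvalue V (s(x := c)) (form_of_rform a)\<bar> \<le> L" if "c \<in> vball V (real n)" for c
      using form_lipD(1)[OF L bounded_assignment_update[OF s(1) that]] .
    have l: "\<bar>fvalue V (s(x := c)) (form_of_rform a) - fvalue V (s'(x := c)) (form_of_rform a)\<bar> \<le> L * d"
      if c: "c \<in> vball V (real n)" for c
    proof (rule form_lipD(2)[OF L bounded_assignment_update[OF s(1) c] bounded_assignment_update[OF s(2) c] s(3)])
      show "vdist V ((s(x := c)) y) ((s'(x := c)) y) \<le> d" if "y \<in> fvars (form_of_rform a)" for y
        using d that s(3) c by (cases "y = x") (auto simp: vdist_refl vball_def)
    qed
    show "\<bar>fvalue V s (form_of_rform (RSup x n a))\<bar> \<le> L"
      using abs_cSUP_le[OF vball_nonempty b] by simp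
    show "\<bar>fvalue V s (form_of_rform (RSup x n a)) - fvalue V s' (form_of_rform (RSup x n a))\<bar> \<le> L * d"
      using abs_cSUP_diff_le[OF vball_nonempty b l] by simp
  qed (use L in \<open>simp add: form_lip_def\<close>)
  then show ?case by blast
next
  case (RInf x n a)
  obtain L where L: "form_lip (max R (real n)) (form_of_rform a) L" using RInf.IH by blast
  have "form_lip R (form_of_rform (RInf x n a)) L"
    unfolding form_lip_def
  proof (intro conjI allI impI)
    fix s s' d assume s: "bounded_assignment R s" "bounded_assignment R s'" "0 \<le> (d::real)"
      and d: "\<forall>y\<in>fvars (form_of_rform (RInf x n a)). vdist V (s y) (s' y) \<le> d"
    have b: "\<bar>fvalue V (s(x := c)) (form_of_rform a)\<bar> \<le> L" if "c \<in> vball V (real n)" for c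
      using form_lipD(1)[OF L bounded_assignment_update[OF s(1) that]] .
    have l: "\<bar>fvalue V (s(x := c)) (form_of_rform a) - fvalue V (s'(x := c)) (form_of_rform a)\<bar> \<le> L * d"
      if c: "c \<in> vball V (real n)" for c
    proof (rule form_lipD(2)[OF L bounded_assignment_update[OF s(1) c] bounded_assignment_update[OF s(2) c] s(3)])
      show "vdist V ((s(x := c)) y) ((s'(x := c)) y) \<le> d" if "y \<in> fvars (form_of_rform a)" for y
        using d that s(3) c by (cases "y = x") (auto simp: vdist_refl vball_def)
    qed
    show "\<bar>fvalue V s (form_of_rform (RInf x n a))\<bar> \<le> L"
      using abs_cINF_le[OF vball_nonempty b] by simp
    show "\<bar>fvalue V s (form_of_rform (RInf x n a)) - fvalue V s' (form_of_rform (RInf x n a))\<bar> \<le> L * d"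
      using abs_cINF_diff_le[OF vball_nonempty b l] by simp
  qed (use L in \<open>simp add: form_lip_def\<close>)
  then show ?case by blast
qed

end

context vnormed
begin

definition form_approx :: "bform \<Rightarrow> bool" where
  "form_approx \<phi> \<longleftrightarrow> (\<forall>R. \<forall>e>0. \<exists>r. \<forall>s. bounded_assignment R s \<longrightarrow>
     \<bar>fvalue V s \<phi> - fvalue V s (form_of_rform r)\<bar> \<le> e)"

lemma form_approxE:
  assumes "form_approx \<phi>" "e > 0"
  obtains r where "\<And>s. bounded_assignment R s \<Longrightarrow> \<bar>fvalue V s \<phi> - fvalue V s (form_of_rform r)\<bar> \<le> e"
  using assms unfolding form_approx_def by meson

lemma form_approx_bounded:
  assumes "form_approx \<phi>"
  shows "\<exists>B\<ge>0. \<forall>s. bounded_assignment R s \<longrightarrow> \<bar>fvalue V s \<phi>\<bar> \<le> B"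
proof -
  obtain r where r: "\<And>s. bounded_assignment R s \<Longrightarrow> \<bar>fvalue V s \<phi> - fvalue V s (form_of_rform r)\<bar> \<le> 1"
    using form_approxE[OF assms zero_less_one, of R] by blast
  obtain L where L: "form_lip R (form_of_rform r) L" using rform_lipschitz by blast
  have "\<bar>fvalue V s \<phi>\<bar> \<le> L + 1" if "bounded_assignment R s" for s
    using r[OF that] form_lipD(1)[OF L that] by linarith
  moreover have "L + 1 \<ge> 0" using L by (simp add: form_lip_def)
  ultimately show ?thesis by blast
qed

lemma term_approx:
  "e > 0 \<Longrightarrow> \<exists>t'. \<forall>s. bounded_assignment R s \<longrightarrow> vdist V (tvalue V s t) (tvalue V s (term_of_rterm t')) \<le> e"
proof (induction t arbitrary: e)
  case (Var x)
  then show ?case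
    by (intro exI[of _ "RVar x"]) (simp add: vdist_refl bounded_assignment_def)
next
  case Zero
  then show ?case by (intro exI[of _ RZero]) (simp add: vdist_refl closed)
next
  case (Add t u)
  obtain t' where t': "\<And>s. bounded_assignment R s \<Longrightarrow> vdist V (tvalue V s t) (tvalue V s (term_of_rterm t')) \<le> e / 2"
    using Add.IH(1)[of "e / 2"] Add.prems by auto
  obtain u' where u': "\<And>s. bounded_assignment R s \<Longrightarrow> vdist V (tvalue V s u) (tvalue V s (term_of_rterm u')) \<le> e / 2"
    using Add.IH(2)[of "e / 2"] Add.prems by auto
  show ?case
  proof (intro exI[of _ "RAdd t' u'"] allI impI)
    fix s assume s: "bounded_assignment R s"
    then have c: "tvalue V s w \<in> vcarrier V" for w
      by (auto intro!: tvalue_closed simp: bounded_assignment_def)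
    show "vdist V (tvalue V s (Add t u)) (tvalue V s (term_of_rterm (RAdd t' u'))) \<le> e"
      using vdist_add_le[OF c[of t] c[of u] c[of "term_of_rterm t'"] c[of "term_of_rterm u'"]]
        t'[OF s] u'[OF s] by simp
  qed
next
  case (Scale r t)
  obtain L where L: "L \<ge> 0" "\<And>s s' d. bounded_assignment R s \<Longrightarrow> bounded_assignment R s' \<Longrightarrow> 0 \<le> d \<Longrightarrow>
     (\<forall>x\<in>tvars t. vdist V (s x) (s' x) \<le> d) \<Longrightarrow>
     vnorm V (tvalue V s t) \<le> L \<and> vdist V (tvalue V s t) (tvalue V s' t) \<le> L * d"
    using tvalue_lipschitz[of R t] by blast
  have Lb: "vnorm V (tvalue V s t) \<le> L" if "bounded_assignment R s" for s
    using L(2)[OF that that, of 0] that by (simp add: vdist_refl bounded_assignment_def)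
  define d where "d = min 1 (e / (2 * (L + 1)))"
  have d: "d > 0" using Scale.prems L by (simp add: d_def)
  obtain q where q: "r - d < real_of_rat q" "real_of_rat q < r" using of_rat_dense[of "r - d" r] d by auto
  have qr: "\<bar>r - of_rat q\<bar> \<le> d" using q by linarith
  have "d \<le> 1" by (simp add: d_def)
  with q have q1: "\<bar>real_of_rat q\<bar> \<le> \<bar>r\<bar> + 1" by linarith
  obtain t' where t': "\<And>s. bounded_assignment R s \<Longrightarrow> vdist V (tvalue V s t) (tvalue V s (term_of_rterm t')) \<le> e / (2 * (\<bar>r\<bar> + 1))"
    using Scale.IH[of "e / (2 * (\<bar>r\<bar> + 1))"] Scale.prems by (auto simp: add_nonneg_pos)
  show ?case
  proof (intro exI[of _ "RScale q t'"] allI impI)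
    fix s assume s: "bounded_assignment R s"
    then have c: "tvalue V s w \<in> vcarrier V" for w
      by (auto intro!: tvalue_closed simp: bounded_assignment_def)
    let ?a = "tvalue V s t" and ?b = "tvalue V s (term_of_rterm t')"
    have "vdist V (vscale V r ?a) (vscale V (of_rat q) ?b) \<le>
       vdist V (vscale V r ?a) (vscale V (of_rat q) ?a) + vdist V (vscale V (of_rat q) ?a) (vscale V (of_rat q) ?b)"
      by (intro vdist_triangle closed c)
    also have "vdist V (vscale V r ?a) (vscale V (of_rat q) ?a) \<le> e / (2 * (L + 1)) * (L + 1)"
      unfolding vdist_scale_diff[OF c]
      using qr Lb[OF s] L Scale.prems by (intro mult_mono) (auto simp: d_def norm_nonneg c)
    also have "\<dots> = e / 2" using L by (simp add: field_simps)
    also have "vdist V (vscale V (of_rat q) ?a) (vscale V (of_rat q) ?b) \<le> (\<bar>r\<bar> + 1) * (e / (2 * (\<bar>r\<bar> + 1)))"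
      unfolding vdist_scale[OF c c] using q1 t'[OF s] by (intro mult_mono) (auto simp: vdist_nonneg)
    also have "\<dots> = e / 2" by (simp add: field_simps)
    finally show "vdist V (tvalue V s (Scale r t)) (tvalue V s (term_of_rterm (RScale q t'))) \<le> e" by simp
  qed
qed

text \<open>
  Arguments of a connective are approximable by induction; approximations may be substituted into
  a polynomial because sums and products are continuous on bounded sets.
\<close>

lemma poly_of_forms_approx:
  assumes p: "p \<in> poly_fun {..<length \<phi>s}" and \<phi>s: "\<And>\<phi>. \<phi> \<in> set \<phi>s \<Longrightarrow> form_approx \<phi>"
  shows "e > 0 \<Longrightarrow> \<exists>r. \<forall>s. bounded_assignment R s \<longrightarrow>
     \<bar>p (nth_default 0 (map (fvalue V s) \<phi>s)) - fvalue V s (form_of_rform r)\<bar> \<le> e"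
  using p
proof (induction arbitrary: e)
  case (poly_const c)
  obtain q where q: "c - e < real_of_rat q" "real_of_rat q < c" using of_rat_dense[of "c - e" c] poly_const by auto
  then have "\<bar>c - of_rat q\<bar> \<le> e" by linarith
  then show ?case by (intro exI[of _ "RConst q"]) simp
next
  case (poly_coord i)
  then have "form_approx (\<phi>s ! i)" using \<phi>s by simp
  from form_approxE[OF this poly_coord(2), of R] obtain r where
    "\<And>s. bounded_assignment R s \<Longrightarrow> \<bar>fvalue V s (\<phi>s ! i) - fvalue V s (form_of_rform r)\<bar> \<le> e" by blast
  then show ?case using poly_coord by (intro exI[of _ r]) (simp add: nth_default_nth)
next
  case (poly_add p q)
  obtain r1 where r1: "\<And>s. bounded_assignment R s \<Longrightarrow>
     \<bar>p (nth_default 0 (map (fvalue V s) \<phi>s)) - fvalue V s (form_of_rform r1)\<bar> \<le> e / 2"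
    using poly_add.IH(1)[of "e / 2"] poly_add.prems by auto
  obtain r2 where r2: "\<And>s. bounded_assignment R s \<Longrightarrow>
     \<bar>q (nth_default 0 (map (fvalue V s) \<phi>s)) - fvalue V s (form_of_rform r2)\<bar> \<le> e / 2"
    using poly_add.IH(2)[of "e / 2"] poly_add.prems by auto
  have tri: "\<bar>a + b - (c + d)\<bar> \<le> e" if "\<bar>a - c\<bar> \<le> e / 2" "\<bar>b - d\<bar> \<le> e / 2" for a b c d :: real
    using that by linarith
  show ?case
    by (intro exI[of _ "RPlus r1 r2"]) (auto intro!: tri r1 r2)
next
  case (poly_mult p q)
  let ?v = "\<lambda>s. nth_default 0 (map (fvalue V s) \<phi>s)"
  have bd: "\<exists>B\<ge>0. \<forall>s. bounded_assignment R s \<longrightarrow> \<bar>g (?v s)\<bar> \<le> B"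
    if g: "\<And>e. e > 0 \<Longrightarrow> \<exists>r. \<forall>s. bounded_assignment R s \<longrightarrow> \<bar>g (?v s) - fvalue V s (form_of_rform r)\<bar> \<le> e" for g
  proof -
    obtain r where r: "\<And>s. bounded_assignment R s \<Longrightarrow> \<bar>g (?v s) - fvalue V s (form_of_rform r)\<bar> \<le> 1"
      using g[of 1] by auto
    obtain L where L: "form_lip R (form_of_rform r) L" using rform_lipschitz by blast
    have "\<bar>g (?v s)\<bar> \<le> L + 1" if "bounded_assignment R s" for s
      using r[OF that] form_lipD(1)[OF L that] by linarith
    moreover have "L + 1 \<ge> 0" using L by (simp add: form_lip_def)
    ultimately show ?thesis by blast
  qed
  obtain P where P: "P \<ge> 0" "\<And>s. bounded_assignment R s \<Longrightarrow> \<bar>p (?v s)\<bar> \<le> P" using bd[OF poly_mult.IH(1)] by blast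
  obtain Q where Q: "Q \<ge> 0" "\<And>s. bounded_assignment R s \<Longrightarrow> \<bar>q (?v s)\<bar> \<le> Q" using bd[OF poly_mult.IH(2)] by blast
  define e' where "e' = min 1 (e / (P + Q + 1))"
  have e': "e' > 0" "e' \<le> 1" using poly_mult.prems P Q by (auto simp: e'_def)
  have "e' * (P + Q + 1) \<le> e / (P + Q + 1) * (P + Q + 1)"
    using P Q by (intro mult_right_mono) (auto simp: e'_def)
  then have ee: "e' * (P + Q + 1) \<le> e" using P Q by simp
  obtain r1 where r1: "\<And>s. bounded_assignment R s \<Longrightarrow> \<bar>p (?v s) - fvalue V s (form_of_rform r1)\<bar> \<le> e'"
    using poly_mult.IH(1)[OF e'(1)] by blast
  obtain r2 where r2: "\<And>s. bounded_assignment R s \<Longrightarrow> \<bar>q (?v s) - fvalue V s (form_of_rform r2)\<bar> \<le> e'"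
    using poly_mult.IH(2)[OF e'(1)] by blast
  have "\<bar>p (?v s) * q (?v s) - fvalue V s (form_of_rform r1) * fvalue V s (form_of_rform r2)\<bar> \<le> e"
    if s: "bounded_assignment R s" for s
  proof -
    let ?a = "p (?v s)" and ?b = "q (?v s)" and ?c = "fvalue V s (form_of_rform r1)" and ?d = "fvalue V s (form_of_rform r2)"
    have "?a * ?b - ?c * ?d = ?a * (?b - ?d) + (?a - ?c) * ?d" by (simp add: algebra_simps)
    then have "\<bar>?a * ?b - ?c * ?d\<bar> \<le> \<bar>?a\<bar> * \<bar>?b - ?d\<bar> + \<bar>?a - ?c\<bar> * \<bar>?d\<bar>"
      using abs_triangle_ineq[of "?a * (?b - ?d)" "(?a - ?c) * ?d"] by (simp add: abs_mult)
    also have "\<dots> \<le> P * e' + e' * (Q + 1)"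
    proof (intro add_mono mult_mono)
      have "\<bar>d\<bar> \<le> Q + 1" if "\<bar>b\<bar> \<le> Q" "\<bar>b - d\<bar> \<le> e'" for b d using that e'(2) by linarith
      then show "\<bar>?d\<bar> \<le> Q + 1" using Q(2)[OF s] r2[OF s] by blast
    qed (use P Q r1 r2 s e' in auto)
    also have "\<dots> = e' * (P + Q + 1)" by (simp add: algebra_simps)
    finally show ?thesis using ee by simp
  qed
  then show ?case by (intro exI[of _ "RTimes r1 r2"]) simp
qed

text \<open>
  The only case that is not routine is that of a connective. On assignments bounded by
  \<open>R\<close> the arguments range over a compact cube, on which the connective is uniformly
  close to a polynomial.
\<close>

lemma wf_form_approx: "wf_form \<phi> \<Longrightarrow> form_approx \<phi>"
proof (induction \<phi>)
  case (Norm t)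
  show ?case
    unfolding form_approx_def
  proof (intro allI impI)
    fix R e :: real assume "e > 0"
    then obtain t' where t': "\<And>s. bounded_assignment R s \<Longrightarrow> vdist V (tvalue V s t) (tvalue V s (term_of_rterm t')) \<le> e"
      using term_approx by blast
    show "\<exists>r. \<forall>s. bounded_assignment R s \<longrightarrow> \<bar>fvalue V s (Norm t) - fvalue V s (form_of_rform r)\<bar> \<le> e"
    proof (intro exI[of _ "RNorm t'"] allI impI)
      fix s assume s: "bounded_assignment R s"
      then have c: "tvalue V s w \<in> vcarrier V" for w
        by (auto intro!: tvalue_closed simp: bounded_assignment_def)
      show "\<bar>fvalue V s (Norm t) - fvalue V s (form_of_rform (RNorm t'))\<bar> \<le> e"
        using order_trans[OF abs_norm_diff_le[OF c c] t'[OF s]] by simp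
    qed
  qed
next
  case (Conn u \<phi>s)
  then have \<phi>s: "\<And>\<phi>. \<phi> \<in> set \<phi>s \<Longrightarrow> form_approx \<phi>" and u: "continuous_on UNIV u" by auto
  show ?case
    unfolding form_approx_def
  proof (intro allI impI)
    fix R e :: real assume e: "e > 0"
    have "\<exists>B. \<forall>\<phi>\<in>set \<phi>s. \<forall>s. bounded_assignment R s \<longrightarrow> \<bar>fvalue V s \<phi>\<bar> \<le> B"
    proof -
      obtain b where b: "\<And>\<phi>. \<phi> \<in> set \<phi>s \<Longrightarrow> b \<phi> \<ge> 0 \<and> (\<forall>s. bounded_assignment R s \<longrightarrow> \<bar>fvalue V s \<phi>\<bar> \<le> b \<phi>)"
        using form_approx_bounded[OF \<phi>s, of _ R] by metis
      have "b \<phi> \<le> (\<Sum>\<phi>\<in>set \<phi>s. b \<phi>)" if "\<phi> \<in> set \<phi>s" for \<phi>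
        using that b by (intro member_le_sum) auto
      then show ?thesis using b by (intro exI[of _ "\<Sum>\<phi>\<in>set \<phi>s. b \<phi>"]) (blast intro: order_trans)
    qed
    then obtain B where B: "\<And>\<phi> s. \<phi> \<in> set \<phi>s \<Longrightarrow> bounded_assignment R s \<Longrightarrow> \<bar>fvalue V s \<phi>\<bar> \<le> B" by blast
    obtain p where p: "p \<in> poly_fun {..<length \<phi>s}" "\<And>y. y \<in> cube {..<length \<phi>s} B \<Longrightarrow> \<bar>u y - p y\<bar> < e / 2"
      using poly_fun_dense[OF continuous_on_subset[OF u subset_UNIV], of "e / 2"] e by (metis half_gt_zero)
    obtain r where r: "\<And>s. bounded_assignment R s \<Longrightarrow>
        \<bar>p (nth_default 0 (map (fvalue V s) \<phi>s)) - fvalue V s (form_of_rform r)\<bar> \<le> e / 2"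
      using poly_of_forms_approx[OF p(1) \<phi>s, of "e / 2" R] e by auto
    show "\<exists>r. \<forall>s. bounded_assignment R s \<longrightarrow> \<bar>fvalue V s (Conn u \<phi>s) - fvalue V s (form_of_rform r)\<bar> \<le> e"
    proof (intro exI[of _ r] allI impI)
      fix s assume s: "bounded_assignment R s"
      have "nth_default 0 (map (fvalue V s) \<phi>s) \<in> cube {..<length \<phi>s} B"
        using B s by (auto simp: cube_def nth_default_def)
      moreover have "\<bar>a - c\<bar> \<le> e" if "\<bar>a - b\<bar> < e / 2" "\<bar>b - c\<bar> \<le> e / 2" for a b c
        using that by linarith
      ultimately have "\<bar>u (nth_default 0 (map (fvalue V s) \<phi>s)) - fvalue V s (form_of_rform r)\<bar> \<le> e"
        using p(2) r[OF s] by blast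
      then show "\<bar>fvalue V s (Conn u \<phi>s) - fvalue V s (form_of_rform r)\<bar> \<le> e" by simp
    qed
  qed
next
  case (FSup x n \<phi>)
  then have \<phi>: "form_approx \<phi>" by simp
  show ?case
    unfolding form_approx_def
  proof (intro allI impI)
    fix R e :: real assume e: "e > 0"
    obtain r where r: "\<And>s. bounded_assignment (max R (real n)) s \<Longrightarrow> \<bar>fvalue V s \<phi> - fvalue V s (form_of_rform r)\<bar> \<le> e"
      using form_approxE[OF \<phi> e, of "max R (real n)"] by blast
    obtain B where B: "\<And>s. bounded_assignment (max R (real n)) s \<Longrightarrow> \<bar>fvalue V s \<phi>\<bar> \<le> B"
      using form_approx_bounded[OF \<phi>] by blast
    show "\<exists>r. \<forall>s. bounded_assignment R s \<longrightarrow> \<bar>fvalue V s (FSup x n \<phi>) - fvalue V s (form_of_rform r)\<bar> \<le> e"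
      using abs_cSUP_diff_le[OF vball_nonempty B r, OF bounded_assignment_update bounded_assignment_update]
      by (intro exI[of _ "RSup x n r"]) simp
  qed
next
  case (FInf x n \<phi>)
  then have \<phi>: "form_approx \<phi>" by simp
  show ?case
    unfolding form_approx_def
  proof (intro allI impI)
    fix R e :: real assume e: "e > 0"
    obtain r where r: "\<And>s. bounded_assignment (max R (real n)) s \<Longrightarrow> \<bar>fvalue V s \<phi> - fvalue V s (form_of_rform r)\<bar> \<le> e"
      using form_approxE[OF \<phi> e, of "max R (real n)"] by blast
    obtain B where B: "\<And>s. bounded_assignment (max R (real n)) s \<Longrightarrow> \<bar>fvalue V s \<phi>\<bar> \<le> B"
      using form_approx_bounded[OF \<phi>] by blast
    show "\<exists>r. \<forall>s. bounded_assignment R s \<longrightarrow> \<bar>fvalue V s (FInf x n \<phi>) - fvalue V s (form_of_rform r)\<bar> \<le> e"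
      using abs_cINF_diff_le[OF vball_nonempty B r, OF bounded_assignment_update bounded_assignment_update]
      by (intro exI[of _ "RInf x n r"]) simp
  qed
qed

end

lemma tvalue_cong: "(\<And>x. x \<in> tvars t \<Longrightarrow> s x = s' x) \<Longrightarrow> tvalue V s t = tvalue V s' t"
  by (induction t) auto

lemma fvalue_cong: "(\<And>x. x \<in> fvars \<phi> \<Longrightarrow> s x = s' x) \<Longrightarrow> fvalue V s \<phi> = fvalue V s' \<phi>"
proof (induction \<phi> arbitrary: s s')
  case (Norm t)
  then show ?case using tvalue_cong[of t s s' V] by simp
next
  case (Conn u \<phi>s)
  have "fvalue V s \<phi> = fvalue V s' \<phi>" if "\<phi> \<in> set \<phi>s" for \<phi>
    using that by (rule Conn.IH) (use Conn.prems that in auto)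
  then show ?case by (simp cong: map_cong)
next
  case (FSup x n \<phi>)
  have "fvalue V (s(x := a)) \<phi> = fvalue V (s'(x := a)) \<phi>" for a
    by (rule FSup.IH) (use FSup.prems in auto)
  then show ?case by simp
next
  case (FInf x n \<phi>)
  have "fvalue V (s(x := a)) \<phi> = fvalue V (s'(x := a)) \<phi>" for a
    by (rule FInf.IH) (use FInf.prems in auto)
  then show ?case by simp
qed

lemma finite_tvars: "finite (tvars t)"
  by (induction t) auto

lemma finite_fvars: "finite (fvars \<phi>)"
  by (induction \<phi>) (auto simp: finite_tvars)

context vnormed
begin

lemma wf_form_bounded:
  "wf_form \<phi> \<Longrightarrow> \<exists>B\<ge>0. \<forall>s. bounded_assignment R s \<longrightarrow> \<bar>fvalue V s \<phi>\<bar> \<le> B"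
  by (rule form_approx_bounded[OF wf_form_approx])

text \<open>
  Inherited from the Lipschitz continuity of the approximating formulas.
\<close>

lemma wf_form_uniformly_continuous:
  assumes "wf_form \<phi>" "e > 0"
  shows "\<exists>d>0. \<forall>s s'. bounded_assignment R s \<longrightarrow> bounded_assignment R s' \<longrightarrow>
     (\<forall>x\<in>fvars \<phi>. vdist V (s x) (s' x) \<le> d) \<longrightarrow> \<bar>fvalue V s \<phi> - fvalue V s' \<phi>\<bar> \<le> e"
proof -
  obtain r where r: "\<And>s. bounded_assignment R s \<Longrightarrow> \<bar>fvalue V s \<phi> - fvalue V s (form_of_rform r)\<bar> \<le> e / 3"
    using form_approxE[OF wf_form_approx[OF assms(1)], of "e / 3" R] assms(2) by auto
  obtain L where L: "form_lip R (form_of_rform r) L" using rform_lipschitz by blast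
  then have L0: "L \<ge> 0" by (simp add: form_lip_def)
  define d where "d = e / (3 * (L + 1))"
  have d: "d > 0" using L0 assms by (simp add: d_def)
  have "L * d \<le> (L + 1) * d" using d by simp
  also have "\<dots> = e / 3" using L0 by (simp add: d_def field_simps)
  finally have Ld: "L * d \<le> e / 3" .
  show ?thesis
  proof (intro exI[of _ d] conjI allI impI d)
    fix s s' assume s: "bounded_assignment R s" "bounded_assignment R s'" and close: "\<forall>x\<in>fvars \<phi>. vdist V (s x) (s' x) \<le> d"
    (* The approximating formula may have other free variables than \<open>\<phi>\<close>, on
       which \<open>s\<close> and \<open>s'\<close> need not be close; changing \<open>s\<close>
       only at the free variables of \<open>\<phi>\<close> avoids them. *)
    define t where "t x = (if x \<in> fvars \<phi> then s' x else s x)" for x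
    have t: "bounded_assignment R t" using s by (auto simp: bounded_assignment_def t_def)
    have "vdist V (s x) (t x) \<le> d" for x
      using close d s by (auto simp: t_def vdist_refl bounded_assignment_def)
    then have "\<bar>fvalue V s (form_of_rform r) - fvalue V t (form_of_rform r)\<bar> \<le> L * d"
      using form_lipD(2)[OF L s(1) t] d by simp
    moreover have "fvalue V s' \<phi> = fvalue V t \<phi>" by (rule fvalue_cong) (simp add: t_def)
    moreover have "\<bar>a - b\<bar> \<le> e" if "\<bar>a - a'\<bar> \<le> e / 3" "\<bar>a' - b'\<bar> \<le> L * d" "\<bar>b - b'\<bar> \<le> e / 3" for a b a' b'
      using that Ld by linarith
    ultimately show "\<bar>fvalue V s \<phi> - fvalue V s' \<phi>\<bar> \<le> e"
      using r[OF s(1)] r[OF t] by metis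
  qed
qed

end

section \<open>Separable elementary substructures of ultrapowers\<close>

lemma vbanach_iff:
  fixes V :: "'a space"
  shows "vbanach V \<longleftrightarrow> vnormed V \<and>
    (\<forall>\<sigma> :: nat \<Rightarrow> 'a. (\<forall>n. \<sigma> n \<in> vcarrier V) \<longrightarrow> (\<forall>e>0. \<exists>N. \<forall>n\<ge>N. \<forall>m\<ge>N. vdist V (\<sigma> n) (\<sigma> m) < e) \<longrightarrow>
       (\<exists>x\<in>vcarrier V. \<forall>e>0. \<exists>N. \<forall>n\<ge>N. vdist V (\<sigma> n) x < e))"
proof (cases "vnormed V")
  case True
  then interpret Metric_space "vcarrier V" "vdist V" by (rule vnormed.Metric_space_vdist)
  have c1: "MCauchy \<sigma> \<longleftrightarrow> (\<forall>n. \<sigma> n \<in> vcarrier V) \<and> (\<forall>e>0. \<exists>N. \<forall>n\<ge>N. \<forall>m\<ge>N. vdist V (\<sigma> n) (\<sigma> m) < e)" for \<sigma> :: "nat \<Rightarrow> 'a"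
    unfolding MCauchy_def by (auto simp: image_subset_iff)
  have c2: "(\<exists>x. limitin mtopology \<sigma> x sequentially) \<longleftrightarrow> (\<exists>x\<in>vcarrier V. \<forall>e>0. \<exists>N. \<forall>n\<ge>N. vdist V (\<sigma> n) x < e)"
    if "\<forall>n. \<sigma> n \<in> vcarrier V" for \<sigma> :: "nat \<Rightarrow> 'a"
    using that by (auto simp: limit_metric_sequentially)
  have "mcomplete \<longleftrightarrow> (\<forall>\<sigma> :: nat \<Rightarrow> 'a. (\<forall>n. \<sigma> n \<in> vcarrier V) \<longrightarrow>
      (\<forall>e>0. \<exists>N. \<forall>n\<ge>N. \<forall>m\<ge>N. vdist V (\<sigma> n) (\<sigma> m) < e) \<longrightarrow>
      (\<exists>x\<in>vcarrier V. \<forall>e>0. \<exists>N. \<forall>n\<ge>N. vdist V (\<sigma> n) x < e))"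
    unfolding mcomplete_def
  proof (rule iff_allI)
    have "(mc \<longrightarrow> l) = (a \<longrightarrow> b \<longrightarrow> l')" if "mc = (a \<and> b)" "a \<Longrightarrow> l = l'" for mc l a b l'
      using that by blast
    from this[OF c1 c2]
    show "(MCauchy \<sigma> \<longrightarrow> (\<exists>x. limitin mtopology \<sigma> x sequentially)) =
       ((\<forall>n. \<sigma> n \<in> vcarrier V) \<longrightarrow>
      (\<forall>e>0. \<exists>N. \<forall>n\<ge>N. \<forall>m\<ge>N. vdist V (\<sigma> n) (\<sigma> m) < e) \<longrightarrow>
      (\<exists>x\<in>vcarrier V. \<forall>e>0. \<exists>N. \<forall>n\<ge>N. vdist V (\<sigma> n) x < e))" for \<sigma> .
  qed
  then show ?thesis
    using True by (simp add: vbanach_def)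
qed (simp add: vbanach_def)

lemma (in vnormed) vseparable_iff:
  "vseparable V \<longleftrightarrow> (\<exists>C. countable C \<and> C \<subseteq> vcarrier V \<and> (\<forall>x\<in>vcarrier V. \<forall>e>0. \<exists>c\<in>C. vdist V x c < e))"
proof -
  interpret Metric_space "vcarrier V" "vdist V" by (rule Metric_space_vdist)
  have "mtopology closure_of C = vcarrier V \<longleftrightarrow> (\<forall>x\<in>vcarrier V. \<forall>e>0. \<exists>c\<in>C. vdist V x c < e)"
    if "C \<subseteq> vcarrier V" for C
  proof -
    have eq: "mtopology closure_of C = {x \<in> vcarrier V. \<forall>r>0. \<exists>c\<in>C. vdist V x c < r}"
      unfolding metric_closure_of using that
      by (intro Collect_cong conj_cong refl all_cong imp_cong bex_cong) auto
    show ?thesis unfolding eq by blast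
  qed
  then show ?thesis
    unfolding vseparable_def separable_space_def by auto
qed

lemma (in ultra) ulim_mono:
  fixes f g :: "nat \<Rightarrow> real"
  assumes "(f \<longlongrightarrow> a) U" "(g \<longlongrightarrow> b) U" "eventually (\<lambda>k. f k \<le> g k) U"
  shows "a \<le> b"
  using tendsto_le[OF U_not_bot assms(2,1,3)] .

text \<open>
  Names for the elements of a countable dense subset of the hull. \<open>Skolem \<psi> x n
  ts\<close> names an element of the ball of radius \<open>n\<close> at which
  \<open>\<psi>\<close>, as a function of \<open>x\<close>, is almost maximal, when the other
  variables take the values named by \<open>ts\<close>.
\<close>

datatype skolem_term = Base nat | SAdd skolem_term skolem_term | SScale rat skolem_term
  | Skolem rform nat nat "skolem_term list"

instance skolem_term :: countable by countable_datatype

text \<open>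
  The ultrapower of \<open>V\<close> is handled through its representatives, the bounded sequences
  in \<open>V\<close>; the sequences \<open>z j\<close> are the elements that the hull is required
  to contain.
\<close>

locale skolem_hull = vnormed V + ultra U for V :: "'a space" and U +
  fixes z :: "nat \<Rightarrow> nat \<Rightarrow> 'a"
  assumes z_closed: "z j k \<in> vcarrier V" and z_bounded: "\<exists>R. \<forall>k. vnorm V (z j k) \<le> R"
begin

text \<open>
  In the \<open>k\<close>-th factor of the ultrapower the supremum is attained up to \<open>1 / (k
  + 1)\<close>, so that in the ultrapower it is attained exactly.
\<close>

definition near_max :: "rform \<Rightarrow> nat \<Rightarrow> nat \<Rightarrow> nat \<Rightarrow> (nat \<Rightarrow> 'a) \<Rightarrow> 'a" where
  "near_max \<psi> x n k s = (SOME c. c \<in> vball V (real n) \<and>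
     (SUP a\<in>vball V (real n). fvalue V (s(x := a)) (form_of_rform \<psi>)) - 1 / real (Suc k)
       \<le> fvalue V (s(x := c)) (form_of_rform \<psi>))"

fun hval :: "skolem_term \<Rightarrow> nat \<Rightarrow> 'a" where
  "hval (Base j) k = z j k"
| "hval (SAdd s t) k = vadd V (hval s k) (hval t k)"
| "hval (SScale q t) k = vscale V (of_rat q) (hval t k)"
| "hval (Skolem \<psi> x n ts) k = near_max \<psi> x n k (nth_default (vzero V) (map (\<lambda>t. hval t k) ts))"

lemma near_max:
  "near_max \<psi> x n k s \<in> vball V (real n) \<and>
     (SUP a\<in>vball V (real n). fvalue V (s(x := a)) (form_of_rform \<psi>)) - 1 / real (Suc k)
       \<le> fvalue V (s(x := near_max \<psi> x n k s)) (form_of_rform \<psi>)"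
proof -
  let ?f = "\<lambda>a. fvalue V (s(x := a)) (form_of_rform \<psi>)"
  let ?S = "SUP a\<in>vball V (real n). ?f a"
  have "\<exists>c. c \<in> vball V (real n) \<and> ?S - 1 / real (Suc k) \<le> ?f c"
  proof (rule ccontr)
    assume not: "\<not> ?thesis"
    then have "?f c \<le> ?S - 1 / real (Suc k)" if "c \<in> vball V (real n)" for c
      using that by (meson linear)
    then have "?S \<le> ?S - 1 / real (Suc k)"
      by (rule cSUP_least[OF vball_nonempty])
    then show False by (simp add: field_simps)
  qed
  then show ?thesis unfolding near_max_def by (rule someI_ex)
qed

lemma hval_SAdd: "hval (SAdd s t) = (\<lambda>k. vadd V (hval s k) (hval t k))"
  and hval_SScale: "hval (SScale q t) = (\<lambda>k. vscale V (of_rat q) (hval t k))"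
  by (simp_all add: fun_eq_iff)

definition bseq :: "(nat \<Rightarrow> 'a) \<Rightarrow> bool" where
  "bseq x \<longleftrightarrow> (\<forall>k. x k \<in> vcarrier V) \<and> (\<exists>R. \<forall>k. vnorm V (x k) \<le> R)"

lemma bseq_closed: "bseq x \<Longrightarrow> x k \<in> vcarrier V"
  by (simp add: bseq_def)

lemma bseq_add:
  assumes "bseq x" "bseq y"
  shows "bseq (\<lambda>k. vadd V (x k) (y k))"
proof -
  obtain R S where "\<And>k. vnorm V (x k) \<le> R" "\<And>k. vnorm V (y k) \<le> S" using assms by (auto simp: bseq_def)
  then have "vnorm V (vadd V (x k) (y k)) \<le> R + S" for k
    using order_trans[OF norm_triangle add_mono] assms by (meson bseq_closed)
  then show ?thesis using assms by (auto simp: bseq_def closed)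
qed

lemma bseq_scale:
  assumes "bseq x"
  shows "bseq (\<lambda>k. vscale V r (x k))"
proof -
  obtain R where "\<And>k. vnorm V (x k) \<le> R" using assms by (auto simp: bseq_def)
  then have "vnorm V (vscale V r (x k)) \<le> \<bar>r\<bar> * R" for k
    using bseq_closed[OF assms] by (simp add: norm_scale mult_left_mono)
  then show ?thesis using assms by (auto simp: bseq_def closed)
qed

lemma bseq_hval: "bseq (hval t)"
proof (induction t)
  case (Base j)
  then show ?case using z_closed z_bounded by (simp add: bseq_def)
next
  case (SAdd s t)
  then show ?case using bseq_add by simp
next
  case (SScale q t)
  then show ?case using bseq_scale by simp
next
  case (Skolem \<psi> x n ts)
  have "hval (Skolem \<psi> x n ts) k \<in> vball V (real n)" for k using near_max by simp
  then show ?case by (auto simp: bseq_def vball_def)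
qed

definition udist :: "(nat \<Rightarrow> 'a) \<Rightarrow> (nat \<Rightarrow> 'a) \<Rightarrow> real" where
  "udist x y = ulim (\<lambda>k. vdist V (x k) (y k))"

definition unorm :: "(nat \<Rightarrow> 'a) \<Rightarrow> real" where
  "unorm x = ulim (\<lambda>k. vnorm V (x k))"

lemma unorm_tendsto:
  assumes "bseq x"
  shows "((\<lambda>k. vnorm V (x k)) \<longlongrightarrow> unorm x) U"
proof -
  obtain R where "\<And>k. vnorm V (x k) \<le> R" using assms by (auto simp: bseq_def)
  then show ?thesis
    unfolding unorm_def
    by (intro bounded_tendsto_ulim[of 0 _ R]) (simp_all add: norm_nonneg bseq_closed[OF assms])
qed

lemma udist_tendsto:
  assumes "bseq x" "bseq y"
  shows "((\<lambda>k. vdist V (x k) (y k)) \<longlongrightarrow> udist x y) U"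
proof -
  have "bseq (\<lambda>k. vadd V (x k) (vscale V (- 1) (y k)))"
    using assms by (intro bseq_add bseq_scale)
  from unorm_tendsto[OF this] show ?thesis
    using assms by (simp add: vdist_eq bseq_closed udist_def unorm_def)
qed

lemma udist_nonneg: "bseq x \<Longrightarrow> bseq y \<Longrightarrow> 0 \<le> udist x y"
  by (rule ulim_mono[OF tendsto_const udist_tendsto]) (auto simp: vdist_nonneg)

lemma udist_commute: "udist x y = udist y x"
  by (simp add: udist_def vdist_commute)

lemma udist_triangle:
  assumes "bseq x" "bseq y" "bseq w"
  shows "udist x w \<le> udist x y + udist y w"
  by (rule ulim_mono[OF udist_tendsto tendsto_add[OF udist_tendsto udist_tendsto]])
     (use assms vdist_triangle in \<open>auto simp: bseq_closed\<close>)

lemma udist_refl: "bseq x \<Longrightarrow> udist x x = 0"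
  by (simp add: udist_def vdist_refl bseq_closed ulim_eqI)

lemma udist_add_le:
  assumes "bseq x" "bseq y" "bseq x'" "bseq y'"
  shows "udist (\<lambda>k. vadd V (x k) (y k)) (\<lambda>k. vadd V (x' k) (y' k)) \<le> udist x x' + udist y y'"
  by (rule ulim_mono[OF udist_tendsto tendsto_add[OF udist_tendsto udist_tendsto]])
     (use assms vdist_add_le in \<open>auto simp: bseq_closed bseq_add\<close>)

lemma udist_scale:
  assumes "bseq x" "bseq y"
  shows "udist (\<lambda>k. vscale V r (x k)) (\<lambda>k. vscale V r (y k)) = \<bar>r\<bar> * udist x y"
  unfolding udist_def[of "\<lambda>k. vscale V r (x k)"]
  using assms tendsto_mult_left[OF udist_tendsto[OF assms], of "\<bar>r\<bar>"]
  by (intro ulim_eqI) (simp add: vdist_scale bseq_closed)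

lemma udist_scale_diff:
  assumes "bseq x"
  shows "udist (\<lambda>k. vscale V r (x k)) (\<lambda>k. vscale V q (x k)) = \<bar>r - q\<bar> * unorm x"
  unfolding udist_def
  using assms tendsto_mult_left[OF unorm_tendsto[OF assms], of "\<bar>r - q\<bar>"]
  by (intro ulim_eqI) (simp add: vdist_scale_diff bseq_closed)

lemma unorm_nonneg: "bseq x \<Longrightarrow> 0 \<le> unorm x"
  by (rule ulim_mono[OF tendsto_const unorm_tendsto]) (auto simp: norm_nonneg bseq_closed)

lemma unorm_diff_le:
  assumes "bseq x" "bseq y"
  shows "\<bar>unorm x - unorm y\<bar> \<le> udist x y"
  by (rule ulim_mono[OF tendsto_rabs[OF tendsto_diff[OF unorm_tendsto unorm_tendsto]] udist_tendsto])
     (use assms abs_norm_diff_le in \<open>auto simp: bseq_closed\<close>)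

text \<open>
  The bounded sequences whose classes lie in the closure of the set of named elements.
\<close>

definition H :: "(nat \<Rightarrow> 'a) set" where
  "H = {x. bseq x \<and> (\<forall>e>0. \<exists>t. udist x (hval t) < e)}"

lemma H_bseq: "x \<in> H \<Longrightarrow> bseq x"
  by (simp add: H_def)

lemma H_approx: "x \<in> H \<Longrightarrow> e > 0 \<Longrightarrow> \<exists>t. udist x (hval t) < e"
  by (simp add: H_def)

lemma hval_in_H: "hval t \<in> H"
  by (auto simp: H_def bseq_hval udist_refl intro!: exI[of _ t])

lemma H_closure:
  assumes "bseq x" "\<And>e. e > 0 \<Longrightarrow> \<exists>y\<in>H. udist x y < e"
  shows "x \<in> H"
proof -
  have "\<exists>t. udist x (hval t) < e" if "e > 0" for e
  proof -
    obtain y where y: "y \<in> H" "udist x y < e / 2" using assms(2)[of "e / 2"] \<open>e > 0\<close> by auto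
    obtain t where t: "udist y (hval t) < e / 2" using H_approx[OF y(1), of "e / 2"] \<open>e > 0\<close> by auto
    have "udist x (hval t) < e"
      using udist_triangle[OF assms(1) H_bseq[OF y(1)] bseq_hval[of t]] y(2) t by linarith
    then show ?thesis by blast
  qed
  then show ?thesis using assms(1) by (simp add: H_def)
qed

lemma H_add:
  assumes "x \<in> H" "y \<in> H"
  shows "(\<lambda>k. vadd V (x k) (y k)) \<in> H"
proof (rule H_closure)
  fix e :: real assume "e > 0"
  obtain s where s: "udist x (hval s) < e / 2" using H_approx[OF assms(1), of "e / 2"] \<open>e > 0\<close> by auto
  obtain t where t: "udist y (hval t) < e / 2" using H_approx[OF assms(2), of "e / 2"] \<open>e > 0\<close> by auto
  have "udist (\<lambda>k. vadd V (x k) (y k)) (hval (SAdd s t)) < e"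
    using udist_add_le[OF H_bseq[OF assms(1)] H_bseq[OF assms(2)] bseq_hval[of s] bseq_hval[of t]] s t
    by (simp add: hval_SAdd hval_SScale)
  then show "\<exists>w\<in>H. udist (\<lambda>k. vadd V (x k) (y k)) w < e"
    using hval_in_H by blast
qed (use assms bseq_add H_bseq in auto)

lemma H_scale:
  assumes "x \<in> H"
  shows "(\<lambda>k. vscale V r (x k)) \<in> H"
proof (rule H_closure)
  fix e :: real assume e: "e > 0"
  have x: "bseq x" by (rule H_bseq[OF assms])
  define d where "d = min 1 (e / (2 * (unorm x + 1)))"
  have d: "d > 0" "d \<le> 1" using e unorm_nonneg[OF x] by (auto simp: d_def add_nonneg_pos)
  obtain q where q: "r - d < real_of_rat q" "real_of_rat q < r" using of_rat_dense[of "r - d" r] d by auto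
  have qr: "\<bar>r - of_rat q\<bar> \<le> d" using q by linarith
  have q1: "\<bar>real_of_rat q\<bar> \<le> \<bar>r\<bar> + 1" using q d by linarith
  obtain t where t: "udist x (hval t) < e / (2 * (\<bar>r\<bar> + 1))"
    using H_approx[OF assms, of "e / (2 * (\<bar>r\<bar> + 1))"] e by (auto simp: add_nonneg_pos)
  have "udist (\<lambda>k. vscale V r (x k)) (hval (SScale q t)) \<le>
     udist (\<lambda>k. vscale V r (x k)) (\<lambda>k. vscale V (of_rat q) (x k)) +
     udist (\<lambda>k. vscale V (of_rat q) (x k)) (\<lambda>k. vscale V (of_rat q) (hval t k))"
    using udist_triangle[OF bseq_scale[OF x] bseq_scale[OF x] bseq_scale[OF bseq_hval]]
    by (simp add: hval_SAdd hval_SScale)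
  also have "\<dots> = \<bar>r - of_rat q\<bar> * unorm x + \<bar>of_rat q\<bar> * udist x (hval t)"
    using x by (simp only: udist_scale_diff udist_scale bseq_hval)
  also have "\<bar>r - of_rat q\<bar> * unorm x \<le> d * (unorm x + 1)"
    using qr unorm_nonneg[OF x] d by (intro mult_mono) auto
  also have "d * (unorm x + 1) \<le> e / (2 * (unorm x + 1)) * (unorm x + 1)"
    using unorm_nonneg[OF x] by (intro mult_right_mono) (auto simp: d_def)
  also have "\<dots> = e / 2" using unorm_nonneg[OF x] by (simp add: field_simps)
  also have "\<bar>real_of_rat q\<bar> * udist x (hval t) \<le> (\<bar>r\<bar> + 1) * udist x (hval t)"
    using q1 udist_nonneg[OF x bseq_hval] by (intro mult_right_mono) auto
  also have "\<dots> < (\<bar>r\<bar> + 1) * (e / (2 * (\<bar>r\<bar> + 1)))"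
    using t by (intro mult_strict_left_mono) auto
  also have "\<dots> = e / 2" by (simp add: field_simps)
  finally have "udist (\<lambda>k. vscale V r (x k)) (hval (SScale q t)) < e" by (simp add: hval_SScale)
  then show "\<exists>w\<in>H. udist (\<lambda>k. vscale V r (x k)) w < e" using hval_in_H by blast
qed (use assms bseq_scale H_bseq in auto)

lemma H_zero: "(\<lambda>k. vzero V) \<in> H"
  using H_scale[OF hval_in_H[of "Base 0"], of 0] by (simp add: zero_scale z_closed)

text \<open>
  The class of \<open>x\<close> in the ultrapower, represented by the distances to the named
  elements. These determine an element of the hull because the named elements are dense in it. In
  this form the hull is a set of real sequences, as is required of models.
\<close>

definition cl :: "(nat \<Rightarrow> 'a) \<Rightarrow> nat \<Rightarrow> real" where
  "cl x = (\<lambda>i. udist x (hval (from_nat i)))"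

lemma cl_eq_iff:
  assumes "x \<in> H" "y \<in> H"
  shows "cl x = cl y \<longleftrightarrow> udist x y = 0"
proof
  have x: "bseq x" and y: "bseq y" using assms H_bseq by auto
  {
    assume eq: "cl x = cl y"
    have "udist x y \<le> e" if "e > 0" for e
    proof -
      obtain t where t: "udist x (hval t) < e / 2" using H_approx[OF assms(1), of "e / 2"] \<open>e > 0\<close> by auto
      have "udist x (hval t) = udist y (hval t)"
        using fun_cong[OF eq, of "to_nat t"] by (simp add: cl_def)
      then show ?thesis
        using udist_triangle[OF x bseq_hval[of t] y] t udist_commute[of y "hval t"] by linarith
    qed
    then have "udist x y \<le> 0" using field_le_epsilon[of "udist x y" 0] by simp
    then show "udist x y = 0" using udist_nonneg[OF x y] by simp
  }
  {
    assume 0: "udist x y = 0"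
    show "cl x = cl y"
    proof
      fix i
      show "cl x i = cl y i"
        unfolding cl_def
        using udist_triangle[OF x y bseq_hval[of "from_nat i"]] udist_triangle[OF y x bseq_hval[of "from_nat i"]]
          udist_commute[of y x] 0 by linarith
    qed
  }
qed

definition rep :: "(nat \<Rightarrow> real) \<Rightarrow> nat \<Rightarrow> 'a" where
  "rep a = (SOME x. x \<in> H \<and> cl x = a)"

lemma rep:
  assumes "x \<in> H"
  shows "rep (cl x) \<in> H" "cl (rep (cl x)) = cl x" "udist (rep (cl x)) x = 0"
proof -
  have "rep (cl x) \<in> H \<and> cl (rep (cl x)) = cl x"
    unfolding rep_def using assms by (intro someI_ex[of "\<lambda>y. y \<in> H \<and> cl y = cl x"]) auto
  then show "rep (cl x) \<in> H" "cl (rep (cl x)) = cl x" by auto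
  with assms show "udist (rep (cl x)) x = 0" using cl_eq_iff by auto
qed

definition W :: "(nat \<Rightarrow> real) space" where
  "W = \<lparr> vcarrier = cl ` H,
         vzero = cl (\<lambda>k. vzero V),
         vadd = (\<lambda>a b. cl (\<lambda>k. vadd V (rep a k) (rep b k))),
         vscale = (\<lambda>r a. cl (\<lambda>k. vscale V r (rep a k))),
         vnorm = (\<lambda>a. unorm (rep a)) \<rparr>"

lemma W_carrier: "vcarrier W = cl ` H" and W_zero: "vzero W = cl (\<lambda>k. vzero V)"
  by (simp_all add: W_def)

lemma W_add:
  assumes "x \<in> H" "y \<in> H"
  shows "vadd W (cl x) (cl y) = cl (\<lambda>k. vadd V (x k) (y k))"
proof -
  note b = H_bseq[OF rep(1)[OF assms(1)]] H_bseq[OF rep(1)[OF assms(2)]] H_bseq[OF assms(1)] H_bseq[OF assms(2)]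
  have "udist (\<lambda>k. vadd V (rep (cl x) k) (rep (cl y) k)) (\<lambda>k. vadd V (x k) (y k)) \<le> 0"
    using udist_add_le[OF b] rep(3)[OF assms(1)] rep(3)[OF assms(2)] by simp
  moreover have "0 \<le> udist (\<lambda>k. vadd V (rep (cl x) k) (rep (cl y) k)) (\<lambda>k. vadd V (x k) (y k))"
    using b by (intro udist_nonneg bseq_add)
  ultimately show ?thesis
    using cl_eq_iff[OF H_add[OF rep(1)[OF assms(1)] rep(1)[OF assms(2)]] H_add[OF assms]] by (simp add: W_def)
qed

lemma W_scale:
  assumes "x \<in> H"
  shows "vscale W r (cl x) = cl (\<lambda>k. vscale V r (x k))"
  using cl_eq_iff[OF H_scale[OF rep(1)[OF assms]] H_scale[OF assms], of r r]
    udist_scale[OF H_bseq[OF rep(1)[OF assms]] H_bseq[OF assms], of r] rep(3)[OF assms]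
  by (simp add: W_def)

lemma W_norm:
  assumes "x \<in> H"
  shows "vnorm W (cl x) = unorm x"
  using unorm_diff_le[OF H_bseq[OF rep(1)[OF assms]] H_bseq[OF assms]] rep(3)[OF assms]
  by (simp add: W_def)

lemma vnormed_W: "vnormed W"
proof
  show "vzero W \<in> vcarrier W" using H_zero by (simp add: W_carrier W_zero)
  fix a b c r s
  {
    assume "a \<in> vcarrier W" "b \<in> vcarrier W"
    then obtain x y where [simp]: "a = cl x" "b = cl y" and H: "x \<in> H" "y \<in> H" by (auto simp: W_carrier)
    note [simp] = H_bseq[OF H(1), THEN bseq_closed] H_bseq[OF H(2), THEN bseq_closed]
    show "vadd W a b \<in> vcarrier W" using H by (simp add: W_carrier W_add H_add)
    show "vadd W a b = vadd W b a" using H by (simp add: W_add add_commute)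
    show "vscale W r (vadd W a b) = vadd W (vscale W r a) (vscale W r b)"
      using H by (simp add: W_add W_scale H_add H_scale scale_add_right)
    show "vnorm W (vadd W a b) \<le> vnorm W a + vnorm W b"
      using H by (simp add: W_add W_norm H_add)
        (rule ulim_mono[OF unorm_tendsto tendsto_add[OF unorm_tendsto unorm_tendsto]],
         auto simp: bseq_add H_bseq norm_triangle)
    {
      assume "c \<in> vcarrier W"
      then obtain w where [simp]: "c = cl w" and w: "w \<in> H" by (auto simp: W_carrier)
      note [simp] = H_bseq[OF w, THEN bseq_closed]
      show "vadd W (vadd W a b) c = vadd W a (vadd W b c)"
        using H w by (simp add: W_add H_add add_assoc)
    }
  }
  {
    assume "a \<in> vcarrier W"
    then obtain x where [simp]: "a = cl x" and x: "x \<in> H" by (auto simp: W_carrier)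
    note [simp] = H_bseq[OF x, THEN bseq_closed]
    show "vscale W r a \<in> vcarrier W" using x by (simp add: W_carrier W_scale H_scale)
    show "vadd W (vzero W) a = a" using x by (simp add: W_zero W_add H_zero add_zero)
    show "\<exists>b\<in>vcarrier W. vadd W a b = vzero W"
      using x by (intro bexI[of _ "cl (\<lambda>k. vscale V (- 1) (x k))"])
        (simp_all add: W_add W_zero H_scale add_neg W_carrier)
    show "vscale W (r + s) a = vadd W (vscale W r a) (vscale W s a)"
      using x by (simp add: W_add W_scale H_scale scale_add_left)
    show "vscale W r (vscale W s a) = vscale W (r * s) a"
      using x by (simp add: W_scale H_scale scale_scale)
    show "vscale W 1 a = a" using x by (simp add: W_scale scale_one)
    have "udist x (\<lambda>k. vzero V) = unorm x"
      by (simp add: udist_def unorm_def vdist_eq closed scale_zero add_zero_right)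
    then show "vnorm W a = 0 \<longleftrightarrow> a = vzero W"
      using x cl_eq_iff[OF x H_zero] by (simp add: W_norm W_zero)
    show "vnorm W (vscale W r a) = \<bar>r\<bar> * vnorm W a"
    proof -
      have "unorm (\<lambda>k. vscale V r (x k)) = \<bar>r\<bar> * unorm x"
        unfolding unorm_def[of "\<lambda>k. vscale V r (x k)"]
        using tendsto_mult_left[OF unorm_tendsto[OF H_bseq[OF x]], of "\<bar>r\<bar>"]
        by (intro ulim_eqI) (simp add: norm_scale)
      then show ?thesis using x by (simp add: W_norm W_scale H_scale)
    qed
  }
qed

lemma W_dist:
  assumes "x \<in> H" "y \<in> H"
  shows "vdist W (cl x) (cl y) = udist x y"
proof -
  have "vdist W (cl x) (cl y) = unorm (\<lambda>k. vadd V (x k) (vscale V (- 1) (y k)))"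
    using assms by (simp add: vdist_def W_carrier W_add W_scale W_norm H_add H_scale)
  then show ?thesis
    using assms by (simp add: unorm_def udist_def vdist_eq H_bseq bseq_closed)
qed

lemma vseparable_W: "vseparable W"
  unfolding vnormed.vseparable_iff[OF vnormed_W]
proof (intro exI[of _ "cl ` range hval"] conjI ballI allI impI)
  show "countable (cl ` range hval)" by simp
  show "cl ` range hval \<subseteq> vcarrier W" using hval_in_H by (auto simp: W_carrier)
  fix a and e :: real assume "a \<in> vcarrier W" "e > 0"
  then obtain x where x: "a = cl x" "x \<in> H" by (auto simp: W_carrier)
  then obtain t where "udist x (hval t) < e" using H_approx \<open>e > 0\<close> by blast
  then show "\<exists>c\<in>cl ` range hval. vdist W a c < e"
    using x by (auto simp: W_dist hval_in_H intro!: bexI[of _ "cl (hval t)"])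
qed

text \<open>
  This is where the ultrapower is used to obtain limits. Pass to a subsequence \<open>w\<close>
  with geometric distances. For each \<open>j\<close> the estimates between \<open>w 0, \<dots>, w
  j\<close> hold in almost all factors \<open>k\<close>; let \<open>J k\<close> be the largest
  \<open>j \<le> k\<close> for which they hold in the factor \<open>k\<close>, and let the limit
  have \<open>w (J k) k\<close> as its \<open>k\<close>-th entry.
\<close>

lemma H_complete:
  fixes x :: "nat \<Rightarrow> nat \<Rightarrow> 'a"
  assumes x: "\<And>i. x i \<in> H" and cauchy: "\<And>e. e > 0 \<Longrightarrow> \<exists>N. \<forall>i\<ge>N. \<forall>l\<ge>N. udist (x i) (x l) < e"
  shows "\<exists>y\<in>H. \<forall>e>0. \<exists>N. \<forall>i\<ge>N. udist (x i) y < e"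
proof -
  have "\<forall>j. \<exists>N. \<forall>i\<ge>N. \<forall>l\<ge>N. udist (x i) (x l) < (1 / 2) ^ j" using cauchy by simp
  then obtain m where m: "\<And>j i l. i \<ge> m j \<Longrightarrow> l \<ge> m j \<Longrightarrow> udist (x i) (x l) < (1 / 2) ^ j" by metis
  (* The partial sums of the thresholds are monotone and dominate each of them. *)
  define M where "M j = (\<Sum>i\<le>j. m i)" for j
  have M: "m i \<le> M j" if "i \<le> j" for i j
    unfolding M_def using that by (intro member_le_sum) auto
  define w where "w j = x (M j)" for j
  have w: "udist (w i) (w l) < (1 / 2) ^ i" if "i \<le> l" for i l
    unfolding w_def using that by (intro m M) auto
  have wH: "w j \<in> H" for j using x by (simp add: w_def)
  note wb = H_bseq[OF wH]
  define A where "A j k \<longleftrightarrow> j \<le> k \<and> (\<forall>l\<le>j. \<forall>i\<le>l. vdist V (w i k) (w l k) < (1 / 2) ^ i)" for j k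
  have ev: "\<forall>\<^sub>F k in U. A j k" for j
  proof -
    have "\<forall>\<^sub>F k in U. j \<le> k" by (intro eventually_U eventually_ge_at_top)
    moreover have "\<forall>\<^sub>F k in U. \<forall>l\<in>{..j}. \<forall>i\<in>{..l}. vdist V (w i k) (w l k) < (1 / 2) ^ i"
    proof (intro eventually_ball_finite finite_atMost ballI)
      fix l i :: nat assume "i \<in> {..l}"
      then show "\<forall>\<^sub>F k in U. vdist V (w i k) (w l k) < (1 / 2) ^ i"
        using order_tendstoD(2)[OF udist_tendsto[OF wb wb] w] by auto
    qed
    ultimately show ?thesis by eventually_elim (auto simp: A_def)
  qed
  define J where "J k = Max {j. A j k}" for k
  define y where "y k = w (J k) k" for k
  have fin: "finite {j. A j k}" for k by (rule finite_subset[of _ "{..k}"]) (auto simp: A_def)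
  have A0: "A 0 k" for k using wb by (auto simp: A_def vdist_refl bseq_closed)
  have AJ: "A (J k) k" for k
    using Max_in[OF fin, of k] A0[of k] by (auto simp: J_def)
  have J: "j \<le> J k" if "A j k" for j k
    unfolding J_def using fin that by (intro Max_ge) auto
  have near: "vdist V (w j k) (y k) < (1 / 2) ^ j" if "A j k" for j k
    using AJ[of k] J[OF that] by (auto simp: A_def y_def)
  have yc: "y k \<in> vcarrier V" for k using wb by (simp add: y_def bseq_closed)
  have yb: "bseq y"
  proof -
    obtain R where R: "\<And>k. vnorm V (w 0 k) \<le> R" using wb[of 0] by (auto simp: bseq_def)
    have "vnorm V (y k) \<le> R + 1" for k
      using abs_norm_diff_le[OF bseq_closed[OF wb] yc, of 0 k k] near[OF A0, of k] R[of k] by simp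
    then show ?thesis using yc by (auto simp: bseq_def)
  qed
  have lim: "udist (w j) y \<le> (1 / 2) ^ j" for j
    by (rule ulim_mono[OF udist_tendsto[OF wb yb] tendsto_const eventually_mono[OF ev[of j]]])
       (use near in \<open>auto intro: less_imp_le\<close>)
  have half: "\<exists>j. (1 / 2) ^ j < e" if "e > 0" for e :: real
    using real_arch_pow_inv[OF that, of "1 / 2"] by auto
  have "y \<in> H"
  proof (rule H_closure[OF yb])
    fix e :: real assume "e > 0"
    then obtain j where "(1 / 2) ^ j < e" using half by blast
    then show "\<exists>v\<in>H. udist y v < e" using lim[of j] wH udist_commute[of y] by (intro bexI[of _ "w j"]) auto
  qed
  moreover have "\<exists>N. \<forall>i\<ge>N. udist (x i) y < e" if e: "e > 0" for e
  proof -
    obtain j where j: "(1 / 2) ^ j < e / 2" using half[of "e / 2"] e by auto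
    have "udist (x i) y < e" if "i \<ge> M j" for i
    proof -
      have "udist (x i) (w j) < (1 / 2) ^ j"
        unfolding w_def using that M[of j j] by (intro m) auto
      then show ?thesis
        using udist_triangle[OF H_bseq[OF x] wb[of j] yb, of i] lim[of j] j by linarith
    qed
    then show ?thesis by blast
  qed
  ultimately show ?thesis by blast
qed

lemma vbanach_W: "vbanach W"
  unfolding vbanach_iff
proof (intro conjI allI impI vnormed_W)
  fix \<sigma> :: "nat \<Rightarrow> nat \<Rightarrow> real" assume \<sigma>: "\<forall>n. \<sigma> n \<in> vcarrier W"
    and cauchy: "\<forall>e>0. \<exists>N. \<forall>n\<ge>N. \<forall>m\<ge>N. vdist W (\<sigma> n) (\<sigma> m) < e"
  have "\<forall>n. \<exists>x. x \<in> H \<and> \<sigma> n = cl x" using \<sigma> by (auto simp: W_carrier)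
  then obtain x where x: "\<And>n. x n \<in> H" "\<And>n. \<sigma> n = cl (x n)" by metis
  have "\<exists>y\<in>H. \<forall>e>0. \<exists>N. \<forall>i\<ge>N. udist (x i) y < e"
    by (rule H_complete) (use cauchy x in \<open>auto simp: W_dist\<close>)
  then obtain y where y: "y \<in> H" "\<forall>e>0. \<exists>N. \<forall>i\<ge>N. udist (x i) y < e" by blast
  then show "\<exists>a\<in>vcarrier W. \<forall>e>0. \<exists>N. \<forall>n\<ge>N. vdist W (\<sigma> n) a < e"
    using x by (intro bexI[of _ "cl y"]) (auto simp: W_dist W_carrier)
qed

end

section \<open>The theorem of Los for the hull\<close>

lemma tendsto_fun_componentwise:
  fixes f :: "'c \<Rightarrow> 'i \<Rightarrow> 'b::topological_space"
  assumes "\<And>i. ((\<lambda>k. f k i) \<longlongrightarrow> l i) F"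
  shows "(f \<longlongrightarrow> l) F"
proof -
  have "limitin (product_topology (\<lambda>_. euclidean) UNIV) f l F"
    using assms by (simp add: limitin_componentwise)
  then show ?thesis by (simp add: euclidean_product_topology)
qed

context skolem_hull
begin

text \<open>
  An assignment into the ultrapower is given by sequences, and its \<open>k\<close>-th slice is an
  assignment into \<open>V\<close>.
\<close>

definition slice :: "(nat \<Rightarrow> nat \<Rightarrow> 'a) \<Rightarrow> nat \<Rightarrow> nat \<Rightarrow> 'a" where
  "slice s k = (\<lambda>v. s v k)"

lemma slice_update: "slice (s(x := a)) k = (slice s k)(x := a k)"
  by (auto simp: slice_def)

definition hull_assignment :: "real \<Rightarrow> (nat \<Rightarrow> nat \<Rightarrow> 'a) \<Rightarrow> bool" where
  "hull_assignment R s \<longleftrightarrow> (\<forall>v. s v \<in> H) \<and> (\<forall>k. bounded_assignment R (slice s k))"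

lemma hull_assignment_H: "hull_assignment R s \<Longrightarrow> s v \<in> H"
  and hull_assignment_bounded: "hull_assignment R s \<Longrightarrow> bounded_assignment R (slice s k)"
  by (auto simp: hull_assignment_def)

lemma hull_assignment_update:
  "hull_assignment R s \<Longrightarrow> a \<in> H \<Longrightarrow> (\<And>k. a k \<in> vball V (real n)) \<Longrightarrow> hull_assignment (max R (real n)) (s(x := a))"
  by (simp add: hull_assignment_def slice_update bounded_assignment_update)

lemma fvalue_tendsto:
  assumes "wf_form \<phi>" "hull_assignment R s"
  shows "((\<lambda>k. fvalue V (slice s k) \<phi>) \<longlongrightarrow> ulim (\<lambda>k. fvalue V (slice s k) \<phi>)) U"
proof -
  obtain B where B: "\<And>s. bounded_assignment R s \<Longrightarrow> \<bar>fvalue V s \<phi>\<bar> \<le> B"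
    using wf_form_bounded[OF assms(1)] by blast
  have "\<bar>fvalue V (slice s k) \<phi>\<bar> \<le> B" for k
    by (rule B[OF hull_assignment_bounded[OF assms(2)]])
  then show ?thesis
    by (intro bounded_tendsto_ulim[of "- B" _ B]) (auto simp: abs_le_iff minus_le_iff)
qed

lemma W_tvalue:
  assumes "\<And>v. s v \<in> H"
  shows "tvalue W (\<lambda>v. cl (s v)) t = cl (\<lambda>k. tvalue V (slice s k) t) \<and> (\<lambda>k. tvalue V (slice s k) t) \<in> H"
proof (induction t)
  case (Var x)
  then show ?case using assms by (simp add: slice_def)
next
  case Zero
  then show ?case using H_zero by (simp add: W_zero)
next
  case (Add t u)
  then show ?case by (simp add: W_add H_add)
next
  case (Scale r t)
  then show ?case by (simp add: W_scale H_scale)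
qed

text \<open>
  The norm of a class may be at most \<open>n\<close> although entries of the representing
  sequence are longer. Entries that are too long are scaled down to norm \<open>n\<close>, which
  does not change the class.
\<close>

lemma W_ball:
  assumes "b \<in> vball W (real n)"
  shows "\<exists>a\<in>H. b = cl a \<and> (\<forall>k. a k \<in> vball V (real n))"
proof -
  obtain x where x: "b = cl x" "x \<in> H" and xn: "unorm x \<le> real n"
    using assms by (auto simp: vball_def W_carrier W_norm)
  note xb = H_bseq[OF x(2)]
  define c where "c k = (if vnorm V (x k) \<le> real n then 1 else real n / vnorm V (x k))" for k
  define a where "a k = vscale V (c k) (x k)" for k
  have ak: "a k \<in> vball V (real n)" for k
    using bseq_closed[OF xb] by (auto simp: a_def c_def vball_def norm_scale closed)
  have ab: "bseq a" using ak by (auto simp: bseq_def vball_def)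
  have d: "vdist V (x k) (a k) \<le> max 0 (vnorm V (x k) - real n)" for k
  proof -
    have "vdist V (x k) (a k) = \<bar>1 - c k\<bar> * vnorm V (x k)"
      using vdist_scale_diff[OF bseq_closed[OF xb], of 1 k "c k"] bseq_closed[OF xb]
      by (simp add: a_def scale_one)
    also have "\<dots> \<le> max 0 (vnorm V (x k) - real n)"
    proof (cases "vnorm V (x k) \<le> real n")
      case False
      then have "0 < vnorm V (x k)" "real n / vnorm V (x k) \<le> 1" by (auto simp: divide_le_eq)
      with False show ?thesis by (simp add: c_def left_diff_distrib)
    qed (simp add: c_def)
    finally show ?thesis .
  qed
  have "((\<lambda>k. max 0 (vnorm V (x k) - real n)) \<longlongrightarrow> max 0 (unorm x - real n)) U"
    by (intro tendsto_intros unorm_tendsto xb)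
  then have "udist x a \<le> max 0 (unorm x - real n)"
    by (rule ulim_mono[OF udist_tendsto[OF xb ab]]) (simp add: d)
  then have "udist x a = 0" using xn udist_nonneg[OF xb ab] by simp
  moreover from this have "a \<in> H"
    using x(2) by (intro H_closure[OF ab] bexI[of _ x]) (simp_all add: udist_commute)
  ultimately show ?thesis using x ak cl_eq_iff by auto
qed

text \<open>
  The case of a supremum. One inequality holds because an element of the ball of \<open>W\<close>
  has a representative with all entries in the ball of \<open>V\<close>. For the other,
  approximate \<open>\<phi>\<close> by a rational formula \<open>\<psi>\<close> and the parameters
  \<open>s v\<close> by named elements \<open>hval (t v)\<close>. The hull contains a named
  element that is almost maximal for \<open>\<psi>\<close> with the approximate parameters in each
  factor, and this element is almost maximal for \<open>\<phi>\<close> with the original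
  parameters.
\<close>

lemma W_los_sup:
  assumes wf: "wf_form \<phi>"
    and IH: "\<And>R s. hull_assignment R s \<Longrightarrow> fvalue W (\<lambda>v. cl (s v)) \<phi> = ulim (\<lambda>k. fvalue V (slice s k) \<phi>)"
    and s: "hull_assignment R s" and n: "1 \<le> n"
  shows "fvalue W (\<lambda>v. cl (s v)) (FSup x n \<phi>) = ulim (\<lambda>k. fvalue V (slice s k) (FSup x n \<phi>))"
proof (rule antisym)
  interpret W: vnormed W by (rule vnormed_W)
  define F where "F k a = fvalue V ((slice s k)(x := a)) \<phi>" for k a
  define S where "S k = (SUP a\<in>vball V (real n). F k a)" for k
  have S: "S k = fvalue V (slice s k) (FSup x n \<phi>)" for k by (simp add: S_def F_def)
  have Seq: "(\<lambda>k. fvalue V (slice s k) (FSup x n \<phi>)) = S" by (simp only: S[abs_def])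
  have St: "(S \<longlongrightarrow> ulim S) U"
    using fvalue_tendsto[of "FSup x n \<phi>", OF _ s] wf n unfolding S[abs_def] by simp
  obtain B where B: "\<And>s. bounded_assignment (max (R + 1) (real n)) s \<Longrightarrow> \<bar>fvalue V s \<phi>\<bar> \<le> B"
    using wf_form_bounded[OF wf] by blast
  have s1: "bounded_assignment (R + 1) (slice s k)" for k
    using bounded_assignment_mono[OF hull_assignment_bounded[OF s]] by simp
  have FB: "\<bar>F k a\<bar> \<le> B" if "a \<in> vball V (real n)" for k a
    unfolding F_def by (rule B[OF bounded_assignment_update[OF s1 that]])
  have FS: "F k a \<le> S k" if "a \<in> vball V (real n)" for k a
    unfolding S_def
  proof (rule cSUP_upper[OF that])
    show "bdd_above (F k ` vball V (real n))"
      by (rule bdd_aboveI2[of _ _ B]) (use FB abs_le_D1 in blast)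
  qed
  have val: "fvalue W ((\<lambda>v. cl (s v))(x := cl a)) \<phi> = ulim (\<lambda>k. F k (a k))"
    and Ft: "((\<lambda>k. F k (a k)) \<longlongrightarrow> ulim (\<lambda>k. F k (a k))) U"
    if a: "a \<in> H" "\<And>k. a k \<in> vball V (real n)" for a
  proof -
    have g: "hull_assignment (max R (real n)) (s(x := a))" using hull_assignment_update[OF s a] .
    have "(\<lambda>v. cl ((s(x := a)) v)) = (\<lambda>v. cl (s v))(x := cl a)" by auto
    then show "fvalue W ((\<lambda>v. cl (s v))(x := cl a)) \<phi> = ulim (\<lambda>k. F k (a k))"
      using IH[OF g] by (simp add: F_def slice_update)
    show "((\<lambda>k. F k (a k)) \<longlongrightarrow> ulim (\<lambda>k. F k (a k))) U"
      using fvalue_tendsto[OF wf g] by (simp add: F_def slice_update)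
  qed
  have le: "fvalue W ((\<lambda>v. cl (s v))(x := b)) \<phi> \<le> ulim S" if b: "b \<in> vball W (real n)" for b
  proof -
    obtain a where a: "a \<in> H" "b = cl a" "\<And>k. a k \<in> vball V (real n)" using W_ball[OF b] by blast
    have "ulim (\<lambda>k. F k (a k)) \<le> ulim S"
      by (rule ulim_mono[OF Ft[OF a(1,3)] St]) (simp add: FS a(3))
    then show ?thesis using val[OF a(1,3)] a(2) by simp
  qed
  show "fvalue W (\<lambda>v. cl (s v)) (FSup x n \<phi>) \<le> ulim (\<lambda>k. fvalue V (slice s k) (FSup x n \<phi>))"
    unfolding Seq unfolding fvalue.simps by (rule cSUP_least[OF W.vball_nonempty le])
  show "ulim (\<lambda>k. fvalue V (slice s k) (FSup x n \<phi>)) \<le> fvalue W (\<lambda>v. cl (s v)) (FSup x n \<phi>)"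
  proof (rule field_le_epsilon)
    fix e0 :: real assume "e0 > 0"
    (* Five errors: the change of the formula and of the parameters, each on both sides of the
       comparison, and the gap \<open>1 / (k + 1)\<close> of the almost maximal element. *)
    define e where "e = e0 / 5"
    have e: "e > 0" using \<open>e0 > 0\<close> by (simp add: e_def)
    let ?R = "max (R + 1) (real n)"
    obtain \<psi> where \<psi>: "\<And>t. bounded_assignment ?R t \<Longrightarrow> \<bar>fvalue V t \<phi> - fvalue V t (form_of_rform \<psi>)\<bar> \<le> e"
      using form_approxE[OF wf_form_approx[OF wf] e, of ?R] by blast
    obtain d where d: "d > 0" and unif: "\<And>t t'. bounded_assignment ?R t \<Longrightarrow> bounded_assignment ?R t' \<Longrightarrow>
        (\<forall>v\<in>fvars \<phi>. vdist V (t v) (t' v) \<le> d) \<Longrightarrow> \<bar>fvalue V t \<phi> - fvalue V t' \<phi>\<bar> \<le> e"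
      using wf_form_uniformly_continuous[OF wf e, of ?R] by blast
    define d1 where "d1 = min d 1"
    have d1: "d1 > 0" "d1 \<le> d" "d1 \<le> 1" using d by (auto simp: d1_def)
    obtain N where N: "fvars \<phi> \<subseteq> {..<N}"
      using finite_nat_iff_bounded[of "fvars \<phi>"] finite_fvars by blast
    have "\<forall>v. \<exists>t. udist (s v) (hval t) < d1" using H_approx[OF hull_assignment_H[OF s] d1(1)] by blast
    then obtain t where t: "\<And>v. udist (s v) (hval (t v)) < d1" by metis
    define ts where "ts = map t [0..<N]"
    define \<sigma> where "\<sigma> k = nth_default (vzero V) (map (\<lambda>t. hval t k) ts)" for k
    have \<sigma>: "\<sigma> k v = (if v < N then hval (t v) k else vzero V)" for k v
      by (simp add: \<sigma>_def ts_def nth_default_def)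
    define a where "a = hval (Skolem \<psi> x n ts)"
    have a: "a \<in> H" unfolding a_def by (rule hval_in_H)
    have ak: "a k \<in> vball V (real n)" for k using near_max by (simp add: a_def)
    have amax: "(SUP c\<in>vball V (real n). fvalue V ((\<sigma> k)(x := c)) (form_of_rform \<psi>)) - 1 / real (Suc k)
        \<le> fvalue V ((\<sigma> k)(x := a k)) (form_of_rform \<psi>)" for k
      using near_max[of \<psi> x n k "\<sigma> k"] by (simp add: a_def \<sigma>_def)
    have "\<forall>\<^sub>F k in U. \<forall>v\<in>{..<N}. vdist V (s v k) (hval (t v) k) < d1"
      using order_tendstoD(2)[OF udist_tendsto[OF H_bseq[OF hull_assignment_H[OF s]] bseq_hval] t]
      by (intro eventually_ball_finite) auto
    moreover have "\<forall>\<^sub>F k in U. 1 / real (Suc k) < e"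
      by (intro eventually_U order_tendstoD(2)[OF LIMSEQ_Suc[OF lim_1_over_n]] e)
    ultimately have "\<forall>\<^sub>F k in U. S k \<le> F k (a k) + 5 * e"
    proof eventually_elim
      case (elim k)
      have \<sigma>b: "bounded_assignment (R + 1) (\<sigma> k)"
        unfolding bounded_assignment_def
      proof
        fix v
        have R0: "0 \<le> R"
          using hull_assignment_bounded[OF s, of k] norm_nonneg by (force simp: bounded_assignment_def intro: order_trans)
        have sv: "s v k \<in> vcarrier V" "vnorm V (s v k) \<le> R"
          using hull_assignment_bounded[OF s, of k] by (auto simp: bounded_assignment_def slice_def)
        have hv: "hval (t v) k \<in> vcarrier V" using bseq_closed[OF bseq_hval] .
        show "\<sigma> k v \<in> vcarrier V \<and> vnorm V (\<sigma> k v) \<le> R + 1"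
        proof (cases "v < N")
          case True
          have "vdist V (s v k) (hval (t v) k) < 1" using elim(1) True d1(3) by force
          then show ?thesis
            using abs_norm_diff_le[OF sv(1) hv] sv(2) hv True by (simp add: \<sigma>)
        qed (use R0 in \<open>simp add: \<sigma> closed\<close>)
      qed
      have cmp: "\<bar>F k c - fvalue V ((\<sigma> k)(x := c)) (form_of_rform \<psi>)\<bar> \<le> 2 * e" if c: "c \<in> vball V (real n)" for c
      proof -
        note b1 = bounded_assignment_update[OF s1 c, of k x] and b2 = bounded_assignment_update[OF \<sigma>b c, of x]
        have "\<bar>F k c - fvalue V ((\<sigma> k)(x := c)) \<phi>\<bar> \<le> e"
          unfolding F_def
        proof (rule unif[OF b1 b2], rule ballI)
          fix v assume "v \<in> fvars \<phi>"
          then have "v < N" using N by auto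
          then show "vdist V (((slice s k)(x := c)) v) (((\<sigma> k)(x := c)) v) \<le> d"
            using elim(1) d1(2) d c by (force simp: slice_def \<sigma> vdist_refl vball_def)
        qed
        moreover have "\<bar>p - r\<bar> \<le> 2 * e" if "\<bar>p - q\<bar> \<le> e" "\<bar>q - r\<bar> \<le> e" for p q r
          using that by linarith
        ultimately show ?thesis using \<psi>[OF b2] by blast
      qed
      let ?G = "\<lambda>c. fvalue V ((\<sigma> k)(x := c)) (form_of_rform \<psi>)"
      have "\<bar>S k - (SUP c\<in>vball V (real n). ?G c)\<bar> \<le> 2 * e"
        unfolding S_def by (rule abs_cSUP_diff_le[OF vball_nonempty FB cmp])
      moreover have "p \<le> q + 5 * e"
        if "\<bar>p - p'\<bar> \<le> 2 * e" "p' - t \<le> q'" "t < e" "\<bar>q - q'\<bar> \<le> 2 * e" for p p' q q' t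
        using that by linarith
      ultimately show ?case using amax[of k] elim(2) cmp[OF ak[of k]] by blast
    qed
    then have "ulim S \<le> ulim (\<lambda>k. F k (a k)) + 5 * e"
      by (rule ulim_mono[OF St tendsto_add[OF Ft[OF a ak] tendsto_const]])
    also have "ulim (\<lambda>k. F k (a k)) \<le> (SUP b\<in>vball W (real n). fvalue W ((\<lambda>v. cl (s v))(x := b)) \<phi>)"
    proof -
      have "cl a \<in> vball W (real n)"
      proof -
        have "unorm a \<le> real n"
          by (rule ulim_mono[OF unorm_tendsto[OF H_bseq[OF a]] tendsto_const]) (use ak in \<open>simp add: vball_def\<close>)
        then show ?thesis using a by (simp add: vball_def W_carrier W_norm)
      qed
      moreover have "bdd_above ((\<lambda>b. fvalue W ((\<lambda>v. cl (s v))(x := b)) \<phi>) ` vball W (real n))"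
        using le by (rule bdd_aboveI2)
      ultimately show ?thesis
        unfolding val[OF a ak, symmetric] by (rule cSUP_upper)
    qed
    finally show "ulim (\<lambda>k. fvalue V (slice s k) (FSup x n \<phi>)) \<le> fvalue W (\<lambda>v. cl (s v)) (FSup x n \<phi>) + e0"
      unfolding Seq unfolding fvalue.simps by (simp add: e_def)
  qed
qed

text \<open>
  The theorem of Los, restricted to the hull. Infima are reduced to suprema of the negated
  formula.
\<close>

theorem W_los:
  "wf_form \<phi> \<Longrightarrow> hull_assignment R s \<Longrightarrow> fvalue W (\<lambda>v. cl (s v)) \<phi> = ulim (\<lambda>k. fvalue V (slice s k) \<phi>)"
proof (induction \<phi> arbitrary: R s)
  case (Norm t)
  then show ?case
    using W_tvalue[of s t] hull_assignment_H by (simp add: W_norm unorm_def)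
next
  case (Conn u \<phi>s)
  let ?v = "\<lambda>k. nth_default 0 (map (fvalue V (slice s k)) \<phi>s)"
  let ?l = "nth_default 0 (map (fvalue W (\<lambda>v. cl (s v))) \<phi>s)"
  have "(?v \<longlongrightarrow> ?l) U"
  proof (rule tendsto_fun_componentwise)
    fix i
    show "((\<lambda>k. ?v k i) \<longlongrightarrow> ?l i) U"
    proof (cases "i < length \<phi>s")
      case True
      then have "\<phi>s ! i \<in> set \<phi>s" by simp
      with Conn have "wf_form (\<phi>s ! i)" "fvalue W (\<lambda>v. cl (s v)) (\<phi>s ! i) = ulim (\<lambda>k. fvalue V (slice s k) (\<phi>s ! i))"
        by auto
      then show ?thesis
        using True fvalue_tendsto[OF _ Conn.prems(2), of "\<phi>s ! i"] by (simp add: nth_default_nth)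
    qed (simp add: nth_default_beyond)
  qed
  moreover have "isCont u ?l"
    using Conn.prems by (simp add: continuous_on_eq_continuous_at)
  ultimately have "((\<lambda>k. u (?v k)) \<longlongrightarrow> u ?l) U"
    by (rule isCont_tendsto_compose[rotated])
  then show ?case using ulim_eqI by simp
next
  case (FSup x n \<phi>)
  show ?case
    by (rule W_los_sup[OF _ FSup.IH FSup.prems(2)]) (use FSup.prems in auto)
next
  case (FInf x n \<phi>)
  let ?\<psi> = "Conn (\<lambda>y. - y 0) [\<phi>]"
  have wf: "wf_form \<phi>" "wf_form ?\<psi>" "1 \<le> n"
    using FInf.prems by (auto intro!: continuous_intros continuous_on_product_coordinates)
  have inf: "fvalue V' t (FInf x n \<phi>) = - fvalue V' t (FSup x n ?\<psi>)" for V' :: "'x space" and t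
    by (simp add: INF_real_uminus)
  have "fvalue W (\<lambda>v. cl (s v)) ?\<psi> = ulim (\<lambda>k. fvalue V (slice s k) ?\<psi>)" if "hull_assignment R s" for R s
    using FInf.IH[OF wf(1) that] ulim_eqI[OF tendsto_minus[OF fvalue_tendsto[OF wf(1) that]]] by simp
  then have "fvalue W (\<lambda>v. cl (s v)) (FSup x n ?\<psi>) = ulim (\<lambda>k. fvalue V (slice s k) (FSup x n ?\<psi>))"
    by (rule W_los_sup[OF wf(2) _ FInf.prems(2) wf(3)])
  moreover have "wf_form (FSup x n ?\<psi>)" using wf by auto
  ultimately show ?case
    using ulim_eqI[OF tendsto_minus[OF fvalue_tendsto[OF _ FInf.prems(2), of "FSup x n ?\<psi>"]]]
    unfolding inf by simp
qed

text \<open>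
  For sentences the sequence of values in the factors is constant.
\<close>

corollary W_theory:
  assumes "wf_form \<phi>"
  shows "fvalue W (\<lambda>_. vzero W) \<phi> = fvalue V (\<lambda>_. vzero V) \<phi>"
proof -
  have "hull_assignment 0 (\<lambda>_ _. vzero V)"
    by (simp add: hull_assignment_def H_zero bounded_assignment_def slice_def closed)
  from W_los[OF assms this] show ?thesis
    by (simp add: slice_def W_zero ulim_eqI)
qed

end

section \<open>Linear isometries between spaces\<close>

definition linear_isometry :: "'a space \<Rightarrow> 'b space \<Rightarrow> ('a \<Rightarrow> 'b) \<Rightarrow> bool" where
  "linear_isometry V W g \<longleftrightarrow> bij_betw g (vcarrier V) (vcarrier W) \<and> g (vzero V) = vzero W \<and>
     (\<forall>x\<in>vcarrier V. \<forall>y\<in>vcarrier V. g (vadd V x y) = vadd W (g x) (g y)) \<and>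
     (\<forall>r. \<forall>x\<in>vcarrier V. g (vscale V r x) = vscale W r (g x)) \<and>
     (\<forall>x\<in>vcarrier V. vnorm W (g x) = vnorm V x)"

lemma linear_isometryD:
  assumes "linear_isometry V W g"
  shows "x \<in> vcarrier V \<Longrightarrow> g x \<in> vcarrier W" "inj_on g (vcarrier V)" "g ` vcarrier V = vcarrier W"
    "g (vzero V) = vzero W"
    "x \<in> vcarrier V \<Longrightarrow> y \<in> vcarrier V \<Longrightarrow> g (vadd V x y) = vadd W (g x) (g y)"
    "x \<in> vcarrier V \<Longrightarrow> g (vscale V r x) = vscale W r (g x)"
    "x \<in> vcarrier V \<Longrightarrow> vnorm W (g x) = vnorm V x"
  using assms by (auto simp: linear_isometry_def bij_betw_def)

lemma linear_isometry_comp: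
  assumes "linear_isometry V W g" "linear_isometry W X h"
  shows "linear_isometry V X (h \<circ> g)"
  using assms linear_isometryD(1)[OF assms(1)]
  by (auto simp: linear_isometry_def intro: bij_betw_trans)

lemma linear_isometry_vnormed:
  assumes V: "vnormed V" and g: "linear_isometry V W g"
  shows "vnormed W"
proof -
  interpret vnormed V by (rule V)
  note im = linear_isometryD(3)[OF g, symmetric]
  note G = linear_isometryD[OF g]
  have inj: "g x = g y \<longleftrightarrow> x = y" if "x \<in> vcarrier V" "y \<in> vcarrier V" for x y
    using G(2) that by (auto dest: inj_onD)
  show ?thesis
  proof
    show "vzero W \<in> vcarrier W" using G(1)[OF zero_closed] G(4) by simp
    fix a b c r s
    {
      assume "a \<in> vcarrier W" "b \<in> vcarrier W"
      then obtain x y where ab: "a = g x" "b = g y" and xy: "x \<in> vcarrier V" "y \<in> vcarrier V"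
        unfolding im by auto
      show "vadd W a b \<in> vcarrier W" using G(1)[OF add_closed[OF xy]] G(5)[OF xy] ab by simp
      show "vadd W a b = vadd W b a" using G(5)[OF xy] G(5)[OF xy(2,1)] add_commute[OF xy] ab by simp
      show "vscale W r (vadd W a b) = vadd W (vscale W r a) (vscale W r b)"
        unfolding ab using xy
        by (simp only: G(5)[symmetric] G(6)[symmetric] add_closed scale_closed scale_add_right)
      show "vnorm W (vadd W a b) \<le> vnorm W a + vnorm W b"
        unfolding ab using xy by (simp only: G(5)[symmetric] G(7) add_closed norm_triangle)
      {
        assume "c \<in> vcarrier W"
        then obtain w where c: "c = g w" and w: "w \<in> vcarrier V" unfolding im by auto
        show "vadd W (vadd W a b) c = vadd W a (vadd W b c)"
          unfolding ab c using xy w by (simp only: G(5)[symmetric] add_closed add_assoc)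
      }
    }
    {
      assume "a \<in> vcarrier W"
      then obtain x where a: "a = g x" and x: "x \<in> vcarrier V" unfolding im by auto
      show "vscale W r a \<in> vcarrier W"
        unfolding a using x by (simp only: G(6)[symmetric] G(1) scale_closed)
      show "vadd W (vzero W) a = a"
        unfolding a G(4)[symmetric] using x by (simp only: G(5)[symmetric] zero_closed add_zero)
      show "\<exists>b\<in>vcarrier W. vadd W a b = vzero W"
        unfolding a G(4)[symmetric] using x
        by (intro bexI[of _ "g (vscale V (- 1) x)"]) (simp_all only: G(1) G(5)[symmetric] scale_closed add_neg)
      show "vscale W (r + s) a = vadd W (vscale W r a) (vscale W s a)"
        unfolding a using x by (simp only: G(5)[symmetric] G(6)[symmetric] scale_closed scale_add_left)
      show "vscale W r (vscale W s a) = vscale W (r * s) a"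
        unfolding a using x by (simp only: G(6)[symmetric] scale_closed scale_scale)
      show "vscale W 1 a = a"
        unfolding a using x by (simp only: G(6)[symmetric] scale_one)
      show "vnorm W a = 0 \<longleftrightarrow> a = vzero W"
        unfolding a G(4)[symmetric] using x by (simp only: G(7) inj zero_closed norm_eq_zero)
      show "vnorm W (vscale W r a) = \<bar>r\<bar> * vnorm W a"
        unfolding a using x by (simp only: G(6)[symmetric] G(7) scale_closed norm_scale)
    }
  qed
qed

lemma linear_isometry_vdist:
  assumes V: "vnormed V" and g: "linear_isometry V W g" and x: "x \<in> vcarrier V" "y \<in> vcarrier V"
  shows "vdist W (g x) (g y) = vdist V x y"
proof -
  interpret vnormed V by (rule V)
  note G = linear_isometryD[OF g]
  show ?thesis
    using x by (simp add: vdist_def G(1)) (simp only: G(5)[symmetric] G(6)[symmetric] G(7) closed)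
qed

lemma linear_isometry_vbanach:
  assumes V: "vbanach V" and g: "linear_isometry V W g"
  shows "vbanach W"
proof -
  have Vn: "vnormed V" using V by (simp add: vbanach_def)
  note G = linear_isometryD[OF g] and d = linear_isometry_vdist[OF Vn g]
  show ?thesis
    unfolding vbanach_iff
  proof (intro conjI allI impI linear_isometry_vnormed[OF Vn g])
    fix \<sigma> :: "nat \<Rightarrow> 'b"
    assume "\<forall>n. \<sigma> n \<in> vcarrier W" and cauchy: "\<forall>e>0. \<exists>N. \<forall>n\<ge>N. \<forall>m\<ge>N. vdist W (\<sigma> n) (\<sigma> m) < e"
    then have "\<forall>n. \<exists>x. x \<in> vcarrier V \<and> \<sigma> n = g x" unfolding G(3)[symmetric] by auto
    then obtain x where x: "\<And>n. x n \<in> vcarrier V" "\<And>n. \<sigma> n = g (x n)" by metis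
    have "\<forall>e>0. \<exists>N. \<forall>n\<ge>N. \<forall>m\<ge>N. vdist V (x n) (x m) < e"
      using cauchy by (simp add: x d)
    then obtain y where "y \<in> vcarrier V" "\<forall>e>0. \<exists>N. \<forall>n\<ge>N. vdist V (x n) y < e"
      using V x(1) unfolding vbanach_iff by blast
    then show "\<exists>y\<in>vcarrier W. \<forall>e>0. \<exists>N. \<forall>n\<ge>N. vdist W (\<sigma> n) y < e"
      by (intro bexI[of _ "g y"]) (simp_all add: x d G(1))
  qed
qed

lemma linear_isometry_vseparable:
  assumes V: "vnormed V" "vseparable V" and g: "linear_isometry V W g"
  shows "vseparable W"
proof -
  note G = linear_isometryD[OF g] and d = linear_isometry_vdist[OF V(1) g]
  obtain C where C: "countable C" "C \<subseteq> vcarrier V" "\<And>x e. x \<in> vcarrier V \<Longrightarrow> e > 0 \<Longrightarrow> \<exists>c\<in>C. vdist V x c < e"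
    using V(2) unfolding vnormed.vseparable_iff[OF V(1)] by blast
  show ?thesis
    unfolding vnormed.vseparable_iff[OF linear_isometry_vnormed[OF V(1) g]]
  proof (intro exI[of _ "g ` C"] conjI ballI allI impI)
    show "g ` C \<subseteq> vcarrier W" using C(2) G(1) by blast
    fix a and e :: real assume "a \<in> vcarrier W" "e > 0"
    then obtain x where x: "x \<in> vcarrier V" "a = g x" unfolding G(3)[symmetric] by auto
    obtain c where "c \<in> C" "vdist V x c < e" using C(3)[OF x(1) \<open>e > 0\<close>] by blast
    then show "\<exists>c\<in>g ` C. vdist W a c < e"
      using C(2) x by (auto simp: d subset_iff intro!: bexI[of _ "g c"])
  qed (use C in simp)
qed

lemma linear_isometry_tvalue:
  assumes V: "vnormed V" and g: "linear_isometry V W g" and s: "\<And>v. s v \<in> vcarrier V"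
  shows "tvalue W (g \<circ> s) t = g (tvalue V s t)"
proof -
  interpret vnormed V by (rule V)
  note G = linear_isometryD[OF g]
  show ?thesis
    by (induction t) (simp_all add: G(4) tvalue_closed[OF s] G(5) G(6))
qed

lemma linear_isometry_vball:
  assumes "linear_isometry V W g"
  shows "vball W r = g ` vball V r"
proof -
  note G = linear_isometryD[OF assms]
  show ?thesis
    unfolding vball_def G(3)[symmetric] using G(7) by auto
qed

text \<open>
  Isomorphic structures have the same theory.
\<close>

lemma linear_isometry_fvalue:
  assumes V: "vnormed V" and g: "linear_isometry V W g"
  shows "(\<And>v. s v \<in> vcarrier V) \<Longrightarrow> fvalue W (g \<circ> s) \<phi> = fvalue V s \<phi>"
proof (induction \<phi> arbitrary: s)
  case (Norm t)
  then show ?case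
    by (simp only: fvalue.simps linear_isometry_tvalue[OF V g] linear_isometryD(7)[OF g]
        vnormed.tvalue_closed[OF V])
next
  case (Conn u \<phi>s)
  then show ?case by (simp cong: map_cong)
next
  case (FSup x n \<phi>)
  have "fvalue W ((g \<circ> s)(x := g a)) \<phi> = fvalue V (s(x := a)) \<phi>" if "a \<in> vball V (real n)" for a
  proof -
    have "(g \<circ> s)(x := g a) = g \<circ> s(x := a)" by (auto simp: fun_eq_iff)
    moreover have "(s(x := a)) v \<in> vcarrier V" for v using FSup.prems that by (simp add: vball_def)
    ultimately show ?thesis using FSup.IH[of "s(x := a)"] by (simp only:)
  qed
  then show ?case
    unfolding fvalue.simps linear_isometry_vball[OF g] image_image
    by (intro arg_cong[of _ _ Sup] image_cong refl)
next
  case (FInf x n \<phi>)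
  have "fvalue W ((g \<circ> s)(x := g a)) \<phi> = fvalue V (s(x := a)) \<phi>" if "a \<in> vball V (real n)" for a
  proof -
    have "(g \<circ> s)(x := g a) = g \<circ> s(x := a)" by (auto simp: fun_eq_iff)
    moreover have "(s(x := a)) v \<in> vcarrier V" for v using FInf.prems that by (simp add: vball_def)
    ultimately show ?thesis using FInf.IH[of "s(x := a)"] by (simp only:)
  qed
  then show ?case
    unfolding fvalue.simps linear_isometry_vball[OF g] image_image
    by (intro arg_cong[of _ _ Inf] image_cong refl)
qed

definition transport :: "('a \<Rightarrow> 'b) \<Rightarrow> 'a space \<Rightarrow> 'b space" where
  "transport g V = (let h = inv_into (vcarrier V) g in
     \<lparr> vcarrier = g ` vcarrier V, vzero = g (vzero V),
       vadd = (\<lambda>a b. g (vadd V (h a) (h b))),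
       vscale = (\<lambda>r a. g (vscale V r (h a))),
       vnorm = (\<lambda>a. vnorm V (h a)) \<rparr>)"

lemma linear_isometry_transport:
  "inj_on g (vcarrier V) \<Longrightarrow> linear_isometry V (transport g V) g"
  by (simp add: linear_isometry_def transport_def Let_def bij_betw_def)

lemma contains_isometric_copy_linear_isometry:
  assumes V: "vnormed V" and g: "linear_isometry V W g" and copy: "contains_isometric_copy W Y"
  shows "contains_isometric_copy V Y"
proof -
  interpret vnormed V by (rule V)
  note G = linear_isometryD[OF g]
  define h where "h = inv_into (vcarrier V) g"
  have gh: "g (h a) = a" and hc: "h a \<in> vcarrier V" if "a \<in> vcarrier W" for a
    using that unfolding h_def G(3)[symmetric] by (auto simp: f_inv_into_f inv_into_into)
  have eqI: "x = y" if "g x = g y" "x \<in> vcarrier V" "y \<in> vcarrier V" for x y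
    using inj_onD[OF G(2)] that by blast
  have hg: "h (g x) = x" if "x \<in> vcarrier V" for x
    using inv_into_f_f[OF G(2) that] by (simp add: h_def)
  obtain S T where sub: "vsubspace W S" and bij: "bij_betw T (vcarrier Y) S"
    and add: "\<And>x y. x \<in> vcarrier Y \<Longrightarrow> y \<in> vcarrier Y \<Longrightarrow> T (vadd Y x y) = vadd W (T x) (T y)"
    and scale: "\<And>r x. x \<in> vcarrier Y \<Longrightarrow> T (vscale Y r x) = vscale W r (T x)"
    and norm: "\<And>x. x \<in> vcarrier Y \<Longrightarrow> vnorm W (T x) = vnorm Y x"
    using copy unfolding contains_isometric_copy_def isometric_copy_def by blast
  have SW: "S \<subseteq> vcarrier W" using sub by (simp add: vsubspace_def)
  have h_add: "h (vadd W a b) = vadd V (h a) (h b)" if "a \<in> vcarrier W" "b \<in> vcarrier W" for a b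
    using G(5)[OF hc[OF that(1)] hc[OF that(2)]] hg[OF add_closed[OF hc[OF that(1)] hc[OF that(2)]]] gh that
    by simp
  have h_scale: "h (vscale W r a) = vscale V r (h a)" if "a \<in> vcarrier W" for a r
    using G(6)[OF hc[OF that]] hg[OF scale_closed[OF hc[OF that]]] gh[OF that] by metis
  have TS: "T x \<in> S" if "x \<in> vcarrier Y" for x using bij that by (auto simp: bij_betw_def)
  have inj_h: "inj_on h S" by (metis gh SW inj_onI subsetD)
  have "isometric_copy Y V (h ` S)"
    unfolding isometric_copy_def
  proof (intro conjI exI[of _ "h \<circ> T"] ballI allI)
    show "vsubspace V (h ` S)"
      unfolding vsubspace_def
    proof (intro conjI ballI allI)
      show "h ` S \<subseteq> vcarrier V" using hc SW by auto
      have "h (vzero W) = vzero V" using hg[OF zero_closed] G(4) by simp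
      then show "vzero V \<in> h ` S" using sub unfolding vsubspace_def by force
      fix x y r
      { assume "x \<in> h ` S" "y \<in> h ` S"
        then obtain a b where ab: "x = h a" "y = h b" "a \<in> S" "b \<in> S" by auto
        then have "vadd V x y = h (vadd W a b)" using h_add[of a b] SW by (metis subsetD)
        then show "vadd V x y \<in> h ` S" using sub ab unfolding vsubspace_def by simp }
      { assume "x \<in> h ` S"
        then obtain a where a: "x = h a" "a \<in> S" by auto
        then have "vscale V r x = h (vscale W r a)" using h_scale[of a r] SW by (metis subsetD)
        then show "vscale V r x \<in> h ` S" using sub a unfolding vsubspace_def by simp }
    qed
    show "bij_betw (h \<circ> T) (vcarrier Y) (h ` S)"
      using bij inj_h by (auto intro: bij_betw_trans simp: bij_betw_def comp_inj_on image_comp[symmetric])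
    fix x y r assume x: "x \<in> vcarrier Y"
    show "(h \<circ> T) (vscale Y r x) = vscale V r ((h \<circ> T) x)"
      using scale[OF x] h_scale TS[OF x] SW by auto
    show "vnorm V ((h \<circ> T) x) = vnorm Y x"
      using norm[OF x] G(7)[OF hc] gh TS[OF x] SW by (metis comp_apply subsetD)
    assume y: "y \<in> vcarrier Y"
    show "(h \<circ> T) (vadd Y x y) = vadd V ((h \<circ> T) x) ((h \<circ> T) y)"
      using add[OF x y] h_add TS[OF x] TS[OF y] SW by auto
  qed
  then show ?thesis by (auto simp: contains_isometric_copy_def)
qed

text \<open>
  The conditions \<open>\<parallel>v\<^sub>2 - (v\<^sub>0 + v\<^sub>1)\<parallel> = 0\<close>,
  \<open>\<parallel>v\<^sub>1 - r v\<^sub>0\<parallel> = 0\<close> and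
  \<open>\<parallel>v\<^sub>0\<parallel> - \<parallel>x\<parallel> = 0\<close> belong to the types
  of \<open>(x, y, x + y)\<close>, of \<open>(x, r x)\<close> and of \<open>x\<close>.
\<close>

lemma type_preserving_bijection_linear_isometry:
  assumes V: "vnormed V" and W: "vnormed W" and f: "type_preserving_bijection V W f"
  shows "linear_isometry V W f"
proof -
  interpret V: vnormed V by (rule V)
  interpret W: vnormed W by (rule W)
  have bij: "bij_betw f (vcarrier V) (vcarrier W)"
    and types: "\<And>as. set as \<subseteq> vcarrier V \<Longrightarrow> complete_type W (map f as) = complete_type V as"
    using f by (auto simp: type_preserving_bijection_def)
  have fc: "f x \<in> vcarrier W" if "x \<in> vcarrier V" for x using bij that by (auto simp: bij_betw_def)
  have zero: "fvalue W (nth_default (vzero W) (map f as)) \<phi> = 0"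
    if "set as \<subseteq> vcarrier V" "wf_form \<phi>" "fvars \<phi> \<subseteq> {..<length as}" "fvalue V (nth_default (vzero V) as) \<phi> = 0"
    for as \<phi>
    using types[OF that(1)] that by (auto simp: complete_type_def)
  have add: "f (vadd V x y) = vadd W (f x) (f y)" if "x \<in> vcarrier V" "y \<in> vcarrier V" for x y
  proof -
    have "fvalue W (nth_default (vzero W) (map f [x, y, vadd V x y]))
        (Norm (Add (Var 2) (Scale (- 1) (Add (Var 0) (Var 1))))) = 0"
      by (rule zero) (use that in \<open>auto simp: V.closed V.add_neg nth_default_def numeral_2_eq_2\<close>)
    then have "vnorm W (vadd W (f (vadd V x y)) (vscale W (- 1) (vadd W (f x) (f y)))) = 0"
      by (simp add: nth_default_def numeral_2_eq_2)
    then show ?thesis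
      using that by (intro W.diff_eq_zero[OF _ _ W.norm_eq_zero[THEN iffD1]]) (auto simp: fc W.closed V.closed)
  qed
  have scale: "f (vscale V r x) = vscale W r (f x)" if "x \<in> vcarrier V" for r x
  proof -
    have "fvalue W (nth_default (vzero W) (map f [x, vscale V r x]))
        (Norm (Add (Var 1) (Scale (- 1) (Scale r (Var 0))))) = 0"
      by (rule zero) (use that in \<open>auto simp: V.closed V.add_neg nth_default_def\<close>)
    then have "vnorm W (vadd W (f (vscale V r x)) (vscale W (- 1) (vscale W r (f x)))) = 0"
      by (simp add: nth_default_def)
    then show ?thesis
      using that by (intro W.diff_eq_zero[OF _ _ W.norm_eq_zero[THEN iffD1]]) (auto simp: fc W.closed V.closed)
  qed
  have norm: "vnorm W (f x) = vnorm V x" if "x \<in> vcarrier V" for x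
  proof -
    have "fvalue W (nth_default (vzero W) (map f [x])) (Conn (\<lambda>y. y 0 - vnorm V x) [Norm (Var 0)]) = 0"
      by (rule zero) (use that in \<open>auto intro!: continuous_intros continuous_on_product_coordinates\<close>)
    then show ?thesis by simp
  qed
  have "f (vzero V) = vzero W"
    using scale[OF V.zero_closed, of 0] W.zero_scale[OF fc[OF V.zero_closed]] by (simp add: V.scale_zero)
  with bij add scale norm show ?thesis by (simp add: linear_isometry_def)
qed

section \<open>A separable space is isometric to a space of real sequences\<close>

text \<open>
  A point is determined by its distances to the members of a countable dense set.
\<close>

lemma separable_isometric_to_sequences:
  assumes V: "vnormed V" "vseparable V"
  shows "\<exists>g :: 'a \<Rightarrow> nat \<Rightarrow> real. linear_isometry (V :: 'a space) (transport g V) g"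
proof -
  interpret vnormed V by (rule V)
  obtain C where C: "countable C" "C \<subseteq> vcarrier V" "\<And>x e. x \<in> vcarrier V \<Longrightarrow> e > 0 \<Longrightarrow> \<exists>c\<in>C. vdist V x c < e"
    using V(2) unfolding vseparable_iff by blast
  have "C \<noteq> {}" using C(3)[OF zero_closed zero_less_one] by auto
  define g where "g x = (\<lambda>i. vdist V x (from_nat_into C i))" for x
  have "inj_on g (vcarrier V)"
  proof (rule inj_onI)
    fix x y assume xy: "x \<in> vcarrier V" "y \<in> vcarrier V" and eq: "g x = g y"
    have "vdist V x y \<le> 0 + e" if e: "e > 0" for e
    proof -
      obtain c where c: "c \<in> C" "vdist V x c < e / 2" using C(3)[OF xy(1), of "e / 2"] e by auto
      have "vdist V x c = vdist V y c"
        using fun_cong[OF eq, of "to_nat_on C c"] c(1) C(1) by (simp add: g_def)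
      then show ?thesis
        using vdist_triangle[OF xy(1) _ xy(2), of c] c C(2) vdist_commute[of c y] by auto
    qed
    then have "vdist V x y \<le> 0" by (rule field_le_epsilon)
    then have "vdist V x y = 0" using vdist_nonneg[of x y] by simp
    then show "x = y" using Metric_space.zero[OF Metric_space_vdist xy] by simp
  qed
  then show ?thesis using linear_isometry_transport by blast
qed

section \<open>Isometric copies of Hilbert space\<close>

lemma abs_powr_two: "\<bar>x\<bar> powr 2 = x\<^sup>2" for x :: real
  by (cases "x = 0") (auto simp: powr_numeral)

lemma ell2_simps:
  "x \<in> vcarrier (ell 2) \<longleftrightarrow> summable (\<lambda>n. (x n)\<^sup>2)"
  "vadd (ell 2) x y = (\<lambda>n. x n + y n)" "vscale (ell 2) r x = (\<lambda>n. r * x n)"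
  "vnorm (ell 2) x = (\<Sum>n. (x n)\<^sup>2) powr (1 / 2)"
  by (simp_all add: ell_def abs_powr_two)

lemma summable_sq_add:
  fixes x y :: "nat \<Rightarrow> real"
  assumes "summable (\<lambda>n. (x n)\<^sup>2)" "summable (\<lambda>n. (y n)\<^sup>2)"
  shows "summable (\<lambda>n. (x n + y n)\<^sup>2)"
proof (rule summable_comparison_test)
  have "(a + b)\<^sup>2 \<le> 2 * a\<^sup>2 + 2 * b\<^sup>2" for a b :: real
    using zero_le_power2[of "a - b"] by (simp add: power2_eq_square algebra_simps)
  then show "\<exists>N. \<forall>n\<ge>N. norm ((x n + y n)\<^sup>2) \<le> 2 * (x n)\<^sup>2 + 2 * (y n)\<^sup>2" by simp
  show "summable (\<lambda>n. 2 * (x n)\<^sup>2 + 2 * (y n)\<^sup>2)"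
    using assms by (intro summable_add summable_mult)
qed

text \<open>
  The partial sums of \<open>\<Sum>j. x j v j\<close> form a Cauchy sequence for every square
  summable \<open>x\<close>, and their limits \<open>T x\<close> form the copy; linearity and the
  norm pass to the limit.
\<close>

lemma contains_ell2_if_orthonormal:
  fixes V :: "'a space"
  assumes V: "vbanach V" and v: "\<And>j. v j \<in> vcarrier V"
    and norm: "\<And>x n. vnorm V (vnormed.lin V v x n) = sqrt (\<Sum>j<n. (x j)\<^sup>2)"
  shows "contains_isometric_copy V (ell 2)"
proof -
  interpret vnormed V using V by (simp add: vbanach_def)
  let ?C = "vcarrier V"
  let ?E = "vcarrier (ell 2)"
  define conv where "conv a w \<longleftrightarrow> w \<in> ?C \<and> (\<lambda>n. vdist V (a n) w) \<longlonglongrightarrow> 0" for a w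
  have conv_unique: "w = w'" if "conv a w" "conv a w'" "\<And>n. a n \<in> ?C" for a :: "nat \<Rightarrow> 'a" and w w'
  proof -
    have w: "w \<in> ?C" "w' \<in> ?C" using that by (auto simp: conv_def)
    have "(\<lambda>n. vdist V (a n) w + vdist V (a n) w') \<longlonglongrightarrow> 0 + 0"
      using that by (intro tendsto_add) (auto simp: conv_def)
    moreover have "vdist V w w' \<le> vdist V (a n) w + vdist V (a n) w'" for n
      using vdist_triangle[OF w(1) that(3) w(2), of n] vdist_commute[of w "a n"] by simp
    ultimately have "vdist V w w' \<le> 0 + 0" by (intro LIMSEQ_le_const) auto
    then have "vdist V w w' = 0" using vdist_nonneg[of w w'] by simp
    then show ?thesis using Metric_space.zero[OF Metric_space_vdist w] by simp
  qed
  have lc: "lin v x n \<in> ?C" for x n using v by (rule lin_closed)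
  have ex: "\<exists>w. conv (lin v x) w" if x: "x \<in> ?E" for x
  proof -
    have gap: "vdist V (lin v x m) (lin v x n) = sqrt (\<Sum>j=n..<m. (x j)\<^sup>2)" if "n \<le> m" for n m
    proof -
      have "lin v x n = lin v (\<lambda>j. if j < n then x j else 0) n" by (intro lin_cong) simp
      also have "\<dots> = lin v (\<lambda>j. if j < n then x j else 0) m"
        by (rule lin_extend[OF v _ that, symmetric]) simp
      finally have "vadd V (lin v x m) (vscale V (- 1) (lin v x n)) =
         lin v (\<lambda>j. x j + (- 1) * (if j < n then x j else 0)) m"
        by (simp only: lin_add[OF v] lin_scale[OF v])
      also have "\<dots> = lin v (\<lambda>j. if j < n then 0 else x j) m" by (intro lin_cong) simp
      finally have "vdist V (lin v x m) (lin v x n) = sqrt (\<Sum>j<m. (if j < n then 0 else x j)\<^sup>2)"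
        by (simp add: vdist_eq lc norm)
      also have "(\<Sum>j<m. (if j < n then 0 else x j)\<^sup>2) = (\<Sum>j=n..<m. (x j)\<^sup>2)"
        by (intro sum.mono_neutral_cong_right) auto
      finally show ?thesis .
    qed
    have "\<exists>N. \<forall>n\<ge>N. \<forall>m\<ge>N. vdist V (lin v x n) (lin v x m) < e" if e: "e > 0" for e
    proof -
      have "summable (\<lambda>n. (x n)\<^sup>2)" using x by (simp add: ell2_simps)
      then obtain N where N: "\<And>m n. m \<ge> N \<Longrightarrow> norm (\<Sum>j=m..<n. (x j)\<^sup>2) < e\<^sup>2"
        using e unfolding summable_Cauchy by (metis zero_less_power)
      have *: "vdist V (lin v x m) (lin v x n) < e" if "N \<le> n" "n \<le> m" for n m
        using N[OF that(1), of m] e by (simp add: gap[OF that(2)] real_less_lsqrt sum_nonneg)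
      have "vdist V (lin v x n) (lin v x m) < e" if "N \<le> n" "N \<le> m" for n m
        using *[of n m] *[of m n] that vdist_commute[of "lin v x n" "lin v x m"]
        by (cases "n \<le> m") simp_all
      then show ?thesis by blast
    qed
    then have "\<exists>w\<in>?C. \<forall>e>0. \<exists>N. \<forall>n\<ge>N. vdist V (lin v x n) w < e"
      using V[unfolded vbanach_iff, THEN conjunct2, THEN spec, THEN mp, THEN mp, of "lin v x"]
      by (simp add: lc)
    then obtain w where "w \<in> ?C" "\<forall>e>0. \<exists>N. \<forall>n\<ge>N. vdist V (lin v x n) w < e" ..
    then show ?thesis
      by (intro exI[of _ w]) (simp add: conv_def LIMSEQ_iff vdist_nonneg)
  qed
  define T where "T x = (SOME w. conv (lin v x) w)" for x
  have T: "conv (lin v x) (T x)" if "x \<in> ?E" for x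
    unfolding T_def using ex[OF that] by (rule someI_ex)
  have TC: "T x \<in> ?C" if "x \<in> ?E" for x using T[OF that] by (simp add: conv_def)
  have T_eq: "T x = w" if "x \<in> ?E" "conv (lin v x) w" for x w
    using conv_unique[OF T[OF that(1)] that(2) lc] .
  have add: "T (\<lambda>n. x n + y n) = vadd V (T x) (T y)" if xy: "x \<in> ?E" "y \<in> ?E" for x y
  proof (rule T_eq)
    show "(\<lambda>n. x n + y n) \<in> ?E" using xy summable_sq_add by (simp add: ell2_simps)
    have lim: "(\<lambda>n. vdist V (lin v x n) (T x) + vdist V (lin v y n) (T y)) \<longlonglongrightarrow> 0 + 0"
      using T[OF xy(1)] T[OF xy(2)] by (intro tendsto_add) (auto simp: conv_def)
    have le: "vdist V (lin v (\<lambda>n. x n + y n) n) (vadd V (T x) (T y)) \<le>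
       vdist V (lin v x n) (T x) + vdist V (lin v y n) (T y)" for n
      unfolding lin_add[OF v] by (rule vdist_add_le[OF lc lc TC[OF xy(1)] TC[OF xy(2)]])
    have "(\<lambda>n. vdist V (lin v (\<lambda>n. x n + y n) n) (vadd V (T x) (T y))) \<longlonglongrightarrow> 0"
    proof (rule Lim_null_comparison)
      show "\<forall>\<^sub>F n in sequentially. norm (vdist V (lin v (\<lambda>n. x n + y n) n) (vadd V (T x) (T y))) \<le>
          vdist V (lin v x n) (T x) + vdist V (lin v y n) (T y)"
        using le by (simp add: vdist_nonneg)
    qed (use lim in simp)
    then show "conv (lin v (\<lambda>n. x n + y n)) (vadd V (T x) (T y))"
      using TC xy by (simp add: conv_def closed)
  qed
  have scale: "T (\<lambda>n. r * x n) = vscale V r (T x)" if x: "x \<in> ?E" for r x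
  proof (rule T_eq)
    show "(\<lambda>n. r * x n) \<in> ?E" using x by (simp add: ell2_simps power_mult_distrib summable_mult)
    have "(\<lambda>n. \<bar>r\<bar> * vdist V (lin v x n) (T x)) \<longlonglongrightarrow> \<bar>r\<bar> * 0"
      using T[OF x] by (intro tendsto_mult_left) (simp add: conv_def)
    then show "conv (lin v (\<lambda>n. r * x n)) (vscale V r (T x))"
      using TC[OF x] by (simp add: conv_def closed lin_scale[OF v] vdist_scale lc)
  qed
  have T_norm: "vnorm V (T x) = sqrt (\<Sum>n. (x n)\<^sup>2)" if x: "x \<in> ?E" for x
  proof (rule LIMSEQ_unique)
    have "(\<lambda>n. \<Sum>j<n. (x j)\<^sup>2) \<longlonglongrightarrow> (\<Sum>n. (x n)\<^sup>2)"
      using x by (intro summable_LIMSEQ) (simp add: ell2_simps)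
    then show "(\<lambda>n. vnorm V (lin v x n)) \<longlonglongrightarrow> sqrt (\<Sum>n. (x n)\<^sup>2)"
      unfolding norm by (rule tendsto_real_sqrt)
    have "(\<lambda>n. vnorm V (lin v x n) - vnorm V (T x)) \<longlonglongrightarrow> 0"
    proof (rule Lim_null_comparison)
      show "\<forall>\<^sub>F n in sequentially. norm (vnorm V (lin v x n) - vnorm V (T x)) \<le> vdist V (lin v x n) (T x)"
        using abs_norm_diff_le[OF lc TC[OF x]] by simp
    qed (use T[OF x] in \<open>simp add: conv_def\<close>)
    then show "(\<lambda>n. vnorm V (lin v x n)) \<longlonglongrightarrow> vnorm V (T x)" by (simp add: LIM_zero_iff)
  qed
  have inj: "inj_on T ?E"
  proof (rule inj_onI)
    fix x y assume xy: "x \<in> ?E" "y \<in> ?E" and eq: "T x = T y"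
    have my: "(\<lambda>n. (- 1) * y n) \<in> ?E" using xy by (simp add: ell2_simps)
    have d: "(\<lambda>n. x n + (- 1) * y n) \<in> ?E"
      using summable_sq_add[of x "\<lambda>n. (- 1) * y n"] xy my by (simp only: ell2_simps)
    have "T (\<lambda>n. x n + (- 1) * y n) = vzero V"
      using add[OF xy(1) my] scale[OF xy(2), of "- 1"] add_neg[OF TC[OF xy(2)]] eq by simp
    then have "sqrt (\<Sum>n. (x n + (- 1) * y n)\<^sup>2) = 0" using T_norm[OF d] by simp
    then have "\<forall>n. (x n + (- 1) * y n)\<^sup>2 = 0"
      using d by (subst (asm) real_sqrt_eq_zero_cancel_iff, subst suminf_eq_zero_iff[symmetric])
        (simp_all only: ell2_simps zero_le_power2)
    then show "x = y" by (simp add: fun_eq_iff)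
  qed
  have zeroE: "(\<lambda>n. 0) \<in> ?E" by (simp add: ell2_simps)
  have T0: "T (\<lambda>n. 0) = vzero V"
    using scale[OF zeroE, of 0] zero_scale[OF TC[OF zeroE]] by simp
  have "isometric_copy (ell 2) V (T ` ?E)"
    unfolding isometric_copy_def
  proof (intro conjI exI[of _ T] ballI allI)
    show "vsubspace V (T ` ?E)"
      unfolding vsubspace_def
    proof (intro conjI ballI allI)
      show "T ` ?E \<subseteq> ?C" using TC by auto
      show "vzero V \<in> T ` ?E" using T0 zeroE by (metis imageI)
      fix a b r
      { assume "a \<in> T ` ?E" "b \<in> T ` ?E"
        then obtain x y where xy: "a = T x" "b = T y" "x \<in> ?E" "y \<in> ?E" by auto
        then have "vadd V a b = T (\<lambda>n. x n + y n)" by (simp add: add)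
        moreover have "(\<lambda>n. x n + y n) \<in> ?E" using xy summable_sq_add by (simp add: ell2_simps)
        ultimately show "vadd V a b \<in> T ` ?E" by simp }
      { assume "a \<in> T ` ?E"
        then obtain x where x: "a = T x" "x \<in> ?E" by auto
        then have "vscale V r a = T (\<lambda>n. r * x n)" by (simp add: scale)
        moreover have "(\<lambda>n. r * x n) \<in> ?E" using x by (simp add: ell2_simps power_mult_distrib summable_mult)
        ultimately show "vscale V r a \<in> T ` ?E" by simp }
    qed
    show "bij_betw T ?E (T ` ?E)" using inj by (simp add: bij_betw_def)
    fix x assume x: "x \<in> ?E"
    show "vnorm V (T x) = vnorm (ell 2) x"
      using x by (simp add: T_norm ell2_simps powr_half_sqrt suminf_nonneg)
    show "T (vscale (ell 2) r x) = vscale V r (T x)" for r using x by (simp add: ell2_simps(3) scale)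
    fix y assume "y \<in> ?E"
    then show "T (vadd (ell 2) x y) = vadd V (T x) (T y)" using x by (simp add: ell2_simps(2) add)
  qed
  then show ?thesis by (auto simp: contains_isometric_copy_def)
qed

section \<open>A separable elementarily equivalent space containing Hilbert space\<close>

text \<open>
  A sequence of elements of the ultrapower is obtained by applying Dvoretzky's theorem for each
  \<open>k\<close> to the first \<open>k\<close> members of an enumeration of all rational
  vectors. The rational vectors are coded as lists, extended by zeros.
\<close>

lemma (in vnormed) Dvoretzky_diagonal:
  assumes "infinite_dimensional V"
  shows "\<exists>z :: nat \<Rightarrow> nat \<Rightarrow> 'a. (\<forall>j k. z j k \<in> vcarrier V) \<and> (\<forall>j k. vnorm V (z j k) \<le> 2) \<and>
    (\<forall>c :: rat list. (\<lambda>k. vnorm V (lin (\<lambda>j. z j k) (nth_default 0 (map of_rat c)) (length c)))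
        \<longlonglongrightarrow> sqrt (\<Sum>j<length c. (nth_default 0 (map of_rat c) j)\<^sup>2))"
proof -
  define q where "q c = (nth_default 0 (map of_rat c) :: nat \<Rightarrow> real)" for c :: "rat list"
  define unit where "unit j = (\<lambda>i. if j = i then 1 else 0 :: real)" for j :: nat
  (* The unit vectors are included only to bound the norms of the vectors obtained. *)
  define A where "A r = (\<lambda>i. q (from_nat i)) ` {..r} \<union> unit ` {..<r}" for r :: nat
  have "\<exists>y. (\<forall>j. y j \<in> vcarrier V) \<and>
     (\<forall>x\<in>A r. \<bar>vnorm V (lin y x r) - sqrt (\<Sum>j<r. (x j)\<^sup>2)\<bar> < 1 / real (Suc r))" for r
    by (rule Dvoretzky[OF assms]) (auto simp: A_def)
  then obtain y where y: "\<And>r j. y r j \<in> vcarrier V"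
    "\<And>r x. x \<in> A r \<Longrightarrow> \<bar>vnorm V (lin (y r) x r) - sqrt (\<Sum>j<r. (x j)\<^sup>2)\<bar> < 1 / real (Suc r)"
    by metis
  (* Nothing bounds the norm of \<open>y k j\<close> for \<open>j \<ge> k\<close>. *)
  define z where "z j k = (if j < k then y k j else vzero V)" for j k
  have zc: "z j k \<in> vcarrier V" for j k using y(1) by (simp add: z_def closed)
  have zb: "vnorm V (z j k) \<le> 2" for j k
  proof (cases "j < k")
    case True
    have lin_unit: "lin (y k) (unit j) n = (if j < n then y k j else vzero V)" for n
      by (induction n) (auto simp: unit_def y(1) closed add_zero add_zero_right zero_scale scale_one less_Suc_eq)
    have "(\<Sum>i<k. (unit j i)\<^sup>2) = (\<Sum>i<k. if i = j then 1 else 0)"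
      by (intro sum.cong) (auto simp: unit_def)
    then have "\<bar>vnorm V (y k j) - 1\<bar> < 1 / real (Suc k)"
      using y(2)[of "unit j" k] True lin_unit[of k] by (simp add: A_def)
    moreover have "1 / real (Suc k) \<le> 1" by simp
    ultimately have "vnorm V (y k j) \<le> 2" by linarith
    then show ?thesis using True by (simp add: z_def)
  qed (simp add: z_def)
  have lim: "(\<lambda>k. vnorm V (lin (\<lambda>j. z j k) (q c) (length c))) \<longlonglongrightarrow> sqrt (\<Sum>j<length c. (q c j)\<^sup>2)" for c
  proof -
    have q0: "q c j = 0" if "length c \<le> j" for j using that by (simp add: q_def nth_default_beyond)
    have "norm (vnorm V (lin (\<lambda>j. z j k) (q c) (length c)) - sqrt (\<Sum>j<length c. (q c j)\<^sup>2)) \<le> 1 / real (Suc k)"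
      if k: "k \<ge> max (length c) (to_nat c)" for k
    proof -
      have "lin (\<lambda>j. z j k) (q c) n = lin (y k) (q c) n" if "n \<le> k" for n
        using that by (induction n) (simp_all add: z_def)
      then have "lin (\<lambda>j. z j k) (q c) (length c) = lin (y k) (q c) (length c)" using k by simp
      also have "\<dots> = lin (y k) (q c) k"
        by (rule lin_extend[OF y(1) q0, symmetric]) (use k in auto)
      finally have 1: "lin (\<lambda>j. z j k) (q c) (length c) = lin (y k) (q c) k" .
      have 2: "(\<Sum>j<length c. (q c j)\<^sup>2) = (\<Sum>j<k. (q c j)\<^sup>2)"
        using k q0 by (intro sum.mono_neutral_left) auto
      have "q c \<in> A k" using k by (auto simp: A_def intro!: image_eqI[of _ _ "to_nat c"])
      from y(2)[OF this] show ?thesis unfolding 1 2 by simp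
    qed
    then have "\<forall>\<^sub>F k in sequentially. norm (vnorm V (lin (\<lambda>j. z j k) (q c) (length c)) - sqrt (\<Sum>j<length c. (q c j)\<^sup>2)) \<le> 1 / real (Suc k)"
      unfolding eventually_sequentially by blast
    from Lim_null_comparison[OF this LIMSEQ_Suc[OF lim_1_over_n]]
    show ?thesis by (simp add: LIM_zero_iff)
  qed
  show ?thesis
    using zc zb lim unfolding q_def by blast
qed

text \<open>
  In the hull of the sequences found above, combinations with rational coefficients have exactly
  the Euclidean norm, since their norms are limits along the ultrafilter; real coefficients follow
  by continuity.
\<close>

theorem separable_model_containing_ell2:
  fixes V :: "'a space"
  assumes V: "vnormed V" and inf: "infinite_dimensional V"
  shows "\<exists>W :: (nat \<Rightarrow> real) space. vbanach W \<and> vseparable W \<and> contains_isometric_copy W (ell 2) \<and>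
     (\<forall>\<phi>. wf_form \<phi> \<longrightarrow> fvalue W (\<lambda>_. vzero W) \<phi> = fvalue V (\<lambda>_. vzero V) \<phi>)"
proof -
  interpret vnormed V by (rule V)
  obtain U where U: "free_ultrafilter U" using free_ultrafilter_exists by blast
  obtain z :: "nat \<Rightarrow> nat \<Rightarrow> 'a" where zc: "\<And>j k. z j k \<in> vcarrier V" and zb: "\<And>j k. vnorm V (z j k) \<le> 2"
    and lim: "\<And>c :: rat list. (\<lambda>k. vnorm V (lin (\<lambda>j. z j k) (nth_default 0 (map of_rat c)) (length c)))
        \<longlonglongrightarrow> sqrt (\<Sum>j<length c. (nth_default 0 (map of_rat c) j)\<^sup>2)"
    using Dvoretzky_diagonal[OF inf] by blast
  have zR: "\<exists>R. \<forall>k. vnorm V (z j k) \<le> R" for j using zb by blast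
  interpret skolem_hull V U z
    by unfold_locales (use U zc zR in auto)
  interpret W: vnormed W by (rule vnormed_W)
  have zH: "z j \<in> H" for j
  proof -
    have "hval (Base j) = z j" by (simp add: fun_eq_iff)
    then show ?thesis using hval_in_H by metis
  qed
  define v where "v j = cl (z j)" for j
  have vc: "v j \<in> vcarrier W" for j using zH by (simp add: v_def W_carrier)
  have lin: "W.lin v x n = cl (\<lambda>k. lin (\<lambda>j. z j k) x n) \<and> (\<lambda>k. lin (\<lambda>j. z j k) x n) \<in> H" for x n
    by (induction n) (simp_all add: W_zero H_zero v_def zH W_scale W_add H_scale H_add)
  (* The coefficients have to be rational for \<open>lim\<close> to apply: only countably many
     coefficient vectors were taken into account. *)
  have rat: "vnorm W (W.lin v x n) = sqrt (\<Sum>j<n. (x j)\<^sup>2)" if x: "\<And>j. x j \<in> \<rat>" for x n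
  proof -
    have "\<forall>j. \<exists>r. x j = of_rat r" using x by (auto elim: Rats_cases)
    then obtain r where r: "\<And>j. x j = of_rat (r j)" by metis
    define c where "c = map r [0..<n]"
    have cx: "nth_default 0 (map of_rat c) j = x j" if "j < n" for j
      using that by (simp add: c_def nth_default_def r)
    have "(\<lambda>k. vnorm V (lin (\<lambda>j. z j k) x n)) \<longlonglongrightarrow> sqrt (\<Sum>j<n. (x j)\<^sup>2)"
    proof -
      have "lin (\<lambda>j. z j k) (nth_default 0 (map of_rat c)) n = lin (\<lambda>j. z j k) x n" for k
        using cx by (rule lin_cong)
      moreover have "(\<Sum>j<n. (nth_default 0 (map of_rat c) j)\<^sup>2) = (\<Sum>j<n. (x j)\<^sup>2)"
        using cx by (intro sum.cong) auto
      ultimately show ?thesis using lim[of c] by (simp add: c_def)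
    qed
    then have "((\<lambda>k. vnorm V (lin (\<lambda>j. z j k) x n)) \<longlongrightarrow> sqrt (\<Sum>j<n. (x j)\<^sup>2)) U"
      using U_le by (rule tendsto_mono[rotated])
    then show ?thesis
      using lin[of x n] by (simp add: W_norm unorm_def ulim_eqI)
  qed
  have norm: "vnorm W (W.lin v x n) = sqrt (\<Sum>j<n. (x j)\<^sup>2)" for x n
  proof -
    have "\<exists>r. r \<in> \<rat> \<and> \<bar>x j - r\<bar> < 1 / real (Suc m)" for m j
    proof -
      obtain r where "r \<in> \<rat>" "x j < r" "r < x j + 1 / real (Suc m)"
        using Rats_dense_in_real[of "x j" "x j + 1 / real (Suc m)"] by auto
      then show ?thesis by (intro exI[of _ r]) auto
    qed
    then have "\<forall>m. \<exists>f. \<forall>j. f j \<in> \<rat> \<and> \<bar>x j - f j\<bar> < 1 / real (Suc m)"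
      by (intro allI choice) blast
    then obtain r where "\<And>m j. r m j \<in> \<rat> \<and> \<bar>x j - r m j\<bar> < 1 / real (Suc m)"
      by metis
    then have r: "\<And>m j. r m j \<in> \<rat>" "\<And>m j. \<bar>x j - r m j\<bar> < 1 / real (Suc m)" by auto
    have rx: "(\<lambda>m. r m j) \<longlonglongrightarrow> x j" for j
    proof (rule LIM_zero_cancel, rule Lim_null_comparison)
      show "\<forall>\<^sub>F m in sequentially. norm (r m j - x j) \<le> 1 / real (Suc m)"
        using r(2)[of j] by (auto simp: abs_minus_commute intro!: always_eventually less_imp_le)
      show "(\<lambda>m. 1 / real (Suc m)) \<longlonglongrightarrow> 0" by (rule LIMSEQ_Suc[OF lim_1_over_n])
    qed
    have "(\<lambda>m. vnorm W (W.lin v (r m) n)) \<longlonglongrightarrow> sqrt (\<Sum>j<n. (x j)\<^sup>2)"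
      unfolding rat[OF r(1)] by (intro tendsto_intros rx)
    moreover have "(\<lambda>m. vnorm W (W.lin v (r m) n) - vnorm W (W.lin v x n)) \<longlonglongrightarrow> 0"
    proof (rule Lim_null_comparison)
      have "\<bar>vnorm W (W.lin v (r m) n) - vnorm W (W.lin v x n)\<bar> \<le> (\<Sum>j<n. \<bar>r m j + (- 1) * x j\<bar> * vnorm W (v j))" for m
      proof -
        have "vadd W (W.lin v (r m) n) (vscale W (- 1) (W.lin v x n)) = W.lin v (\<lambda>j. r m j + (- 1) * x j) n"
          by (simp only: W.lin_add[OF vc] W.lin_scale[OF vc])
        then show ?thesis
          using W.norm_diff_le[of "W.lin v (r m) n" "W.lin v x n"] W.lin_closed[of v, OF vc]
            W.lin_norm_le[of v "\<lambda>j. r m j + (- 1) * x j" n] vc by simp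
      qed
      then show "\<forall>\<^sub>F m in sequentially. norm (vnorm W (W.lin v (r m) n) - vnorm W (W.lin v x n)) \<le>
          (\<Sum>j<n. \<bar>r m j + (- 1) * x j\<bar> * vnorm W (v j))" by simp
      have "(\<lambda>m. \<Sum>j<n. \<bar>r m j + (- 1) * x j\<bar> * vnorm W (v j)) \<longlonglongrightarrow> (\<Sum>j<n. \<bar>x j + (- 1) * x j\<bar> * vnorm W (v j))"
        by (intro tendsto_intros rx)
      then show "(\<lambda>m. \<Sum>j<n. \<bar>r m j + (- 1) * x j\<bar> * vnorm W (v j)) \<longlonglongrightarrow> 0" by simp
    qed
    then have "(\<lambda>m. vnorm W (W.lin v (r m) n)) \<longlonglongrightarrow> vnorm W (W.lin v x n)" by (simp add: LIM_zero_iff)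
    ultimately show ?thesis by (rule LIMSEQ_unique[rotated])
  qed
  have "contains_isometric_copy W (ell 2)"
    using vbanach_W vc norm by (rule contains_ell2_if_orthonormal)
  then show ?thesis
    using vbanach_W vseparable_W W_theory by blast
qed

section \<open>Categorical spaces contain Hilbert space\<close>

theorem corollary5p14:
  fixes M :: "'a space"
  assumes "aleph0_categorical M"
  shows "(contains_isometric_copy M c_zero \<or>
            (\<exists>p::real. 1 \<le> p \<and> contains_isometric_copy M (ell p)))
         \<and> contains_isometric_copy M (ell 2)"
proof -
  have M: "vbanach M" "vnormed M" "vseparable M"
    using assms by (auto simp: aleph0_categorical_def vbanach_def)
  obtain N :: "(nat \<Rightarrow> real) space" where N: "model_of N (theory_of M)" "infinite_dimensional N"
    using assms by (auto simp: aleph0_categorical_def)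
  have cat: "\<exists>f. type_preserving_bijection N1 N2 f"
    if "model_of N1 (theory_of M)" "vseparable N1" "model_of N2 (theory_of M)" "vseparable N2"
    for N1 N2 :: "(nat \<Rightarrow> real) space"
    using assms that unfolding aleph0_categorical_def by blast
  have "vnormed N" using N by (simp add: model_of_def vbanach_def)
  from separable_model_containing_ell2[OF this N(2)]
  obtain W :: "(nat \<Rightarrow> real) space" where W: "vbanach W" "vseparable W" "contains_isometric_copy W (ell 2)"
    and eq: "\<And>\<phi>. wf_form \<phi> \<Longrightarrow> fvalue W (\<lambda>_. vzero W) \<phi> = fvalue N (\<lambda>_. vzero N) \<phi>" by blast
  (* \<open>W\<close> and \<open>N\<close> have the same sentences of value \<open>0\<close>, and
     \<open>N\<close> is a model of the theory of \<open>M\<close>. *)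
  have W_model: "model_of W (theory_of M)"
    using N(1) W(1) eq by (auto simp: model_of_def theory_of_def)
  obtain g :: "'a \<Rightarrow> nat \<Rightarrow> real" where g: "linear_isometry M (transport g M) g"
    using separable_isometric_to_sequences[OF M(2,3)] by blast
  let ?M' = "transport g M"
  have "fvalue ?M' (\<lambda>_. vzero ?M') \<phi> = fvalue M (\<lambda>_. vzero M) \<phi>" for \<phi>
    using linear_isometry_fvalue[OF M(2) g, of "\<lambda>_. vzero M" \<phi>] linear_isometryD(4)[OF g]
      vnormed.zero_closed[OF M(2)] by (simp add: comp_def)
  then have "model_of ?M' (theory_of M)"
    using linear_isometry_vbanach[OF M(1) g] by (auto simp: model_of_def theory_of_def)
  then obtain f where f: "type_preserving_bijection ?M' W f"
    using cat[OF _ linear_isometry_vseparable[OF M(2,3) g] W_model W(2)] by blast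
  have "linear_isometry ?M' W f"
    using linear_isometry_vnormed[OF M(2) g] W(1) f
    by (intro type_preserving_bijection_linear_isometry) (auto simp: vbanach_def)
  then have "linear_isometry M W (f \<circ> g)"
    using g linear_isometry_comp by blast
  then have "contains_isometric_copy M (ell 2)"
    using contains_isometric_copy_linear_isometry[OF M(2)] W(3) by blast
  moreover have "(1::real) \<le> 2" by simp
  ultimately show ?thesis by blast
qed

end
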